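(* Let $(M^4,g)$ be the cylinder $\mathbb{R}\times Y^3$, where $(Y^3,g_Y)$ is a (compact) flat torus, with product metric $g=dt^2+g_Y$, and let $\mathcal{I}$ denote the set of indicial roots of $F$. Then there exists an $\epsilon>0$ such that if $\beta\in\mathcal{I}$ with $|\mathrm{Re}(\beta)|<\epsilon$ then $\beta=0$. The corresponding kernel of $F$ has dimension $14$ and is spanned by $$\{3\,dt\otimes dt-g_Y,\ dt\odot\omega,\ B,\ tB\},$$ where $\omega$ is any parallel 1-form and $B$ is any parallel traceless symmetric 2-tensor on $Y^3$. The corresponding cokernel of $F$ (i.e. the corresponding kernel of $F^*$) has dimension $14$ and is spanned by $$\{(0,dt),\ (0,\omega_0),\ (Z,0),\ (tZ,0)\},$$ where $\omega_0$ is a parallel 1-form and $Z$ is any parallel section of $S^2_0(\Lambda^2_-)$.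
   Context: For an oriented Riemannian 4-manifold $(M,g)$, $\Lambda^2_-$ is the bundle of anti-self-dual 2-forms, $S^2_0(\cdot)$ denotes traceless symmetric 2-tensors, and $\mathcal{W}^-=\pi_-\mathcal{W}\pi_-$ (with $\mathcal W$ the Weyl curvature operator on 2-forms and $\pi_-$ the projection to $\Lambda^2_-$) is the anti-self-dual Weyl tensor; $g$ is self-dual if $\mathcal{W}^-=0$. For self-dual $g$, $\mathcal{D}=(\mathcal{W}^-)'_g:\Gamma(S^2_0(T^*M))\to\Gamma(S^2_0(\Lambda^2_-))$ is the linearization of $\mathcal{W}^-$ at $g$ and $\mathcal{D}^*$ its formal $L^2$-adjoint. Set $(\delta h)_j=\nabla^ih_{ij}$, $\delta\omega=\nabla^i\omega_i$, $(\mathcal{K}_g\omega)_{ij}=\nabla_i\omega_j+\nabla_j\omega_i-\frac12(\delta\omega)g_{ij}$. Let $F(h)=(\mathcal{D}h,2\delta h)$, from $\Gamma(S^2_0(T^*M))$ to $\Gamma(S^2_0(\Lambda^2_-))\oplus\Gamma(T^*M)$, with formal adjoint $F^*(Z,\omega)=\mathcal{D}^*Z-\mathcal{K}_g\omega$. On a cylinder $(\mathbb{R}\times Y^3,dt^2+g_Y)$ (oriented by $dt\wedge dV_Y$) the indicial roots of $F$ are those $\lambda\in\mathbb{C}$ for which there is a (nonzero) solution $h$ of $F(h)=0$ whose components have the form $e^{\lambda t}p(y,t)$ with $p$ a polynomial in $t$ with coefficients in $C^\infty(Y)$ (the solutions, or kernel, corresponding to $\lambda$); indicial roots of $F^*$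 and their kernels are defined analogously for pairs $(Z,\omega)$. For 1-forms, $\omega_1\odot\omega_2=\omega_1\otimes\omega_2+\omega_2\otimes\omega_1$. The forms $\omega_0$ are parallel on $Y^3$. *)

theory Defs
  imports "HOL-Analysis.Analysis" "HOL-Library.Function_Algebras"
begin

section \<open>Smooth functions and tensor calculus in a coordinate chart\<close>

definition partial :: "'n::finite \<Rightarrow> (real^'n \<Rightarrow> 'b::real_normed_vector) \<Rightarrow> real^'n \<Rightarrow> 'b" where
  "partial i f x = frechet_derivative f (at x) (axis i 1)"

primrec Ck :: "nat \<Rightarrow> (real^'n::finite \<Rightarrow> 'b::real_normed_vector) \<Rightarrow> bool" where
  "Ck 0 f = continuous_on UNIV f"
| "Ck (Suc m) f = ((\<forall>x. f differentiable (at x)) \<and> (\<forall>i. Ck m (partial i f)))"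

definition smooth :: "(real^'n::finite \<Rightarrow> 'b::real_normed_vector) \<Rightarrow> bool" where
  "smooth f \<longleftrightarrow> (\<forall>m. Ck m f)"

text \<open>A metric, and more generally a covariant tensor field, is given by its array of components
  in the standard coordinates; \<open>G x $ i $ j\<close> is the component \<open>g\<^sub>i\<^sub>j\<close> at \<open>x\<close>.\<close>

text \<open>\<open>christoffel G x k i j\<close> is the symbol with upper index \<open>k\<close>.\<close>

definition christoffel :: "(real^'n::finite \<Rightarrow> real^'n^'n) \<Rightarrow> real^'n \<Rightarrow> 'n \<Rightarrow> 'n \<Rightarrow> 'n \<Rightarrow> real" where
  "christoffel G x k i j = (1/2) * (\<Sum>l\<in>UNIV. matrix_inv (G x) $ k $ l *
     (partial i (\<lambda>z. G z $ j $ l) x + partial j (\<lambda>z. G z $ i $ l) x - partial l (\<lambda>z. G z $ i $ j) x))"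

text \<open>Covariant derivatives of covariant tensors of rank 1, 2 and 4; the first index argument is
  the direction of differentiation.\<close>

definition nabla1 :: "(real^'n::finite \<Rightarrow> real^'n^'n) \<Rightarrow> (real^'n \<Rightarrow> real^'n) \<Rightarrow> real^'n \<Rightarrow>
    'n \<Rightarrow> 'n \<Rightarrow> real" where
  "nabla1 G w x k i = partial k (\<lambda>z. w z $ i) x - (\<Sum>m\<in>UNIV. christoffel G x m k i * w x $ m)"

definition nabla2 :: "(real^'n::finite \<Rightarrow> real^'n^'n) \<Rightarrow> (real^'n \<Rightarrow> real^'n^'n) \<Rightarrow> real^'n \<Rightarrow>
    'n \<Rightarrow> 'n \<Rightarrow> 'n \<Rightarrow> real" where
  "nabla2 G h x k i j = partial k (\<lambda>z. h z $ i $ j) x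
     - (\<Sum>m\<in>UNIV. christoffel G x m k i * h x $ m $ j)
     - (\<Sum>m\<in>UNIV. christoffel G x m k j * h x $ i $ m)"

definition nabla4 :: "(real^'n::finite \<Rightarrow> real^'n^'n) \<Rightarrow> (real^'n \<Rightarrow> real^'n^'n^'n^'n) \<Rightarrow> real^'n \<Rightarrow>
    'n \<Rightarrow> 'n \<Rightarrow> 'n \<Rightarrow> 'n \<Rightarrow> 'n \<Rightarrow> real" where
  "nabla4 G Z x q i j k l = partial q (\<lambda>z. Z z $ i $ j $ k $ l) x
     - (\<Sum>m\<in>UNIV. christoffel G x m q i * Z x $ m $ j $ k $ l)
     - (\<Sum>m\<in>UNIV. christoffel G x m q j * Z x $ i $ m $ k $ l)
     - (\<Sum>m\<in>UNIV. christoffel G x m q k * Z x $ i $ j $ m $ l)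
     - (\<Sum>m\<in>UNIV. christoffel G x m q l * Z x $ i $ j $ k $ m)"

definition parallel1 :: "(real^'n::finite \<Rightarrow> real^'n^'n) \<Rightarrow> (real^'n \<Rightarrow> real^'n) \<Rightarrow> bool" where
  "parallel1 G w \<longleftrightarrow> smooth w \<and> (\<forall>x k i. nabla1 G w x k i = 0)"

definition parallel2 :: "(real^'n::finite \<Rightarrow> real^'n^'n) \<Rightarrow> (real^'n \<Rightarrow> real^'n^'n) \<Rightarrow> bool" where
  "parallel2 G h \<longleftrightarrow> smooth h \<and> (\<forall>x k i j. nabla2 G h x k i j = 0)"

definition parallel4 :: "(real^'n::finite \<Rightarrow> real^'n^'n) \<Rightarrow> (real^'n \<Rightarrow> real^'n^'n^'n^'n) \<Rightarrow> bool" where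
  "parallel4 G Z \<longleftrightarrow> smooth Z \<and> (\<forall>x q i j k l. nabla4 G Z x q i j k l = 0)"

definition div1 :: "(real^'n::finite \<Rightarrow> real^'n^'n) \<Rightarrow> (real^'n \<Rightarrow> real^'n) \<Rightarrow> real^'n \<Rightarrow> real" where
  "div1 G w x = (\<Sum>i\<in>UNIV. \<Sum>k\<in>UNIV. matrix_inv (G x) $ i $ k * nabla1 G w x k i)"

definition div2 :: "(real^'n::finite \<Rightarrow> real^'n^'n) \<Rightarrow> (real^'n \<Rightarrow> real^'n^'n) \<Rightarrow> real^'n \<Rightarrow> real^'n" where
  "div2 G h x = (\<chi> j. \<Sum>i\<in>UNIV. \<Sum>k\<in>UNIV. matrix_inv (G x) $ i $ k * nabla2 G h x k i j)"

text \<open>The conformal Killing operator in dimension 4.\<close>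

definition Kop :: "(real^4 \<Rightarrow> real^4^4) \<Rightarrow> (real^4 \<Rightarrow> real^4) \<Rightarrow> real^4 \<Rightarrow> real^4^4" where
  "Kop G w x = (\<chi> i j. nabla1 G w x i j + nabla1 G w x j i - (1/2) * div1 G w x * G x $ i $ j)"

definition sym_traceless :: "real^'n^'n \<Rightarrow> real^'n^'n::finite \<Rightarrow> bool" where
  "sym_traceless A H \<longleftrightarrow> (\<forall>i j. H $ i $ j = H $ j $ i) \<and>
     (\<Sum>i\<in>UNIV. \<Sum>j\<in>UNIV. matrix_inv A $ i $ j * H $ i $ j) = 0"

section \<open>The anti-self-dual Weyl tensor in dimension 4\<close>

text \<open>\<open>riem G x i j k l\<close> is \<open>g(R(\<partial>\<^sub>i,\<partial>\<^sub>j)\<partial>\<^sub>l, \<partial>\<^sub>k)\<close>, so \<open>R\<^sub>i\<^sub>j\<^sub>i\<^sub>j\<close> is positive on the round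
  sphere and the curvature operator of the unit sphere is the identity on 2-forms.\<close>

definition riem :: "(real^4 \<Rightarrow> real^4^4) \<Rightarrow> real^4 \<Rightarrow> 4 \<Rightarrow> 4 \<Rightarrow> 4 \<Rightarrow> 4 \<Rightarrow> real" where
  "riem G x i j k l = (\<Sum>m\<in>UNIV. G x $ k $ m *
     (partial i (\<lambda>z. christoffel G z m j l) x - partial j (\<lambda>z. christoffel G z m i l) x
      + (\<Sum>p\<in>UNIV. christoffel G x m i p * christoffel G x p j l
                   - christoffel G x m j p * christoffel G x p i l)))"

definition ric :: "(real^4 \<Rightarrow> real^4^4) \<Rightarrow> real^4 \<Rightarrow> 4 \<Rightarrow> 4 \<Rightarrow> real" where
  "ric G x j l = (\<Sum>i\<in>UNIV. \<Sum>k\<in>UNIV. matrix_inv (G x) $ i $ k * riem G x i j k l)"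

definition scal :: "(real^4 \<Rightarrow> real^4^4) \<Rightarrow> real^4 \<Rightarrow> real" where
  "scal G x = (\<Sum>j\<in>UNIV. \<Sum>l\<in>UNIV. matrix_inv (G x) $ j $ l * ric G x j l)"

definition weyl :: "(real^4 \<Rightarrow> real^4^4) \<Rightarrow> real^4 \<Rightarrow> 4 \<Rightarrow> 4 \<Rightarrow> 4 \<Rightarrow> 4 \<Rightarrow> real" where
  "weyl G x i j k l = riem G x i j k l
     - (1/2) * (G x $ i $ k * ric G x j l - G x $ i $ l * ric G x j k
                - G x $ j $ k * ric G x i l + G x $ j $ l * ric G x i k)
     + (scal G x / 6) * (G x $ i $ k * G x $ j $ l - G x $ i $ l * G x $ j $ k)"

text \<open>A 2-form is its antisymmetric component matrix \<open>w $ i $ j = w(\<partial>\<^sub>i, \<partial>\<^sub>j)\<close>.\<close>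

definition weyl_op :: "(real^4 \<Rightarrow> real^4^4) \<Rightarrow> real^4 \<Rightarrow> real^4^4 \<Rightarrow> real^4^4" where
  "weyl_op G x w = (\<chi> i j. (1/2) * (\<Sum>k\<in>UNIV. \<Sum>l\<in>UNIV. \<Sum>a\<in>UNIV. \<Sum>b\<in>UNIV.
     weyl G x i j k l * matrix_inv (G x) $ k $ a * matrix_inv (G x) $ l $ b * w $ a $ b))"

text \<open>The Levi-Civita symbol. The orientation is that of the coordinates \<open>1, 2, 3, 4\<close>.\<close>

definition levi :: "4 \<Rightarrow> 4 \<Rightarrow> 4 \<Rightarrow> 4 \<Rightarrow> real" where
  "levi i j k l = det (vector [axis i 1, axis j 1, axis k 1, axis l 1] :: real^4^4)"

text \<open>The Hodge star on 2-forms of the inner product with Gram matrix \<open>A\<close>.\<close>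

definition hodge :: "real^4^4 \<Rightarrow> real^4^4 \<Rightarrow> real^4^4" where
  "hodge A w = (\<chi> k l. (1/2) * (\<Sum>i\<in>UNIV. \<Sum>j\<in>UNIV. \<Sum>a\<in>UNIV. \<Sum>b\<in>UNIV.
     sqrt (det A) * levi i j k l * matrix_inv A $ i $ a * matrix_inv A $ j $ b * w $ a $ b))"

definition pi_minus :: "real^4^4 \<Rightarrow> real^4^4 \<Rightarrow> real^4^4" where
  "pi_minus A w = (1/2) *\<^sub>R (w - hodge A w)"

definition asd_form :: "real^4^4 \<Rightarrow> real^4^4 \<Rightarrow> bool" where
  "asd_form A w \<longleftrightarrow> (\<forall>i j. w $ i $ j = - w $ j $ i) \<and> hodge A w = - w"

text \<open>\<open>Wminus G x\<close> is the endomorphism \<open>\<pi>\<^sub>- W \<pi>\<^sub>-\<close> of the 2-forms at \<open>x\<close>.\<close>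

definition Wminus :: "(real^4 \<Rightarrow> real^4^4) \<Rightarrow> real^4 \<Rightarrow> real^4^4 \<Rightarrow> real^4^4" where
  "Wminus G x w = pi_minus (G x) (weyl_op G x (pi_minus (G x) w))"

definition wedge :: "4 \<Rightarrow> 4 \<Rightarrow> real^4^4" where
  "wedge k l = (\<chi> a b. axis k 1 $ a * axis l 1 $ b - axis l 1 $ a * axis k 1 $ b)"

text \<open>An endomorphism \<open>E\<close> of 2-forms is recorded by the array whose \<open>(i,j,k,l)\<close> entry is the
  \<open>(i,j)\<close> component of \<open>E(e\<^sub>k \<and> e\<^sub>l)\<close>. In coordinates in which the metric is Euclidean this is also
  the array of the corresponding bilinear form on 2-forms, that is, of a covariant 4-tensor.\<close>

definition Dop :: "(real^4 \<Rightarrow> real^4^4) \<Rightarrow> (real^4 \<Rightarrow> real^4^4) \<Rightarrow> real^4 \<Rightarrow> real^4^4^4^4" where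
  "Dop G h x = (\<chi> i j k l. deriv (\<lambda>s::real. Wminus (\<lambda>z. G z + s *\<^sub>R h z) x (wedge k l) $ i $ j) 0)"

definition Fop :: "(real^4 \<Rightarrow> real^4^4) \<Rightarrow> (real^4 \<Rightarrow> real^4^4) \<Rightarrow>
    (real^4 \<Rightarrow> real^4^4^4^4) \<times> (real^4 \<Rightarrow> real^4)" where
  "Fop G h = (Dop G h, \<lambda>x. 2 *\<^sub>R div2 G h x)"

text \<open>The fibre of \<open>S\<^sup>2\<^sub>0(\<Lambda>\<^sup>2\<^sub>-)\<close>.\<close>

definition asd_sym_traceless :: "real^4^4 \<Rightarrow> real^4^4^4^4 \<Rightarrow> bool" where
  "asd_sym_traceless A Z \<longleftrightarrow>
     (\<forall>k l. asd_form A (\<chi> i j. Z $ i $ j $ k $ l)) \<and>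
     (\<forall>i j k l. Z $ i $ j $ k $ l = Z $ k $ l $ i $ j) \<and>
     (\<Sum>i\<in>UNIV. \<Sum>j\<in>UNIV. \<Sum>k\<in>UNIV. \<Sum>l\<in>UNIV.
        matrix_inv A $ i $ k * matrix_inv A $ j $ l * Z $ i $ j $ k $ l) = 0"

section \<open>The cylinder over a flat torus\<close>

text \<open>The torus \<open>Y\<close> is the quotient of \<open>\<real>\<^sup>3\<close> by the lattice generated by the rows of an invertible
  matrix \<open>v\<close>. Its tangent bundle is trivialised by the coordinate fields, and tensor fields on \<open>Y\<close>
  (on the cylinder) are lattice-periodic component arrays on \<open>\<real>\<^sup>3\<close> (on \<open>\<real>\<^sup>4\<close>). On \<open>\<real>\<^sup>4\<close> the
  coordinate \<open>1\<close> is \<open>t\<close> and the coordinates \<open>2, 3, 4\<close> are those of \<open>Y\<close>.\<close>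

definition tcoord :: "real^4 \<Rightarrow> real" where
  "tcoord x = x $ 1"

definition ypart :: "real^4 \<Rightarrow> real^3" where
  "ypart x = vector [x $ 2, x $ 3, x $ 4]"

definition ylift :: "real^3 \<Rightarrow> real^4" where
  "ylift y = vector [0, y $ 1, y $ 2, y $ 3]"

definition torus_periodic :: "real^3^3 \<Rightarrow> (real^3 \<Rightarrow> 'b) \<Rightarrow> bool" where
  "torus_periodic v f \<longleftrightarrow> (\<forall>a y. f (y + v $ a) = f y)"

definition cyl_periodic :: "real^3^3 \<Rightarrow> (real^4 \<Rightarrow> 'b) \<Rightarrow> bool" where
  "cyl_periodic v f \<longleftrightarrow> (\<forall>a x. f (x + ylift (v $ a)) = f x)"

definition cyl_fundamental_domain :: "real^3^3 \<Rightarrow> (real^4) set" where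
  "cyl_fundamental_domain v =
     {x. \<exists>s::real^3. (\<forall>a. 0 \<le> s $ a \<and> s $ a < 1) \<and> ypart x = (\<Sum>a\<in>UNIV. s $ a *\<^sub>R v $ a)}"

text \<open>Pullback along the projection of the cylinder to \<open>Y\<close>, which is \<open>ypart\<close> in coordinates.\<close>

definition pull1 :: "(real^3 \<Rightarrow> real^3) \<Rightarrow> real^4 \<Rightarrow> real^4" where
  "pull1 w x = (\<chi> i. \<Sum>a\<in>UNIV. w (ypart x) $ a * ypart (axis i 1) $ a)"

definition pull2 :: "(real^3 \<Rightarrow> real^3^3) \<Rightarrow> real^4 \<Rightarrow> real^4^4" where
  "pull2 B x = (\<chi> i j. \<Sum>a\<in>UNIV. \<Sum>b\<in>UNIV.
     B (ypart x) $ a $ b * ypart (axis i 1) $ a * ypart (axis j 1) $ b)"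

definition tens :: "(real^4 \<Rightarrow> real^4) \<Rightarrow> (real^4 \<Rightarrow> real^4) \<Rightarrow> real^4 \<Rightarrow> real^4^4" where
  "tens w1 w2 x = (\<chi> i j. w1 x $ i * w2 x $ j)"

definition odot :: "(real^4 \<Rightarrow> real^4) \<Rightarrow> (real^4 \<Rightarrow> real^4) \<Rightarrow> real^4 \<Rightarrow> real^4^4" where
  "odot w1 w2 x = tens w1 w2 x + tens w2 w1 x"

definition dt :: "real^4 \<Rightarrow> real^4" where
  "dt x = axis 1 1"

definition gY :: "real^3 \<Rightarrow> real^3^3" where
  "gY y = mat 1"

definition gcyl :: "real^4 \<Rightarrow> real^4^4" where
  "gcyl x = tens dt dt x + pull2 gY x"

lemma ypart_axis: "ypart (axis i 1) $ a = (if (i = 2 \<and> a = 1) \<or> (i = 3 \<and> a = 2) \<or> (i = 4 \<and> a = 3) then 1 else 0)"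
  using exhaust_3[of a] exhaust_4[of i] by (auto simp: ypart_def axis_def)

lemma gcyl_eq: "gcyl x = mat 1"
proof -
  have axis_nth: "axis k (1::real) $ i = (if i = k then 1 else 0)" for k i :: 4
    by (simp add: axis_def)
  show ?thesis
    unfolding gcyl_def tens_def pull2_def gY_def dt_def vec_eq_iff forall_4
    by (simp add: ypart_axis sum_3 axis_nth mat_def)
qed

section \<open>Sections and the formal adjoint\<close>

definition sections_S20 :: "real^3^3 \<Rightarrow> (real^4 \<Rightarrow> real^4^4) set" where
  "sections_S20 v = {h. smooth h \<and> cyl_periodic v h \<and> (\<forall>x. sym_traceless (gcyl x) (h x))}"

definition sections_S20_asd :: "real^3^3 \<Rightarrow> (real^4 \<Rightarrow> real^4^4^4^4) set" where
  "sections_S20_asd v = {Z. smooth Z \<and> cyl_periodic v Z \<and> (\<forall>x. asd_sym_traceless (gcyl x) (Z x))}"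

definition compactly_supported :: "(real^4 \<Rightarrow> 'b::zero) \<Rightarrow> bool" where
  "compactly_supported h \<longleftrightarrow> (\<exists>R. \<forall>x. \<bar>tcoord x\<bar> > R \<longrightarrow> h x = 0)"

definition cyl_integral :: "real^3^3 \<Rightarrow> (real^4 \<Rightarrow> real) \<Rightarrow> real" where
  "cyl_integral v f = (LINT x:cyl_fundamental_domain v|lborel. f x)"

text \<open>By \<open>gcyl_eq\<close> the volume form is Lebesgue measure and the fibre metrics are plain sums of
  products of components. The factor \<open>1/4\<close> is the inner product of endomorphisms of 2-forms
  for the norm in which the \<open>e\<^sub>i \<and> e\<^sub>j\<close>, \<open>i < j\<close>, are orthonormal.\<close>

definition Dadj :: "real^3^3 \<Rightarrow> (real^4 \<Rightarrow> real^4^4^4^4) \<Rightarrow> real^4 \<Rightarrow> real^4^4" where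
  "Dadj v Z = (THE k. k \<in> sections_S20 v \<and>
     (\<forall>h\<in>sections_S20 v. compactly_supported h \<longrightarrow>
        cyl_integral v (\<lambda>x. (1/4) * (Dop gcyl h x \<bullet> Z x)) = cyl_integral v (\<lambda>x. h x \<bullet> k x)))"

definition Fadj :: "real^3^3 \<Rightarrow> (real^4 \<Rightarrow> real^4^4^4^4) \<times> (real^4 \<Rightarrow> real^4) \<Rightarrow> real^4 \<Rightarrow> real^4^4" where
  "Fadj v P = (\<lambda>x. Dadj v (fst P) x - Kop gcyl (snd P) x)"

section \<open>Indicial roots and kernels\<close>

definition indicial_form :: "real^3^3 \<Rightarrow> complex \<Rightarrow> (real^4 \<Rightarrow> complex) \<Rightarrow> bool" where
  "indicial_form v lam f \<longleftrightarrow> (\<exists>N (p::nat \<Rightarrow> real^3 \<Rightarrow> complex).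
     (\<forall>m\<le>N. smooth (p m) \<and> torus_periodic v (p m)) \<and>
     (\<forall>x. f x = exp (lam * of_real (tcoord x)) * (\<Sum>m\<le>N. of_real (tcoord x) ^ m * p m (ypart x))))"

text \<open>Real and imaginary parts, complexification and complex scaling of tensor fields of rank
  1, 2 and 4.\<close>

definition re1 :: "(real^4 \<Rightarrow> complex^4) \<Rightarrow> real^4 \<Rightarrow> real^4" where
  "re1 w x = (\<chi> i. Re (w x $ i))"
definition im1 :: "(real^4 \<Rightarrow> complex^4) \<Rightarrow> real^4 \<Rightarrow> real^4" where
  "im1 w x = (\<chi> i. Im (w x $ i))"
definition cplx1 :: "(real^4 \<Rightarrow> real^4) \<Rightarrow> real^4 \<Rightarrow> complex^4" where
  "cplx1 w x = (\<chi> i. of_real (w x $ i))"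

definition re2 :: "(real^4 \<Rightarrow> complex^4^4) \<Rightarrow> real^4 \<Rightarrow> real^4^4" where
  "re2 h x = (\<chi> i j. Re (h x $ i $ j))"
definition im2 :: "(real^4 \<Rightarrow> complex^4^4) \<Rightarrow> real^4 \<Rightarrow> real^4^4" where
  "im2 h x = (\<chi> i j. Im (h x $ i $ j))"
definition cplx2 :: "(real^4 \<Rightarrow> real^4^4) \<Rightarrow> real^4 \<Rightarrow> complex^4^4" where
  "cplx2 h x = (\<chi> i j. of_real (h x $ i $ j))"

definition re4 :: "(real^4 \<Rightarrow> complex^4^4^4^4) \<Rightarrow> real^4 \<Rightarrow> real^4^4^4^4" where
  "re4 Z x = (\<chi> i j k l. Re (Z x $ i $ j $ k $ l))"
definition im4 :: "(real^4 \<Rightarrow> complex^4^4^4^4) \<Rightarrow> real^4 \<Rightarrow> real^4^4^4^4" where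
  "im4 Z x = (\<chi> i j k l. Im (Z x $ i $ j $ k $ l))"
definition cplx4 :: "(real^4 \<Rightarrow> real^4^4^4^4) \<Rightarrow> real^4 \<Rightarrow> complex^4^4^4^4" where
  "cplx4 Z x = (\<chi> i j k l. of_real (Z x $ i $ j $ k $ l))"

definition scale2 :: "complex \<Rightarrow> (real^4 \<Rightarrow> complex^4^4) \<Rightarrow> real^4 \<Rightarrow> complex^4^4" where
  "scale2 c h = (\<lambda>x. \<chi> i j. c * h x $ i $ j)"

definition scaleP :: "complex \<Rightarrow> (real^4 \<Rightarrow> complex^4^4^4^4) \<times> (real^4 \<Rightarrow> complex^4) \<Rightarrow>
    (real^4 \<Rightarrow> complex^4^4^4^4) \<times> (real^4 \<Rightarrow> complex^4)" where
  "scaleP c P = ((\<lambda>x. \<chi> i j k l. c * fst P x $ i $ j $ k $ l), (\<lambda>x. \<chi> i. c * snd P x $ i))"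

lemma vector_space_scale2: "vector_space scale2"
  by unfold_locales (auto simp: scale2_def fun_eq_iff vec_eq_iff algebra_simps)

lemma vector_space_scaleP: "vector_space scaleP"
  by unfold_locales (auto simp: scaleP_def prod_eq_iff fun_eq_iff vec_eq_iff algebra_simps)

text \<open>\<open>Fop\<close> and \<open>Fadj\<close> act on complex-valued fields by complex linearity, so the kernel condition
  is imposed on real and imaginary parts. The kernels below contain \<open>0\<close>, for every \<open>lam\<close>.\<close>

definition kernelF :: "real^3^3 \<Rightarrow> complex \<Rightarrow> (real^4 \<Rightarrow> complex^4^4) set" where
  "kernelF v lam = {h. (\<forall>i j. indicial_form v lam (\<lambda>x. h x $ i $ j)) \<and>
     re2 h \<in> sections_S20 v \<and> im2 h \<in> sections_S20 v \<and>
     Fop gcyl (re2 h) = 0 \<and> Fop gcyl (im2 h) = 0}"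

definition kernelFadj :: "real^3^3 \<Rightarrow> complex \<Rightarrow>
    ((real^4 \<Rightarrow> complex^4^4^4^4) \<times> (real^4 \<Rightarrow> complex^4)) set" where
  "kernelFadj v lam = {(Z, w).
     (\<forall>i j k l. indicial_form v lam (\<lambda>x. Z x $ i $ j $ k $ l)) \<and>
     (\<forall>i. indicial_form v lam (\<lambda>x. w x $ i)) \<and>
     re4 Z \<in> sections_S20_asd v \<and> im4 Z \<in> sections_S20_asd v \<and>
     Fadj v (re4 Z, re1 w) = 0 \<and> Fadj v (im4 Z, im1 w) = 0}"

definition indicial_roots :: "real^3^3 \<Rightarrow> complex set" where
  "indicial_roots v = {lam. \<exists>h\<in>kernelF v lam. h \<noteq> 0}"

text \<open>Parallel tensors on the flat torus \<open>Y\<close>.\<close>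

definition parallel_forms_Y :: "real^3^3 \<Rightarrow> (real^3 \<Rightarrow> real^3) set" where
  "parallel_forms_Y v = {w. torus_periodic v w \<and> parallel1 gY w}"

definition parallel_S20_Y :: "real^3^3 \<Rightarrow> (real^3 \<Rightarrow> real^3^3) set" where
  "parallel_S20_Y v = {B. torus_periodic v B \<and> parallel2 gY B \<and> (\<forall>y. sym_traceless (gY y) (B y))}"

definition parallel_S20_asd :: "real^3^3 \<Rightarrow> (real^4 \<Rightarrow> real^4^4^4^4) set" where
  "parallel_S20_asd v = {Z \<in> sections_S20_asd v. parallel4 gcyl Z}"

end

theory Submission
  imports Defs
begin

text \<open>
At the flat metric, \<open>\<D> h\<close> is, up to the factor \<open>-1/8\<close> and in the basis of \<open>\<Lambda>\<^sup>2\<^sub>-\<close> given by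
the three complex structures \<open>I\<^sub>a\<close>, the traceless part of \<open>E\<^sub>a\<^sub>b = h(I\<^sub>a \<partial>, I\<^sub>b \<partial>)\<close>. With
\<open>I\<^sub>1 = 1\<close> the divergence supplies the remaining entries, so \<open>F h = 0\<close> says that the \<open>4 \<times> 4\<close>
array \<open>E\<close> vanishes. Contracting one slot at a time is a Cauchy--Riemann--Fueter operator, which
factors the Laplacian, hence \<open>\<Delta>\<^sup>2 h = 0\<close>. The adjoint is
\<open>\<D>\<^sup>* Z = -(1/2) \<Sum> (I\<^sub>a \<partial>) (I\<^sub>b \<partial>) z\<^sub>a\<^sub>b\<close>, and contracting \<open>\<D>\<^sup>* Z = \<K> \<omega>\<close> with \<open>I\<^sub>m \<partial>\<close> and
\<open>I\<^sub>n \<partial>\<close> gives \<open>\<Delta>\<^sup>2 z = 0\<close> and \<open>\<Delta>\<^sup>2 \<omega> = 0\<close>.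

For \<open>e\<^bsup>\<lambda>t\<^esup> \<Sum> t\<^sup>m p\<^sub>m(y)\<close> the highest coefficient satisfies \<open>(\<Delta>\<^sub>Y + \<lambda>\<^sup>2)\<^sup>2 p = 0\<close>, so \<open>\<lambda>\<^sup>2\<close> is an
eigenvalue of the torus. The maximum principle for \<open>|u|\<^sup>2\<close> gives \<open>Re \<lambda>\<^sup>2 \<ge> 0\<close>, and a Bernstein
gradient estimate excludes small nonzero eigenvalues: such an eigenfunction is nearly constant, and
then a linear functional of it is strictly subharmonic. For \<open>\<lambda> = 0\<close> all \<open>p\<^sub>m\<close> are constant and
the equations become ordinary differential equations in \<open>t\<close>.
\<close>


section \<open>Calculus of smooth functions\<close>

text \<open>Three points shape the argument. First, a bound on Re lambda alone does not make lambda
  small; that Re (lambda^2) is nonnegative forces |Im lambda| to be at most |Re lambda|, and only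
  then does the exclusion of small eigenvalues apply. The estimates are pointwise and allow complex
  eigenvalues, because lambda is complex a priori. Second, the bi-Laplace equation at lambda = 0
  still admits t^2 and t^3. It serves to remove the dependence on y; the original equations then cut
  the degree: the divergence forbids growth of the entries of h with a dt index, K forbids growth of
  omega, and the second-order part leaves degree one elsewhere. Third, the adjoint is defined by
  testing against compactly supported sections. Its formula therefore requires integration by parts
  over a half-open fundamental domain, obtained by differentiating the translation invariance of the
  integral, and uniqueness requires a bump function in t. Both kernels have dimension 1 + 3 + 5 + 5,
  where 5 counts traceless symmetric 3 x 3 matrices.\<close>

lemma partial_eq: "(f has_derivative f') (at x) \<Longrightarrow> partial i f x = f' (axis i 1)"
  unfolding partial_def using frechet_derivative_at[of f f' x] by simp

lemma smooth_differentiable: "smooth f \<Longrightarrow> f differentiable (at x)"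
  unfolding smooth_def using Ck.simps(2)[of 0 f] by blast

lemma smooth_partial: "smooth f \<Longrightarrow> smooth (partial i f)"
  unfolding smooth_def using Ck.simps(2) by blast

lemma smooth_continuous: "smooth f \<Longrightarrow> continuous_on S f"
  unfolding smooth_def using Ck.simps(1)[of f] continuous_on_subset by blast

text \<open>Induction on the order, with the whole class as induction hypothesis. It suits functions
  whose derivatives of all orders can be listed, such as constants and
  \<open>tcoord\<close>.\<close>

lemma smooth_coinduct:
  assumes "P f" "\<And>g x. P g \<Longrightarrow> g differentiable (at x)" "\<And>g i. P g \<Longrightarrow> P (partial i g)"
  shows "smooth f"
proof -
  have "\<forall>g. P g \<longrightarrow> Ck m g" for m
  proof (induction m)
    case 0
    show ?case
      using assms(2) by (auto intro!: differentiable_imp_continuous_on simp: differentiable_on_def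
          intro: differentiable_at_withinI)
  next
    case (Suc m)
    then show ?case using assms(2,3) by auto
  qed
  with assms(1) show ?thesis by (auto simp: smooth_def)
qed

lemma Ck_Suc_imp_Ck: "Ck (Suc m) f \<Longrightarrow> Ck m f"
proof (induction m arbitrary: f)
  case 0
  then show ?case
    by (auto intro!: differentiable_imp_continuous_on simp: differentiable_on_def
          intro: differentiable_at_withinI)
next
  case (Suc m)
  then show ?case by (metis Ck.simps(2))
qed

lemma partial_bounded_linear:
  assumes "bounded_linear L" "f differentiable (at x)"
  shows "partial i (\<lambda>x. L (f x)) x = L (partial i f x)"
proof -
  have "((\<lambda>x. L (f x)) has_derivative (\<lambda>v. L (frechet_derivative f (at x) v))) (at x)"
    using assms frechet_derivative_works bounded_linear.has_derivative by blast
  then show ?thesis by (simp add: partial_eq) (simp add: partial_def)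
qed

lemma differentiable_bounded_linear:
  assumes "bounded_linear L" "f differentiable (at x)"
  shows "(\<lambda>x. L (f x)) differentiable (at x)"
  using assms bounded_linear.has_derivative unfolding differentiable_def by blast

lemma Ck_bounded_linear: "bounded_linear L \<Longrightarrow> Ck m f \<Longrightarrow> Ck m (\<lambda>x. L (f x))"
proof (induction m arbitrary: f)
  case 0
  then show ?case by (auto intro: bounded_linear.continuous_on)
next
  case (Suc m)
  then have d: "\<forall>x. f differentiable (at x)" by simp
  have "partial i (\<lambda>x. L (f x)) = (\<lambda>x. L (partial i f x))" for i
    using d by (auto simp: partial_bounded_linear Suc.prems)
  moreover have "(\<lambda>x. L (f x)) differentiable (at x)" for x
    using d Suc.prems(1) differentiable_bounded_linear by blast
  ultimately show ?case using Suc by simp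
qed

lemma smooth_bounded_linear: "bounded_linear L \<Longrightarrow> smooth f \<Longrightarrow> smooth (\<lambda>x. L (f x))"
  by (simp add: smooth_def Ck_bounded_linear)

lemma partial_const [simp]: "partial i (\<lambda>x. c) = (\<lambda>x. 0)"
proof
  show "partial i (\<lambda>x. c) x = 0" for x by (rule partial_eq) simp
qed

lemma smooth_const [simp]: "smooth (\<lambda>x. c)"
  by (rule smooth_coinduct[where P = "\<lambda>g. \<exists>c. g = (\<lambda>x. c)"]) auto

lemma partial_add:
  assumes "f differentiable (at x)" "g differentiable (at x)"
  shows "partial i (\<lambda>x. f x + g x) x = partial i f x + partial i g x"
  using has_derivative_add[OF assms[unfolded frechet_derivative_works]]
  by (simp add: partial_eq) (simp add: partial_def)

lemma Ck_add: "Ck m f \<Longrightarrow> Ck m g \<Longrightarrow> Ck m (\<lambda>x. f x + g x)"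
proof (induction m arbitrary: f g)
  case 0
  then show ?case by (auto intro: continuous_on_add)
next
  case (Suc m)
  have "partial i (\<lambda>x. f x + g x) = (\<lambda>x. partial i f x + partial i g x)" for i
    using Suc.prems by (auto simp: partial_add)
  then show ?case using Suc by simp
qed

lemma smooth_add: "smooth f \<Longrightarrow> smooth g \<Longrightarrow> smooth (\<lambda>x. f x + g x)"
  by (simp add: smooth_def Ck_add)

lemma partial_bilinear:
  assumes "bounded_bilinear B" "f differentiable (at x)" "g differentiable (at x)"
  shows "partial i (\<lambda>x. B (f x) (g x)) x = B (f x) (partial i g x) + B (partial i f x) (g x)"
  using bounded_bilinear.FDERIV[OF assms(1) assms(2,3)[unfolded frechet_derivative_works]]
  by (simp add: partial_eq) (simp add: partial_def)

lemma Ck_bilinear: "bounded_bilinear B \<Longrightarrow> Ck m f \<Longrightarrow> Ck m g \<Longrightarrow> Ck m (\<lambda>x. B (f x) (g x))"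
proof (induction m arbitrary: f g)
  case 0
  then show ?case by (auto intro: bounded_bilinear.continuous_on)
next
  case (Suc m)
  have p: "partial i (\<lambda>x. B (f x) (g x)) = (\<lambda>x. B (f x) (partial i g x) + B (partial i f x) (g x))" for i
    using Suc.prems by (auto simp: partial_bilinear)
  have "(\<lambda>x. B (f x) (g x)) differentiable (at x)" for x
    using Suc.prems bounded_bilinear.FDERIV[OF Suc.prems(1)] unfolding Ck.simps differentiable_def by blast
  \<comment> \<open>The product rule leaves one factor undifferentiated, so that factor has to be
    lowered from order \<open>Suc m\<close> to \<open>m\<close>.\<close>
  moreover have "Ck m f" "Ck m g" using Suc.prems Ck_Suc_imp_Ck by blast+
  moreover have "Ck m (partial i f)" "Ck m (partial i g)" for i using Suc.prems by auto
  ultimately show ?case using Suc.IH Suc.prems(1) by (auto simp: p intro!: Ck_add)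
qed

lemma smooth_bilinear: "bounded_bilinear B \<Longrightarrow> smooth f \<Longrightarrow> smooth g \<Longrightarrow> smooth (\<lambda>x. B (f x) (g x))"
  by (simp add: smooth_def Ck_bilinear)

lemmas smooth_mult = smooth_bilinear[OF bounded_bilinear_mult]
lemmas smooth_scaleR = smooth_bilinear[OF bounded_bilinear_scaleR]
lemmas smooth_inner = smooth_bilinear[OF bounded_bilinear_inner]
lemmas smooth_vec_nth = smooth_bounded_linear[OF bounded_linear_vec_nth]
lemmas smooth_minus = smooth_bounded_linear[OF bounded_linear_minus[OF bounded_linear_ident]]
lemmas smooth_cmult = smooth_bounded_linear[OF bounded_linear_mult_right]
lemmas smooth_Re = smooth_bounded_linear[OF bounded_linear_Re]
lemmas smooth_Im = smooth_bounded_linear[OF bounded_linear_Im]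
lemmas smooth_of_real = smooth_bounded_linear[OF bounded_linear_of_real]

lemma smooth_diff: "smooth f \<Longrightarrow> smooth g \<Longrightarrow> smooth (\<lambda>x. f x - g x)"
  using smooth_add[OF _ smooth_minus, of f g] by simp

lemma smooth_sum: "(\<And>k. k \<in> K \<Longrightarrow> smooth (f k)) \<Longrightarrow> smooth (\<lambda>x. \<Sum>k\<in>K. f k x)"
  by (induction K rule: infinite_finite_induct) (auto intro: smooth_add)

lemma smooth_power:
  fixes f :: "real^'n \<Rightarrow> 'b::real_normed_algebra_1"
  shows "smooth f \<Longrightarrow> smooth (\<lambda>x. f x ^ k)"
  by (induction k) (auto intro: smooth_mult)

lemmas smooth_intros = smooth_const smooth_add smooth_diff smooth_minus smooth_sum smooth_mult
  smooth_power smooth_vec_nth smooth_partial smooth_scaleR smooth_inner smooth_of_real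
  smooth_Re smooth_Im

lemma partial_diff:
  assumes "f differentiable (at x)" "g differentiable (at x)"
  shows "partial i (\<lambda>x. f x - g x) x = partial i f x - partial i g x"
  using has_derivative_diff[OF assms[unfolded frechet_derivative_works]]
  by (simp add: partial_eq) (simp add: partial_def)

lemma partial_sum:
  assumes "\<And>k. k \<in> K \<Longrightarrow> f k differentiable (at x)"
  shows "partial i (\<lambda>x. \<Sum>k\<in>K. f k x) x = (\<Sum>k\<in>K. partial i (f k) x)"
  unfolding partial_def[of i "f _"]
  by (rule partial_eq, rule has_derivative_sum) (simp add: assms frechet_derivative_works[symmetric])

lemma partial_cmult:
  fixes f :: "real^'n \<Rightarrow> 'b::real_normed_algebra"
  shows "f differentiable (at x) \<Longrightarrow> partial i (\<lambda>x. c * f x) x = c * partial i f x"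
  by (rule partial_bounded_linear[OF bounded_linear_mult_right])

lemmas partial_mult = partial_bilinear[OF bounded_bilinear_mult]
lemmas partial_inner = partial_bilinear[OF bounded_bilinear_inner]

lemma bounded_linear_axis: "bounded_linear (axis j :: 'b::real_normed_vector \<Rightarrow> 'b^'m::finite)"
proof (rule bounded_linear_intro[where K = 1])
  fix y :: 'b
  have "norm (axis j y) \<le> (\<Sum>i\<in>UNIV. norm (axis j y $ i))"
    unfolding norm_vec_def by (rule L2_set_le_sum) auto
  also have "\<dots> = (\<Sum>i\<in>UNIV. if i = j then norm y else 0)"
    by (rule sum.cong) (auto simp: axis_def)
  finally show "norm (axis j y :: 'b^'m) \<le> norm y * 1" by simp
qed (auto simp: axis_def vec_eq_iff)

lemma sum_axis_nth: "(\<Sum>j\<in>UNIV. axis j (y $ j)) = (y :: 'b::real_normed_vector^'m::finite)"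
  by (auto simp: vec_eq_iff axis_def sum.delta' intro!: trans[OF sum.cong[OF refl]])

lemma smooth_componentwise_vec:
  fixes f :: "real^'n \<Rightarrow> 'b::real_normed_vector ^ 'm"
  assumes "\<And>j. smooth (\<lambda>x. f x $ j)"
  shows "smooth f"
proof -
  have "smooth (\<lambda>x. \<Sum>j\<in>UNIV. axis j (f x $ j))"
    by (intro smooth_sum smooth_bounded_linear[OF bounded_linear_axis] assms)
  then show ?thesis by (simp add: sum_axis_nth)
qed

lemma smooth_vec_lambda: "(\<And>j. smooth (f j)) \<Longrightarrow> smooth (\<lambda>x. \<chi> j. f j x)"
  by (rule smooth_componentwise_vec) simp

lemma frechet_derivative_partial:
  fixes f :: "real^'n::finite \<Rightarrow> 'b::real_normed_vector"
  assumes "f differentiable (at x)"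
  shows "frechet_derivative f (at x) v = (\<Sum>a\<in>UNIV. v $ a *\<^sub>R partial a f x)"
proof -
  have l: "linear (frechet_derivative f (at x))"
    using assms by (rule linear_frechet_derivative)
  have "v = (\<Sum>a\<in>UNIV. v $ a *\<^sub>R axis a 1)"
    by (simp add: vec_eq_iff axis_def if_distrib cong: if_cong)
  then have "frechet_derivative f (at x) v = frechet_derivative f (at x) (\<Sum>a\<in>UNIV. v $ a *\<^sub>R axis a 1)"
    by simp
  also have "\<dots> = (\<Sum>a\<in>UNIV. v $ a *\<^sub>R partial a f x)"
    by (simp add: linear_sum[OF l] linear_scale[OF l] partial_def)
  finally show ?thesis .
qed

lemma has_derivative_partial:
  fixes f :: "real^'n::finite \<Rightarrow> 'b::real_normed_vector"
  assumes "f differentiable (at x)"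
  shows "(f has_derivative (\<lambda>v. \<Sum>a\<in>UNIV. v $ a *\<^sub>R partial a f x)) (at x)"
  using assms[unfolded frechet_derivative_works] frechet_derivative_partial[OF assms]
  by (metis (no_types, lifting) ext)

lemma partial_compose_linear:
  fixes g :: "real^'m::finite \<Rightarrow> 'b::real_normed_vector" and L :: "real^'n::finite \<Rightarrow> real^'m"
  assumes "bounded_linear L" "g differentiable (at (L x))"
  shows "partial i (\<lambda>x. g (L x)) x = (\<Sum>a\<in>UNIV. L (axis i 1) $ a *\<^sub>R partial a g (L x))"
proof (rule partial_eq)
  have "(g \<circ> L has_derivative ((\<lambda>v. \<Sum>a\<in>UNIV. v $ a *\<^sub>R partial a g (L x)) \<circ> L)) (at x)"
    by (rule diff_chain_at[OF bounded_linear_imp_has_derivative has_derivative_partial]) fact+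
  then show "((\<lambda>x. g (L x)) has_derivative (\<lambda>v. \<Sum>a\<in>UNIV. L v $ a *\<^sub>R partial a g (L x))) (at x)"
    by (simp add: o_def)
qed

lemma partial_translate:
  assumes "f differentiable (at (x + c))"
  shows "partial i (\<lambda>z. f (z + c)) x = partial i f (x + c)"
proof -
  have "((\<lambda>z. f (z + c)) has_derivative frechet_derivative f (at (x + c))) (at x)"
    by (rule has_derivative_compose[where g = f and f = "\<lambda>z. z + c" and f' = "\<lambda>x. x", simplified])
      (auto simp: frechet_derivative_works[symmetric] assms intro!: derivative_eq_intros)
  then show ?thesis by (simp add: partial_eq) (simp add: partial_def)
qed

lemma differentiable_compose_linear:
  fixes g :: "real^'m::finite \<Rightarrow> 'b::real_normed_vector" and L :: "real^'n::finite \<Rightarrow> real^'m"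
  assumes "bounded_linear L" "g differentiable (at (L x))"
  shows "(\<lambda>x. g (L x)) differentiable (at x)"
  using assms differentiable_chain_at[of L x g] bounded_linear_imp_differentiable[of L]
  by (simp add: o_def)

text \<open>By the chain rule a partial derivative of g o L is again a composition with L, of a
  linear combination of partial derivatives of g. The induction on the order therefore ranges over
  all smooth g at once.\<close>

lemma smooth_compose_linear:
  fixes g :: "real^'m::finite \<Rightarrow> 'b::real_normed_vector" and L :: "real^'n::finite \<Rightarrow> real^'m"
  assumes L: "bounded_linear L" and "smooth g"
  shows "smooth (\<lambda>x. g (L x))"
proof -
  have "\<forall>g::real^'m \<Rightarrow> 'b. smooth g \<longrightarrow> Ck m (\<lambda>x. g (L x))" for m
  proof (induction m)
    case 0
    show ?case
      by (auto intro!: continuous_on_compose2[OF smooth_continuous bounded_linear.continuous_on[OF L]])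
  next
    case (Suc m)
    show ?case
    proof (intro allI impI)
      fix g :: "real^'m \<Rightarrow> 'b" assume g: "smooth g"
      have eq: "partial i (\<lambda>x. g (L x)) = (\<lambda>x. (\<Sum>a\<in>UNIV. L (axis i 1) $ a *\<^sub>R partial a g (L x)))" for i
        using g L by (auto simp: partial_compose_linear smooth_differentiable)
      have "Ck m (partial i (\<lambda>x. g (L x)))" for i
      proof -
        have "smooth (\<lambda>y. \<Sum>a\<in>UNIV. L (axis i 1) $ a *\<^sub>R partial a g y)"
          by (intro smooth_intros g)
        with Suc show ?thesis unfolding eq by blast
      qed
      then show "Ck (Suc m) (\<lambda>x. g (L x))"
        by (simp add: differentiable_compose_linear[OF L smooth_differentiable[OF g]])
    qed
  qed
  with assms(2) show ?thesis by (simp add: smooth_def)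
qed

section \<open>Symmetry of second partial derivatives\<close>

lemma partial_eq_vector_derivative:
  fixes f :: "real^'n::finite \<Rightarrow> 'b::real_normed_vector"
  assumes "f differentiable (at (x + s *\<^sub>R v))"
  shows "((\<lambda>s. f (x + s *\<^sub>R v)) has_vector_derivative
    (\<Sum>a\<in>UNIV. v $ a *\<^sub>R partial a f (x + s *\<^sub>R v))) (at s)"
proof -
  have "((\<lambda>s. x + s *\<^sub>R v) has_derivative (\<lambda>r. r *\<^sub>R v)) (at s)"
    by (auto intro!: derivative_eq_intros)
  from diff_chain_at[OF this has_derivative_partial[OF assms]]
  show ?thesis
    by (simp add: has_vector_derivative_def o_def scaleR_sum_right)
qed

lemma partial_axis_vector_derivative:
  fixes f :: "real^'n::finite \<Rightarrow> 'b::real_normed_vector"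
  assumes "f differentiable (at (x + s *\<^sub>R axis i 1))"
  shows "((\<lambda>s. f (x + s *\<^sub>R axis i 1)) has_vector_derivative partial i f (x + s *\<^sub>R axis i 1)) (at s)"
proof -
  have "(\<Sum>a\<in>UNIV. axis i 1 $ a *\<^sub>R partial a f y) = partial i f y" for y
    by (subst sum.cong[OF refl, where h = "\<lambda>a. if a = i then partial a f y else 0"])
      (auto simp: axis_def)
  then show ?thesis using partial_eq_vector_derivative[OF assms] by simp
qed

text \<open>The mean value theorem is applied to \<open>\<phi>\<close> in direction i and then to
  \<open>\<psi>\<close> in direction j. The second difference is symmetric in i and j while the
  right side is not, so the limit s to 0 commutes the derivatives.\<close>

lemma second_difference:
  fixes f :: "real^'n::finite \<Rightarrow> real"
  assumes f: "smooth f" and s: "s > 0"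
  obtains \<sigma> \<tau> where "0 < \<sigma>" "\<sigma> < s" "0 < \<tau>" "\<tau> < s"
    "f (x + s *\<^sub>R axis i 1 + s *\<^sub>R axis j 1) - f (x + s *\<^sub>R axis i 1) - f (x + s *\<^sub>R axis j 1) + f x
      = s\<^sup>2 * partial j (partial i f) (x + \<sigma> *\<^sub>R axis i 1 + \<tau> *\<^sub>R axis j 1)"
proof -
  define \<phi> where "\<phi> r = f (x + s *\<^sub>R axis j 1 + r *\<^sub>R axis i 1) - f (x + r *\<^sub>R axis i 1)" for r
  have "(\<phi> has_real_derivative partial i f (x + s *\<^sub>R axis j 1 + r *\<^sub>R axis i 1) - partial i f (x + r *\<^sub>R axis i 1)) (at r)" for r
    unfolding \<phi>_def
    by (intro DERIV_diff)
      (auto simp: has_real_derivative_iff_has_vector_derivative intro!: partial_axis_vector_derivative smooth_differentiable f)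
  from MVT2[of 0 s \<phi>, OF s this] obtain \<sigma> where \<sigma>: "0 < \<sigma>" "\<sigma> < s"
    "\<phi> s - \<phi> 0 = s * (partial i f (x + s *\<^sub>R axis j 1 + \<sigma> *\<^sub>R axis i 1) - partial i f (x + \<sigma> *\<^sub>R axis i 1))"
    by auto
  define \<psi> where "\<psi> r = partial i f (x + \<sigma> *\<^sub>R axis i 1 + r *\<^sub>R axis j 1)" for r
  have "(\<psi> has_real_derivative partial j (partial i f) (x + \<sigma> *\<^sub>R axis i 1 + r *\<^sub>R axis j 1)) (at r)" for r
    unfolding \<psi>_def
    by (auto simp: has_real_derivative_iff_has_vector_derivative intro!: partial_axis_vector_derivative smooth_differentiable smooth_partial f)
  from MVT2[of 0 s \<psi>, OF s this] obtain \<tau> where \<tau>: "0 < \<tau>" "\<tau> < s"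
    "\<psi> s - \<psi> 0 = s * partial j (partial i f) (x + \<sigma> *\<^sub>R axis i 1 + \<tau> *\<^sub>R axis j 1)"
    by auto
  have "\<phi> s - \<phi> 0 = s * (\<psi> s - \<psi> 0)"
    unfolding \<sigma>(3) \<psi>_def by (simp add: algebra_simps)
  with \<tau>(3) have "\<phi> s - \<phi> 0 = s\<^sup>2 * partial j (partial i f) (x + \<sigma> *\<^sub>R axis i 1 + \<tau> *\<^sub>R axis j 1)"
    by (simp add: power2_eq_square)
  then show thesis
    by (intro that[OF \<sigma>(1,2) \<tau>(1,2)]) (simp add: \<phi>_def algebra_simps)
qed

lemma second_difference_limit:
  fixes f :: "real^'n::finite \<Rightarrow> real"
  assumes f: "smooth f"
  shows "((\<lambda>s. (f (x + s *\<^sub>R axis i 1 + s *\<^sub>R axis j 1) - f (x + s *\<^sub>R axis i 1) - f (x + s *\<^sub>R axis j 1) + f x) / s\<^sup>2)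
    \<longlongrightarrow> partial j (partial i f) x) (at_right 0)"
proof (rule tendstoI)
  fix e :: real assume "e > 0"
  have "isCont (partial j (partial i f)) x"
    using smooth_continuous[of _ UNIV, OF smooth_partial[OF smooth_partial[OF f]]] by (simp add: continuous_on_eq_continuous_at)
  then obtain d where d: "d > 0" "\<And>y. dist y x < d \<Longrightarrow> dist (partial j (partial i f) y) (partial j (partial i f) x) < e"
    using \<open>e > 0\<close> unfolding continuous_at by (metis LIM_zero_iff continuous_at_eps_delta continuous_at)
  have "eventually (\<lambda>s. s \<in> {0<..<d/2}) (at_right (0::real))"
    using d by (intro eventually_at_right_real) auto
  then show "eventually (\<lambda>s. dist ((f (x + s *\<^sub>R axis i 1 + s *\<^sub>R axis j 1) - f (x + s *\<^sub>R axis i 1) - f (x + s *\<^sub>R axis j 1) + f x) / s\<^sup>2)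
     (partial j (partial i f) x) < e) (at_right 0)"
  proof eventually_elim
    case (elim s)
    then have s: "s > 0" "s < d/2" by auto
    obtain \<sigma> \<tau> where st: "0 < \<sigma>" "\<sigma> < s" "0 < \<tau>" "\<tau> < s"
      "f (x + s *\<^sub>R axis i 1 + s *\<^sub>R axis j 1) - f (x + s *\<^sub>R axis i 1) - f (x + s *\<^sub>R axis j 1) + f x
      = s\<^sup>2 * partial j (partial i f) (x + \<sigma> *\<^sub>R axis i 1 + \<tau> *\<^sub>R axis j 1)"
      using second_difference[OF f s(1)] .
    have "dist (x + \<sigma> *\<^sub>R axis i 1 + \<tau> *\<^sub>R axis j 1) x \<le> norm (\<sigma> *\<^sub>R axis i (1::real) :: real^'n) + norm (\<tau> *\<^sub>R axis j (1::real) :: real^'n)"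
      unfolding dist_norm by (rule order_trans[OF _ norm_triangle_ineq]) (simp add: algebra_simps)
    also have "\<dots> < d" using st s by simp
    finally have "dist (partial j (partial i f) (x + \<sigma> *\<^sub>R axis i 1 + \<tau> *\<^sub>R axis j 1)) (partial j (partial i f) x) < e"
      by (rule d)
    then show ?case unfolding st(5) using s by simp
  qed
qed

lemma partial_commute_real:
  fixes f :: "real^'n::finite \<Rightarrow> real"
  assumes f: "smooth f"
  shows "partial i (partial j f) x = partial j (partial i f) x"
proof (rule tendsto_unique[OF _ second_difference_limit[OF f, of x j i]])
  show "((\<lambda>s. (f (x + s *\<^sub>R axis j 1 + s *\<^sub>R axis i 1) - f (x + s *\<^sub>R axis j 1) - f (x + s *\<^sub>R axis i 1) + f x) / s\<^sup>2)
    \<longlongrightarrow> partial j (partial i f) x) (at_right 0)"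
    using second_difference_limit[OF f, of x i j] by (simp add: algebra_simps)
qed simp

lemma partial_commute:
  fixes f :: "real^'n::finite \<Rightarrow> 'b::real_inner"
  assumes f: "smooth f"
  shows "partial i (partial j f) = partial j (partial i f)"
proof (rule ext, rule vector_eq_rdot[THEN iffD1], rule allI)
  fix x :: "real^'n" and c :: 'b
  have *: "partial i (\<lambda>x. g x \<bullet> c) = (\<lambda>x. partial i g x \<bullet> c)" if "smooth g" for g i
    using partial_bounded_linear[OF bounded_linear_inner_left[of c]] smooth_differentiable[OF that] by blast
  have "smooth (\<lambda>x. f x \<bullet> c)" by (intro smooth_intros f)
  from partial_commute_real[OF this, of i j x]
  show "partial i (partial j f) x \<bullet> c = partial j (partial i f) x \<bullet> c"
    by (simp add: * f smooth_partial)
qed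


section \<open>Linearization at the flat metric\<close>

lemma matrix_inv_mult:
  fixes A :: "real^'n^'n"
  assumes "det A \<noteq> 0"
  shows "A ** matrix_inv A = mat 1" "matrix_inv A ** A = mat 1"
proof -
  have "\<exists>B. A ** B = mat 1 \<and> B ** A = mat 1"
    using assms by (simp add: invertible_det_nz[symmetric] invertible_def)
  from someI_ex[OF this] show "A ** matrix_inv A = mat 1" "matrix_inv A ** A = mat 1"
    by (auto simp: matrix_inv_def)
qed

lemma mat1_nth: "(mat 1 :: 'a::{zero,one}^'n^'n) $ i $ j = (if i = j then 1 else 0)"
  by (simp add: mat_def)

lemma matrix_inv_mat1 [simp]: "matrix_inv (mat 1 :: real^'n^'n) = mat 1"
  using matrix_inv_mult(1)[of "mat 1 :: real^'n^'n"] by (simp add: matrix_mul_lid)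

text \<open>Cramer's rule exhibits the entries of the inverse as quotients of determinants, from
  which their differentiability is read off.\<close>

lemma matrix_inv_entry:
  fixes A :: "real^'n^'n"
  assumes "det A \<noteq> 0"
  shows "matrix_inv A $ k $ l = det (\<chi> i j. if j = k then axis l 1 $ i else A $ i $ j) / det A"
proof -
  have "A *v (matrix_inv A *v axis l 1) = axis l 1"
    by (simp add: matrix_vector_mul_assoc matrix_inv_mult[OF assms])
  then have "matrix_inv A *v axis l 1
      = (\<chi> k. det (\<chi> i j. if j = k then axis l 1 $ i else A $ i $ j) / det A)"
    by (simp add: cramer[OF assms])
  then have "(matrix_inv A *v axis l 1) $ k = det (\<chi> i j. if j = k then axis l 1 $ i else A $ i $ j) / det A"
    by simp
  moreover have "(matrix_inv A *v axis l 1) $ k = matrix_inv A $ k $ l"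
    by (simp add: matrix_vector_mult_def axis_def if_distrib cong: if_cong)
  ultimately show ?thesis by simp
qed

lemma differentiable_prod':
  fixes f :: "'i \<Rightarrow> 'a::real_normed_vector \<Rightarrow> real"
  assumes "finite I" "\<And>i. i \<in> I \<Longrightarrow> f i differentiable (at x)"
  shows "(\<lambda>z. \<Prod>i\<in>I. f i z) differentiable (at x)"
  using assms by (induction I) auto

lemma differentiable_det:
  fixes F :: "'a::real_normed_vector \<Rightarrow> real^'n^'n"
  assumes "\<And>i j. (\<lambda>z. F z $ i $ j) differentiable (at x)"
  shows "(\<lambda>z. det (F z)) differentiable (at x)"
  unfolding det_def
  by (intro differentiable_sum ballI differentiable_mult differentiable_const differentiable_prod' assms) auto

lemma eventually_det_nonzero:
  fixes F :: "'a::real_normed_vector \<Rightarrow> real^'n^'n"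
  assumes "\<And>i j. (\<lambda>z. F z $ i $ j) differentiable (at x)" "det (F x) \<noteq> 0"
  shows "\<forall>\<^sub>F z in nhds x. det (F z) \<noteq> 0"
proof -
  have "isCont (\<lambda>z. det (F z)) x"
    using differentiable_det[OF assms(1)] by (rule differentiable_imp_continuous_within)
  then have "((\<lambda>z. det (F z)) \<longlongrightarrow> det (F x)) (nhds x)"
    unfolding isCont_def by (rule tendsto_at_iff_tendsto_nhds[THEN iffD1])
  from tendsto_imp_eventually_ne[OF this assms(2)] show ?thesis .
qed

lemma differentiable_transform_nhds:
  assumes "f differentiable (at x)" "\<forall>\<^sub>F z in nhds x. g z = f z"
  shows "g differentiable (at x)"
  using assms has_derivative_transform_eventually[of f _ x UNIV g]
  unfolding differentiable_def eventually_nhds_conv_at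
  by (metis (mono_tags, lifting) UNIV_I eventually_mono)

lemma differentiable_matrix_inv:
  fixes F :: "'a::real_normed_vector \<Rightarrow> real^'n^'n"
  assumes "\<And>i j. (\<lambda>z. F z $ i $ j) differentiable (at x)" "det (F x) \<noteq> 0"
  shows "(\<lambda>z. matrix_inv (F z) $ k $ l) differentiable (at x)"
proof (rule differentiable_transform_nhds)
  show "\<forall>\<^sub>F z in nhds x. matrix_inv (F z) $ k $ l = det (\<chi> i j. if j = k then axis l 1 $ i else F z $ i $ j) / det (F z)"
    using eventually_det_nonzero[OF assms] by eventually_elim (rule matrix_inv_entry)
  have "(\<lambda>z. det (\<chi> i j. if j = k then axis l 1 $ i else F z $ i $ j)) differentiable (at x)"
  proof (rule differentiable_det)
    fix i j
    show "(\<lambda>z. (\<chi> i j. if j = k then axis l 1 $ i else F z $ i $ j) $ i $ j) differentiable (at x)"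
      using assms(1)[of i j] by (cases "j = k") auto
  qed
  then show "(\<lambda>z. det (\<chi> i j. if j = k then axis l 1 $ i else F z $ i $ j) / det (F z)) differentiable (at x)"
    by (rule differentiable_divide[OF _ differentiable_det[OF assms(1)] assms(2)])
qed

text \<open>Differentiate A A^(-1) = 1 and multiply by A^(-1) from the left. The product identity is
  known only near x, where the determinant does not vanish, so its derivative is obtained from an
  eventual equality.\<close>

lemma partial_matrix_inv:
  fixes F :: "real^'m::finite \<Rightarrow> real^'n^'n"
  assumes F: "\<And>i j. (\<lambda>z. F z $ i $ j) differentiable (at x)" and d: "det (F x) \<noteq> 0"
  shows "partial i (\<lambda>z. matrix_inv (F z) $ p $ q) x =
    - (\<Sum>k\<in>UNIV. \<Sum>l\<in>UNIV. matrix_inv (F x) $ p $ k * partial i (\<lambda>z. F z $ k $ l) x * matrix_inv (F x) $ l $ q)"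
proof -
  let ?B = "\<lambda>z. matrix_inv (F z)"
  note B = differentiable_matrix_inv[OF F d]
  have *: "(\<Sum>l\<in>UNIV. F x $ k $ l * partial i (\<lambda>z. ?B z $ l $ q) x) =
      - (\<Sum>l\<in>UNIV. partial i (\<lambda>z. F z $ k $ l) x * ?B x $ l $ q)" for k
  proof -
    have "(\<Sum>l\<in>UNIV. F x $ k $ l * partial i (\<lambda>z. ?B z $ l $ q) x + partial i (\<lambda>z. F z $ k $ l) x * ?B x $ l $ q)
       = partial i (\<lambda>z. \<Sum>l\<in>UNIV. F z $ k $ l * ?B z $ l $ q) x"
      using F B by (subst partial_sum) (auto simp: partial_mult)
    also have "\<dots> = frechet_derivative (\<lambda>z. mat 1 $ k $ q) (at x) (axis i 1)"
    proof -
      have "((\<lambda>z. \<Sum>l\<in>UNIV. F z $ k $ l * ?B z $ l $ q) has_derivative (\<lambda>v. 0)) (at x)"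
      proof (rule has_derivative_transform_eventually[where f = "\<lambda>z. (mat 1 :: real^'n^'n) $ k $ q"])
        have "\<forall>\<^sub>F z in nhds x. (mat 1 :: real^'n^'n) $ k $ q = (\<Sum>l\<in>UNIV. F z $ k $ l * ?B z $ l $ q)"
          using eventually_det_nonzero[OF F d]
        proof eventually_elim
          case (elim z)
          from matrix_inv_mult(1)[OF this] show ?case
            by (simp add: vec_eq_iff matrix_matrix_mult_def)
        qed
        then show "\<forall>\<^sub>F z in at x. (mat 1 :: real^'n^'n) $ k $ q = (\<Sum>l\<in>UNIV. F z $ k $ l * ?B z $ l $ q)"
          and "(mat 1 :: real^'n^'n) $ k $ q = (\<Sum>l\<in>UNIV. F x $ k $ l * ?B x $ l $ q)"
          by (auto simp: eventually_nhds_conv_at)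
      qed auto
      from partial_eq[OF this] show ?thesis by simp
    qed
    finally show ?thesis by (simp add: sum.distrib)
  qed
  have "partial i (\<lambda>z. ?B z $ p $ q) x = (\<Sum>l\<in>UNIV. mat 1 $ p $ l * partial i (\<lambda>z. ?B z $ l $ q) x)"
    by (simp add: mat1_nth if_distrib[of "\<lambda>a. a * _"] cong: if_cong)
  also have "\<dots> = (\<Sum>l\<in>UNIV. \<Sum>k\<in>UNIV. ?B x $ p $ k * F x $ k $ l * partial i (\<lambda>z. ?B z $ l $ q) x)"
    unfolding matrix_inv_mult(2)[OF d, symmetric] by (simp add: matrix_matrix_mult_def sum_distrib_right)
  also have "\<dots> = (\<Sum>k\<in>UNIV. ?B x $ p $ k * (\<Sum>l\<in>UNIV. F x $ k $ l * partial i (\<lambda>z. ?B z $ l $ q) x))"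
    by (subst sum.swap) (simp add: sum_distrib_left mult.assoc)
  also have "\<dots> = - (\<Sum>k\<in>UNIV. \<Sum>l\<in>UNIV. ?B x $ p $ k * partial i (\<lambda>z. F z $ k $ l) x * ?B x $ l $ q)"
    by (simp add: * sum_distrib_left sum_negf mult.assoc)
  finally show ?thesis .
qed

text \<open>All curvature quantities vanish at the flat metric s = 0. Writing them as s times a
  factor that is merely continuous gives their derivative as the value of that factor, so the
  inverse metric never has to be differentiated in s. \<open>DERIV_mult_cont\<close> is the matching
  product rule.\<close>

lemma DERIV_mult_vanishing:
  fixes \<psi> :: "real \<Rightarrow> real"
  assumes "\<forall>\<^sub>F s in nhds 0. f s = s * \<psi> s" "isCont \<psi> 0"
  shows "(f has_real_derivative \<psi> 0) (at 0)" "f 0 = 0"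
proof -
  show f0: "f 0 = 0" using eventually_nhds_x_imp_x[OF assms(1)] by simp
  have "((\<lambda>s. \<psi> s) \<longlongrightarrow> \<psi> 0) (at 0)" using assms(2) by (simp add: isCont_def)
  moreover have "\<forall>\<^sub>F s in at 0. \<psi> s = (f s - f 0) / (s - 0)"
    using assms(1) unfolding eventually_nhds_conv_at f0
    by (auto simp: eventually_at_filter elim: eventually_mono)
  ultimately show "(f has_real_derivative \<psi> 0) (at 0)"
    unfolding has_field_derivative_iff using f0 tendsto_cong by force
qed

lemma DERIV_mult_cont:
  fixes f g :: "real \<Rightarrow> real"
  assumes f: "(f has_real_derivative c) (at 0)" "f 0 = 0" and g: "isCont g 0"
  shows "((\<lambda>s. f s * g s) has_real_derivative c * g 0) (at 0)"
proof -
  have "((\<lambda>s. (f s - f 0) / (s - 0) * g s) \<longlongrightarrow> c * g 0) (at 0)"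
    using f(1) g unfolding has_field_derivative_iff isCont_def by (rule tendsto_mult)
  then show ?thesis unfolding has_field_derivative_iff by (simp add: f)
qed

section \<open>First variation of the curvature at the flat metric\<close>

definition lin_riem :: "(real^4 \<Rightarrow> real^4^4) \<Rightarrow> real^4 \<Rightarrow> 4 \<Rightarrow> 4 \<Rightarrow> 4 \<Rightarrow> 4 \<Rightarrow> real" where
  "lin_riem h x i j k l = (1/2) *
    (partial i (partial l (\<lambda>z. h z $ j $ k)) x - partial i (partial k (\<lambda>z. h z $ j $ l)) x
     - partial j (partial l (\<lambda>z. h z $ i $ k)) x + partial j (partial k (\<lambda>z. h z $ i $ l)) x)"

definition contr_ric :: "(4 \<Rightarrow> 4 \<Rightarrow> 4 \<Rightarrow> 4 \<Rightarrow> real) \<Rightarrow> 4 \<Rightarrow> 4 \<Rightarrow> real" where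
  "contr_ric R j l = (\<Sum>i\<in>UNIV. R i j i l)"

definition contr_scal :: "(4 \<Rightarrow> 4 \<Rightarrow> 4 \<Rightarrow> 4 \<Rightarrow> real) \<Rightarrow> real" where
  "contr_scal R = (\<Sum>j\<in>UNIV. contr_ric R j j)"

definition delta :: "4 \<Rightarrow> 4 \<Rightarrow> real" where
  "delta i j = (if i = j then 1 else 0)"

definition weyl_part :: "(4 \<Rightarrow> 4 \<Rightarrow> 4 \<Rightarrow> 4 \<Rightarrow> real) \<Rightarrow> 4 \<Rightarrow> 4 \<Rightarrow> 4 \<Rightarrow> 4 \<Rightarrow> real" where
  "weyl_part R i j k l = R i j k l
     - (1/2) * (delta i k * contr_ric R j l - delta i l * contr_ric R j k
                - delta j k * contr_ric R i l + delta j l * contr_ric R i k)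
     + (contr_scal R / 6) * (delta i k * delta j l - delta i l * delta j k)"

lemma gcyl_const: "gcyl = (\<lambda>x. mat 1)"
  by (rule ext) (rule gcyl_eq)

context
  fixes h :: "real^4 \<Rightarrow> real^4^4" and x :: "real^4"
  assumes h: "smooth h"
begin

lemma smooth_h_entry: "smooth (\<lambda>z. h z $ i $ j)"
  by (intro smooth_intros h)

lemma h_diff [simp]: "(\<lambda>z. h z $ i $ j) differentiable (at z)"
  using smooth_h_entry by (rule smooth_differentiable)

lemma h_diff2 [simp]: "partial k (\<lambda>z. h z $ i $ j) differentiable (at z)"
  by (intro smooth_differentiable smooth_partial smooth_h_entry)

lemma pert_diff [simp]: "(\<lambda>z. (mat 1 + s *\<^sub>R h z) $ i $ j) differentiable (at z)"
  by simp

lemma pert_partial: "partial k (\<lambda>z. (mat 1 + s *\<^sub>R h z) $ i $ j) z = s * partial k (\<lambda>z. h z $ i $ j) z"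
  by (simp add: partial_add partial_cmult)

lemma pert_diff_s [simp]: "(\<lambda>s. (mat 1 + s *\<^sub>R h z) $ i $ j) differentiable (at s)"
  by simp

lemma eventually_pert_det: "\<forall>\<^sub>F s in nhds 0. det (mat 1 + s *\<^sub>R h x) \<noteq> 0"
  by (rule eventually_det_nonzero) auto

lemma isCont_pert_inv: "isCont (\<lambda>s. matrix_inv (mat 1 + s *\<^sub>R h x) $ i $ j) 0"
  by (rule differentiable_imp_continuous_within, rule differentiable_matrix_inv) auto

lemma isCont_pert: "isCont (\<lambda>s. (mat 1 + s *\<^sub>R h x) $ i $ j) 0"
  by (rule differentiable_imp_continuous_within) auto

lemma isCont_pert_det: "isCont (\<lambda>s. det (mat 1 + s *\<^sub>R h x)) 0"
  by (rule differentiable_imp_continuous_within, rule differentiable_det) auto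

text \<open>Twice the Christoffel symbol of the first kind formed with h; the constant part of the
  metric contributes nothing to it.\<close>

definition "chr1 j l p z = partial j (\<lambda>z. h z $ l $ p) z + partial l (\<lambda>z. h z $ j $ p) z - partial p (\<lambda>z. h z $ j $ l) z"

lemma chr1_diff: "chr1 j l p differentiable (at z)"
  unfolding chr1_def by (intro differentiable_add differentiable_diff h_diff2)

lemma pert_christoffel: "christoffel (\<lambda>z. mat 1 + s *\<^sub>R h z) z m j l =
    s * ((1/2) * (\<Sum>p\<in>UNIV. matrix_inv (mat 1 + s *\<^sub>R h z) $ m $ p * chr1 j l p z))"
  unfolding christoffel_def pert_partial chr1_def
  by (simp add: sum_distrib_left algebra_simps)

text \<open>The form on the right displays one factor s, as \<open>DERIV_mult_vanishing\<close>
  requires; the inner s comes from differentiating the inverse metric in x.\<close>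

lemma pert_partial_christoffel:
  assumes "det (mat 1 + s *\<^sub>R h x) \<noteq> 0"
  shows "partial i (\<lambda>z. christoffel (\<lambda>z. mat 1 + s *\<^sub>R h z) z m j l) x =
    s * ((1/2) * (\<Sum>p\<in>UNIV. matrix_inv (mat 1 + s *\<^sub>R h x) $ m $ p * partial i (chr1 j l p) x
      - s * (\<Sum>k\<in>UNIV. \<Sum>q\<in>UNIV. matrix_inv (mat 1 + s *\<^sub>R h x) $ m $ k * partial i (\<lambda>z. h z $ k $ q) x * matrix_inv (mat 1 + s *\<^sub>R h x) $ q $ p) * chr1 j l p x))"
proof -
  have B: "(\<lambda>z. matrix_inv (mat 1 + s *\<^sub>R h z) $ a $ b) differentiable (at x)" for a b
    by (rule differentiable_matrix_inv[OF pert_diff assms])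
  have Bp: "(\<lambda>z. matrix_inv (mat 1 + s *\<^sub>R h z) $ a $ b * chr1 j l b z) differentiable (at x)" for a b
    by (intro differentiable_mult B chr1_diff)
  have S: "(\<lambda>z. \<Sum>b\<in>UNIV. matrix_inv (mat 1 + s *\<^sub>R h z) $ a $ b * chr1 j l b z) differentiable (at x)" for a
    by (intro differentiable_sum ballI Bp) auto
  have "partial i (\<lambda>z. christoffel (\<lambda>z. mat 1 + s *\<^sub>R h z) z m j l) x =
     s * (1/2 * partial i (\<lambda>z. \<Sum>b\<in>UNIV. matrix_inv (mat 1 + s *\<^sub>R h z) $ m $ b * chr1 j l b z) x)"
    unfolding pert_christoffel
    by (subst partial_cmult, intro differentiable_mult S) (simp, subst partial_cmult, intro S, simp)
  also have "\<dots> = s * (1/2 * (\<Sum>b\<in>UNIV. matrix_inv (mat 1 + s *\<^sub>R h x) $ m $ b * partial i (chr1 j l b) x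
     + partial i (\<lambda>z. matrix_inv (mat 1 + s *\<^sub>R h z) $ m $ b) x * chr1 j l b x))"
    by (simp add: partial_sum Bp partial_mult[OF B chr1_diff])
  finally show ?thesis
    unfolding partial_matrix_inv[OF pert_diff assms] pert_partial
    by (simp add: sum_distrib_left sum_distrib_right algebra_simps)
qed

lemma DERIV_riem:
  "((\<lambda>s. riem (\<lambda>z. mat 1 + s *\<^sub>R h z) x i j k l) has_real_derivative lin_riem h x i j k l) (at 0)"
  "riem (\<lambda>z. mat 1 + 0 *\<^sub>R h z) x i j k l = 0"
proof -
  let ?B = "\<lambda>s. matrix_inv (mat 1 + s *\<^sub>R h x)"
  define \<gamma> where "\<gamma> s m j l = (1/2) * (\<Sum>p\<in>UNIV. ?B s $ m $ p * chr1 j l p x)" for s m j l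
  define d\<gamma> where "d\<gamma> s i m j l = (1/2) * (\<Sum>p\<in>UNIV. ?B s $ m $ p * partial i (chr1 j l p) x
      - s * (\<Sum>k\<in>UNIV. \<Sum>q\<in>UNIV. ?B s $ m $ k * partial i (\<lambda>z. h z $ k $ q) x * ?B s $ q $ p) * chr1 j l p x)"
    for s i m j l
  \<comment> \<open>The curvature divided by s. The products of two Christoffel symbols carry s^2,
    hence keep a factor s here and disappear at s = 0.\<close>
  define \<psi> where "\<psi> s = (\<Sum>m\<in>UNIV. (mat 1 + s *\<^sub>R h x) $ k $ m *
     (d\<gamma> s i m j l - d\<gamma> s j m i l + s * (\<Sum>p\<in>UNIV. \<gamma> s m i p * \<gamma> s p j l - \<gamma> s m j p * \<gamma> s p i l)))" for s
  have ev: "\<forall>\<^sub>F s in nhds 0. riem (\<lambda>z. mat 1 + s *\<^sub>R h z) x i j k l = s * \<psi> s"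
    using eventually_pert_det
  proof eventually_elim
    case (elim s)
    have 1: "partial i (\<lambda>z. christoffel (\<lambda>z. mat 1 + s *\<^sub>R h z) z m j l) x = s * d\<gamma> s i m j l" for i m j l
      unfolding pert_partial_christoffel[OF elim] d\<gamma>_def ..
    have 2: "christoffel (\<lambda>z. mat 1 + s *\<^sub>R h z) x m j l = s * \<gamma> s m j l" for m j l
      unfolding pert_christoffel \<gamma>_def ..
    have "(\<Sum>p\<in>UNIV. s * \<gamma> s m i p * (s * \<gamma> s p j l) - s * \<gamma> s m j p * (s * \<gamma> s p i l))
        = s * (s * (\<Sum>p\<in>UNIV. \<gamma> s m i p * \<gamma> s p j l - \<gamma> s m j p * \<gamma> s p i l))" for m
      unfolding sum_distrib_left by (rule sum.cong) (auto simp: algebra_simps)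
    then have "riem (\<lambda>z. mat 1 + s *\<^sub>R h z) x i j k l = (\<Sum>m\<in>UNIV. s * ((mat 1 + s *\<^sub>R h x) $ k $ m *
       (d\<gamma> s i m j l - d\<gamma> s j m i l + s * (\<Sum>p\<in>UNIV. \<gamma> s m i p * \<gamma> s p j l - \<gamma> s m j p * \<gamma> s p i l))))"
      unfolding riem_def 1 2 by (intro sum.cong refl) (simp only: distrib_left right_diff_distrib mult.left_commute)
    then show ?case unfolding \<psi>_def sum_distrib_left .
  qed
  note cont_rules = continuous_add continuous_diff continuous_mult continuous_sum continuous_const
    continuous_ident isCont_pert_inv isCont_pert
  have \<gamma>: "isCont (\<lambda>s. \<gamma> s m j l) 0" for m j l
    unfolding \<gamma>_def by (intro cont_rules)
  have d\<gamma>: "isCont (\<lambda>s. d\<gamma> s i m j l) 0" for i m j l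
    unfolding d\<gamma>_def by (intro cont_rules)
  have cont: "isCont \<psi> 0"
    unfolding \<psi>_def by (intro cont_rules \<gamma> d\<gamma>)
  have mat: "(\<Sum>m\<in>UNIV. mat 1 $ k $ m * f m) = f k" for f :: "4 \<Rightarrow> real" and k
    by (simp add: mat1_nth if_distrib[of "\<lambda>a. a * _"] cong: if_cong)
  have c: "partial i (chr1 j l k) x = partial i (partial j (\<lambda>z. h z $ l $ k)) x
      + partial i (partial l (\<lambda>z. h z $ j $ k)) x - partial i (partial k (\<lambda>z. h z $ j $ l)) x" for i j k l
    unfolding chr1_def by (simp add: partial_add partial_diff)
  have "\<psi> 0 = (1/2) * partial i (chr1 j l k) x - (1/2) * partial j (chr1 i l k) x"
    unfolding \<psi>_def d\<gamma>_def by (simp add: mat)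
  \<comment> \<open>Of the six second derivatives, the two that differ only in the order of i and j
    cancel.\<close>
  also have "\<dots> = lin_riem h x i j k l"
    using partial_commute[OF smooth_h_entry, of i j l k] unfolding c lin_riem_def
    by (simp add: algebra_simps)
  finally have "\<psi> 0 = lin_riem h x i j k l" .
  then show "((\<lambda>s. riem (\<lambda>z. mat 1 + s *\<^sub>R h z) x i j k l) has_real_derivative lin_riem h x i j k l) (at 0)"
    "riem (\<lambda>z. mat 1 + 0 *\<^sub>R h z) x i j k l = 0"
    using DERIV_mult_vanishing[OF ev cont] by simp_all
qed

lemma DERIV_ric:
  "((\<lambda>s. ric (\<lambda>z. mat 1 + s *\<^sub>R h z) x j l) has_real_derivative contr_ric (lin_riem h x) j l) (at 0)"
  "ric (\<lambda>z. mat 1 + 0 *\<^sub>R h z) x j l = 0"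
proof -
  have "((\<lambda>s. \<Sum>i\<in>UNIV. \<Sum>k\<in>UNIV. riem (\<lambda>z. mat 1 + s *\<^sub>R h z) x i j k l * matrix_inv (mat 1 + s *\<^sub>R h x) $ i $ k)
    has_real_derivative (\<Sum>i\<in>UNIV. \<Sum>k\<in>UNIV. lin_riem h x i j k l * matrix_inv (mat 1 + 0 *\<^sub>R h x) $ i $ k)) (at 0)"
    by (intro DERIV_sum DERIV_mult_cont DERIV_riem isCont_pert_inv)
  then show "((\<lambda>s. ric (\<lambda>z. mat 1 + s *\<^sub>R h z) x j l) has_real_derivative contr_ric (lin_riem h x) j l) (at 0)"
    by (simp add: ric_def contr_ric_def mult.commute mat1_nth if_distrib[of "\<lambda>a. a * _"] cong: if_cong)
qed (simp add: ric_def DERIV_riem(2)[simplified])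

lemma DERIV_scal:
  "((\<lambda>s. scal (\<lambda>z. mat 1 + s *\<^sub>R h z) x) has_real_derivative contr_scal (lin_riem h x)) (at 0)"
  "scal (\<lambda>z. mat 1 + 0 *\<^sub>R h z) x = 0"
proof -
  have "((\<lambda>s. \<Sum>i\<in>UNIV. \<Sum>k\<in>UNIV. ric (\<lambda>z. mat 1 + s *\<^sub>R h z) x i k * matrix_inv (mat 1 + s *\<^sub>R h x) $ i $ k)
    has_real_derivative (\<Sum>i\<in>UNIV. \<Sum>k\<in>UNIV. contr_ric (lin_riem h x) i k * matrix_inv (mat 1 + 0 *\<^sub>R h x) $ i $ k)) (at 0)"
    by (intro DERIV_sum DERIV_mult_cont DERIV_ric isCont_pert_inv)
  then show "((\<lambda>s. scal (\<lambda>z. mat 1 + s *\<^sub>R h z) x) has_real_derivative contr_scal (lin_riem h x)) (at 0)"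
    by (simp add: scal_def contr_scal_def mult.commute mat1_nth if_distrib[of "\<lambda>a. a * _"] cong: if_cong)
qed (simp add: scal_def DERIV_ric(2)[simplified])

text \<open>Every term of the Weyl tensor has a curvature factor that vanishes at s = 0, so the
  metric coefficients enter only through their values there.\<close>

lemma DERIV_weyl:
  "((\<lambda>s. weyl (\<lambda>z. mat 1 + s *\<^sub>R h z) x i j k l) has_real_derivative weyl_part (lin_riem h x) i j k l) (at 0)"
  "weyl (\<lambda>z. mat 1 + 0 *\<^sub>R h z) x i j k l = 0"
proof -
  let ?G = "\<lambda>s a b. (mat 1 + s *\<^sub>R h x) $ a $ b" and ?r = "\<lambda>s. ric (\<lambda>z. mat 1 + s *\<^sub>R h z) x"
  have "((\<lambda>s. riem (\<lambda>z. mat 1 + s *\<^sub>R h z) x i j k l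
     - (1/2) * (?r s j l * ?G s i k - ?r s j k * ?G s i l - ?r s i l * ?G s j k + ?r s i k * ?G s j l)
     + (scal (\<lambda>z. mat 1 + s *\<^sub>R h z) x * ((?G s i k * ?G s j l - ?G s i l * ?G s j k) / 6))) has_real_derivative
     lin_riem h x i j k l
     - (1/2) * (contr_ric (lin_riem h x) j l * ?G 0 i k - contr_ric (lin_riem h x) j k * ?G 0 i l
         - contr_ric (lin_riem h x) i l * ?G 0 j k + contr_ric (lin_riem h x) i k * ?G 0 j l)
     + (contr_scal (lin_riem h x) * ((?G 0 i k * ?G 0 j l - ?G 0 i l * ?G 0 j k) / 6))) (at 0)"
    by (intro DERIV_add DERIV_diff DERIV_cmult DERIV_mult_cont DERIV_riem DERIV_ric DERIV_scal continuous_diff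
        continuous_mult continuous_divide continuous_const isCont_pert)
      auto
  then show "((\<lambda>s. weyl (\<lambda>z. mat 1 + s *\<^sub>R h z) x i j k l) has_real_derivative weyl_part (lin_riem h x) i j k l) (at 0)"
    by (simp add: weyl_def weyl_part_def delta_def mat1_nth ac_simps)
qed (simp add: weyl_def DERIV_riem(2)[simplified] DERIV_ric(2)[simplified] DERIV_scal(2)[simplified])

end


section \<open>The Hodge star and the quaternionic frame of the anti-self-dual forms\<close>

lemma vector_4:
  "(vector [a,b,c,d] :: 'a::zero^4) $ 1 = a" "(vector [a,b,c,d] :: 'a^4) $ 2 = b"
  "(vector [a,b,c,d] :: 'a^4) $ 3 = c" "(vector [a,b,c,d] :: 'a^4) $ 4 = d"
  unfolding vector_def by simp_all

lemma det_4:
  "det (A::'a::comm_ring_1^4^4) =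
    A$1$1 * (A$2$2 * A$3$3 * A$4$4 + A$2$3 * A$3$4 * A$4$2 + A$2$4 * A$3$2 * A$4$3
           - A$2$2 * A$3$4 * A$4$3 - A$2$3 * A$3$2 * A$4$4 - A$2$4 * A$3$3 * A$4$2)
  - A$1$2 * (A$2$1 * A$3$3 * A$4$4 + A$2$3 * A$3$4 * A$4$1 + A$2$4 * A$3$1 * A$4$3
           - A$2$1 * A$3$4 * A$4$3 - A$2$3 * A$3$1 * A$4$4 - A$2$4 * A$3$3 * A$4$1)
  + A$1$3 * (A$2$1 * A$3$2 * A$4$4 + A$2$2 * A$3$4 * A$4$1 + A$2$4 * A$3$1 * A$4$2
           - A$2$1 * A$3$4 * A$4$2 - A$2$2 * A$3$1 * A$4$4 - A$2$4 * A$3$2 * A$4$1)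
  - A$1$4 * (A$2$1 * A$3$2 * A$4$3 + A$2$2 * A$3$3 * A$4$1 + A$2$3 * A$3$1 * A$4$2
           - A$2$1 * A$3$3 * A$4$2 - A$2$2 * A$3$1 * A$4$3 - A$2$3 * A$3$2 * A$4$1)"
proof -
  have f: "finite {2::4, 3, 4}" "1 \<notin> {2::4, 3, 4}" "finite {3::4, 4}" "2 \<notin> {3::4, 4}"
    "finite {4::4}" "3 \<notin> {4::4}"
    by auto
  show ?thesis
    unfolding det_def UNIV_4
    unfolding sum_over_permutations_insert[OF f(1,2)]
    unfolding sum_over_permutations_insert[OF f(3,4)]
    unfolding sum_over_permutations_insert[OF f(5,6)]
    unfolding permutes_sing
    by (simp add: sign_swap_id permutation_swap_id permutation_compose sign_compose sign_id swap_id_eq algebra_simps)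
qed

lemma axis_nth_delta: "axis k (1::real) $ i = delta k i"
  by (auto simp: axis_def delta_def)

lemma mat1_delta: "(mat 1 :: real^4^4) $ i $ j = delta i j"
  by (simp add: mat1_nth delta_def)

lemma delta_sum: "(\<Sum>j\<in>UNIV. delta i j * f j) = f i" "(\<Sum>j\<in>UNIV. f j * delta i j) = f i"
  by (simp_all add: delta_def if_distrib[of "\<lambda>a. a * _"] if_distrib[of "\<lambda>a. _ * a"] cong: if_cong)

text \<open>In this form the symbol can be evaluated by simplification at numeral indices.\<close>

lemma levi_delta: "levi i j k l = det (\<chi> r c. delta (vector [i, j, k, l] $ r) c :: real^4^4)"
  unfolding levi_def det_4 by (simp add: vector_4 axis_nth_delta)

lemma hodge_mat1: "hodge (mat 1) w $ k $ l = (1/2) * (\<Sum>i\<in>UNIV. \<Sum>j\<in>UNIV. levi i j k l * w $ i $ j)"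
proof -
  have "(\<Sum>a\<in>UNIV. \<Sum>b\<in>UNIV. levi i j k l * delta i a * delta j b * w $ a $ b) = levi i j k l * w $ i $ j" for i j
    by (simp add: mult.assoc sum_distrib_left[symmetric] delta_sum)
  then show ?thesis by (simp add: hodge_def mat1_delta det_I)
qed

text \<open>For \<open>m = 2, 3, 4\<close> these are the anti-self-dual forms \<open>e\<^sub>1 \<and> e\<^sub>m - \<star>(e\<^sub>1 \<and> e\<^sub>m)\<close>, which are
  also the left multiplications by the imaginary quaternions up to sign; \<open>m = 1\<close> is the identity.\<close>

definition asdq :: "4 \<Rightarrow> real^4^4" where
  "asdq m = (if m = 1 then mat 1
     else if m = 2 then vector [vector [0,1,0,0], vector [-1,0,0,0], vector [0,0,0,-1], vector [0,0,1,0]]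
     else if m = 3 then vector [vector [0,0,1,0], vector [0,0,0,1], vector [-1,0,0,0], vector [0,-1,0,0]]
     else vector [vector [0,0,0,1], vector [0,0,-1,0], vector [0,1,0,0], vector [-1,0,0,0]])"

lemma asdq_rows:
  "asdq 1 = vector [vector [1,0,0,0], vector [0,1,0,0], vector [0,0,1,0], vector [0,0,0,1]]"
  "asdq 2 = vector [vector [0,1,0,0], vector [-1,0,0,0], vector [0,0,0,-1], vector [0,0,1,0]]"
  "asdq 3 = vector [vector [0,0,1,0], vector [0,0,0,1], vector [-1,0,0,0], vector [0,-1,0,0]]"
  "asdq 4 = vector [vector [0,0,0,1], vector [0,0,-1,0], vector [0,1,0,0], vector [-1,0,0,0]]"
  by (simp_all add: asdq_def vec_eq_iff forall_4 vector_4 mat1_nth)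

lemma hodge_mat1_entries:
  "hodge (mat 1) w $ 1 $ 1 = 0" "hodge (mat 1) w $ 2 $ 2 = 0"
  "hodge (mat 1) w $ 3 $ 3 = 0" "hodge (mat 1) w $ 4 $ 4 = 0"
  "hodge (mat 1) w $ 1 $ 2 = (w $ 3 $ 4 - w $ 4 $ 3) / 2" "hodge (mat 1) w $ 2 $ 1 = (w $ 4 $ 3 - w $ 3 $ 4) / 2"
  "hodge (mat 1) w $ 1 $ 3 = (w $ 4 $ 2 - w $ 2 $ 4) / 2" "hodge (mat 1) w $ 3 $ 1 = (w $ 2 $ 4 - w $ 4 $ 2) / 2"
  "hodge (mat 1) w $ 1 $ 4 = (w $ 2 $ 3 - w $ 3 $ 2) / 2" "hodge (mat 1) w $ 4 $ 1 = (w $ 3 $ 2 - w $ 2 $ 3) / 2"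
  "hodge (mat 1) w $ 3 $ 4 = (w $ 1 $ 2 - w $ 2 $ 1) / 2" "hodge (mat 1) w $ 4 $ 3 = (w $ 2 $ 1 - w $ 1 $ 2) / 2"
  "hodge (mat 1) w $ 4 $ 2 = (w $ 1 $ 3 - w $ 3 $ 1) / 2" "hodge (mat 1) w $ 2 $ 4 = (w $ 3 $ 1 - w $ 1 $ 3) / 2"
  "hodge (mat 1) w $ 2 $ 3 = (w $ 1 $ 4 - w $ 4 $ 1) / 2" "hodge (mat 1) w $ 3 $ 2 = (w $ 4 $ 1 - w $ 1 $ 4) / 2"
  unfolding hodge_mat1 sum_4 levi_delta det_4 by (simp_all add: vector_4 delta_def)

lemma sum_234: "(\<Sum>a\<in>{2,3,4::4}. f a) = f 2 + f 3 + f 4"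
  by (simp add: add.assoc)

text \<open>The forms \<open>asdq 2\<close>, \<open>asdq 3\<close>, \<open>asdq 4\<close> are an
  orthogonal basis of the anti-self-dual forms, and each has squared norm 4 when all index pairs are
  summed; hence the factor 1/4.\<close>

lemma pi_minus_mat1:
  assumes "\<And>p q. w $ p $ q = - w $ q $ p"
  shows "pi_minus (mat 1) w $ i $ j =
    (\<Sum>a\<in>{2,3,4}. (1/4) * (\<Sum>p\<in>UNIV. \<Sum>q\<in>UNIV. asdq a $ p $ q * w $ p $ q) * asdq a $ i $ j)"
proof -
  have 0: "w $ p $ p = 0" for p using assms[of p p] by simp
  have "\<forall>i j. pi_minus (mat 1) w $ i $ j =
    (\<Sum>a\<in>{2,3,4}. (1/4) * (\<Sum>p\<in>UNIV. \<Sum>q\<in>UNIV. asdq a $ p $ q * w $ p $ q) * asdq a $ i $ j)"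
    unfolding forall_4 sum_234 sum_4 pi_minus_def
    by (simp add: hodge_mat1_entries asdq_rows vector_4 0 assms[of 2 1] assms[of 3 1] assms[of 4 1] assms[of 3 2]
      assms[of 4 2] assms[of 4 3]) (simp add: field_simps)
  then show ?thesis by blast
qed

text \<open>The first row of \<open>asdq a\<close> is the unit vector a, so the coefficients of an
  anti-self-dual form are the entries of its own first row. This is why the entries
  \<open>Z $ 1 $ a $ 1 $ b\<close> serve as coordinates below.\<close>

lemma asd_form_mat1:
  "asd_form (mat 1) w \<longleftrightarrow> (\<forall>i j. w $ i $ j = (\<Sum>a\<in>{2,3,4}. w $ 1 $ a * asdq a $ i $ j))"
  unfolding asd_form_def vec_eq_iff forall_4 sum_234
  by (auto simp: hodge_mat1_entries asdq_rows vector_4)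

context
  fixes h :: "real^4 \<Rightarrow> real^4^4" and x :: "real^4"
  assumes h: "smooth h"
begin

lemma isCont_sqrt_pert_det: "isCont (\<lambda>s. sqrt (det (mat 1 + s *\<^sub>R h x))) 0"
  using isCont_o2[OF isCont_pert_det[OF h] isCont_real_sqrt] .

lemma isCont_pi_minus: "isCont (\<lambda>s. pi_minus (mat 1 + s *\<^sub>R h x) w $ i $ j) 0"
  unfolding pi_minus_def hodge_def vector_scaleR_component vector_minus_component vec_lambda_beta real_scaleR_def
  by (intro continuous_add continuous_diff continuous_mult continuous_sum continuous_const
    continuous_ident isCont_pert_inv[OF h] isCont_sqrt_pert_det)

lemma DERIV_weyl_op:
  assumes "\<And>i j. isCont (\<lambda>s. W s $ i $ j) 0"
  shows "((\<lambda>s. weyl_op (\<lambda>z. mat 1 + s *\<^sub>R h z) x (W s) $ i $ j) has_real_derivative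
      (1/2) * (\<Sum>k\<in>UNIV. \<Sum>l\<in>UNIV. weyl_part (lin_riem h x) i j k l * W 0 $ k $ l)) (at 0)"
    "weyl_op (\<lambda>z. mat 1 + 0 *\<^sub>R h z) x (W 0) $ i $ j = 0"
proof -
  have "((\<lambda>s. weyl_op (\<lambda>z. mat 1 + s *\<^sub>R h z) x (W s) $ i $ j) has_real_derivative
      (1/2) * (\<Sum>k\<in>UNIV. \<Sum>l\<in>UNIV. \<Sum>a\<in>UNIV. \<Sum>b\<in>UNIV. weyl_part (lin_riem h x) i j k l *
        matrix_inv (mat 1 + 0 *\<^sub>R h x) $ k $ a * matrix_inv (mat 1 + 0 *\<^sub>R h x) $ l $ b * W 0 $ a $ b)) (at 0)"
    unfolding weyl_op_def vec_lambda_beta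
    by (intro DERIV_cmult DERIV_sum DERIV_mult_cont DERIV_weyl[OF h] assms isCont_pert_inv[OF h])
      (simp_all only: DERIV_weyl(2)[OF h] mult_zero_left)
  moreover have "(\<Sum>a\<in>UNIV. \<Sum>b\<in>UNIV. F * delta k a * delta l b * W 0 $ a $ b) = F * W 0 $ k $ l" for F k l
    by (simp add: mult.assoc sum_distrib_left[symmetric] delta_sum)
  ultimately show "((\<lambda>s. weyl_op (\<lambda>z. mat 1 + s *\<^sub>R h z) x (W s) $ i $ j) has_real_derivative
      (1/2) * (\<Sum>k\<in>UNIV. \<Sum>l\<in>UNIV. weyl_part (lin_riem h x) i j k l * W 0 $ k $ l)) (at 0)"
    by (simp add: mat1_delta)
  show "weyl_op (\<lambda>z. mat 1 + 0 *\<^sub>R h z) x (W 0) $ i $ j = 0"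
    unfolding weyl_op_def vec_lambda_beta DERIV_weyl(2)[OF h] by simp
qed

text \<open>The projection also moves with s, but its variation multiplies \<open>V 0\<close>, which
  is zero; only continuity of its coefficients matters.\<close>

lemma DERIV_pi_minus:
  assumes d: "\<And>i j. ((\<lambda>s. V s $ i $ j) has_real_derivative V' $ i $ j) (at 0)" and V0: "\<And>i j. V 0 $ i $ j = 0"
  shows "((\<lambda>s. pi_minus (mat 1 + s *\<^sub>R h x) (V s) $ i $ j) has_real_derivative pi_minus (mat 1) V' $ i $ j) (at 0)"
proof -
  let ?B = "\<lambda>s. matrix_inv (mat 1 + s *\<^sub>R h x)"
  have "((\<lambda>s. (1/2) * (V s $ i $ j - (1/2) * (\<Sum>p\<in>UNIV. \<Sum>q\<in>UNIV. \<Sum>a\<in>UNIV. \<Sum>b\<in>UNIV.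
     V s $ a $ b * (sqrt (det (mat 1 + s *\<^sub>R h x)) * levi p q i j * ?B s $ p $ a * ?B s $ q $ b)))) has_real_derivative
     (1/2) * (V' $ i $ j - (1/2) * (\<Sum>p\<in>UNIV. \<Sum>q\<in>UNIV. \<Sum>a\<in>UNIV. \<Sum>b\<in>UNIV.
     V' $ a $ b * (sqrt (det (mat 1 + 0 *\<^sub>R h x)) * levi p q i j * ?B 0 $ p $ a * ?B 0 $ q $ b)))) (at 0)"
    by (intro DERIV_cmult DERIV_diff DERIV_sum DERIV_mult_cont d V0 continuous_mult continuous_const
       isCont_pert_inv[OF h] isCont_sqrt_pert_det)
  then show ?thesis
    by (simp add: pi_minus_def hodge_def mult.commute)
qed

lemma DERIV_Wminus:
  "((\<lambda>s. Wminus (\<lambda>z. mat 1 + s *\<^sub>R h z) x w $ i $ j) has_real_derivative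
    pi_minus (mat 1) (\<chi> i j. (1/2) * (\<Sum>k\<in>UNIV. \<Sum>l\<in>UNIV. weyl_part (lin_riem h x) i j k l * pi_minus (mat 1) w $ k $ l)) $ i $ j) (at 0)"
proof -
  have "((\<lambda>s. pi_minus (mat 1 + s *\<^sub>R h x) (weyl_op (\<lambda>z. mat 1 + s *\<^sub>R h z) x (pi_minus (mat 1 + s *\<^sub>R h x) w)) $ i $ j) has_real_derivative
    pi_minus (mat 1) (\<chi> i j. (1/2) * (\<Sum>k\<in>UNIV. \<Sum>l\<in>UNIV. weyl_part (lin_riem h x) i j k l * pi_minus (mat 1 + 0 *\<^sub>R h x) w $ k $ l)) $ i $ j) (at 0)"
    by (rule DERIV_pi_minus, unfold vec_lambda_beta)
      (rule DERIV_weyl_op[where W = "\<lambda>s. pi_minus (mat 1 + s *\<^sub>R h x) w", OF isCont_pi_minus])+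
  then show ?thesis by (simp add: Wminus_def)
qed

text \<open>The factor 1/16 is 1/4 from the outer projection, 1/2 from the definition of
  \<open>weyl_op\<close>, and 1/2 from the inner projection, since the pairing of
  \<open>asdq b\<close> with \<open>wedge k l\<close> is twice an entry of
  \<open>asdq b\<close>.\<close>

definition dop_coeff :: "4 \<Rightarrow> 4 \<Rightarrow> real" where
  "dop_coeff a b = (1/16) * (\<Sum>i\<in>UNIV. \<Sum>j\<in>UNIV. \<Sum>k\<in>UNIV. \<Sum>l\<in>UNIV.
     asdq a $ i $ j * weyl_part (lin_riem h x) i j k l * asdq b $ k $ l)"

lemma Dop_dop_coeff:
  "Dop gcyl h x $ i $ j $ k $ l = (\<Sum>a\<in>{2,3,4}. \<Sum>b\<in>{2,3,4}. asdq a $ i $ j * dop_coeff a b * asdq b $ k $ l)"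
proof -
  let ?W = "weyl_part (lin_riem h x)"
  have W: "?W i j k l = - ?W j i k l" for i j k l
  proof -
    have "lin_riem h x i j k l = - lin_riem h x j i k l"
      by (simp add: lin_riem_def field_simps)
    then show ?thesis unfolding weyl_part_def by argo
  qed
  have p: "pi_minus (mat 1) (wedge k l) $ p $ q = (\<Sum>b\<in>{2,3,4}. (1/2) * asdq b $ k $ l * asdq b $ p $ q)" for p q
  proof -
    have "(\<Sum>p\<in>UNIV. \<Sum>q\<in>UNIV. asdq b $ p $ q * wedge k l $ p $ q) = asdq b $ k $ l - asdq b $ l $ k" for b
    proof -
      have "(\<Sum>p\<in>UNIV. \<Sum>q\<in>UNIV. asdq b $ p $ q * wedge k l $ p $ q)
        = (\<Sum>p\<in>UNIV. delta k p * (\<Sum>q\<in>UNIV. delta l q * asdq b $ p $ q)) - (\<Sum>p\<in>UNIV. delta l p * (\<Sum>q\<in>UNIV. delta k q * asdq b $ p $ q))"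
        unfolding wedge_def by (simp add: axis_nth_delta sum_distrib_left sum_subtractf[symmetric] algebra_simps)
      then show ?thesis by (simp only: delta_sum)
    qed
    moreover have "asdq b $ l $ k = - asdq b $ k $ l" if "b \<in> {2,3,4}" for b
    proof -
      have "\<forall>b\<in>{2,3,4}. \<forall>l k. asdq b $ l $ k = - asdq b $ k $ l"
        by (simp add: forall_4 asdq_rows vector_4)
      with that show ?thesis by blast
    qed
    ultimately show ?thesis
      by (subst pi_minus_mat1) (auto simp: wedge_def)
  qed
  have "Dop gcyl h x $ i $ j $ k $ l
    = pi_minus (mat 1) (\<chi> i j. (1/2) * (\<Sum>p\<in>UNIV. \<Sum>q\<in>UNIV. ?W i j p q * pi_minus (mat 1) (wedge k l) $ p $ q)) $ i $ j"
    unfolding Dop_def gcyl_const by (simp add: DERIV_imp_deriv[OF DERIV_Wminus])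
  also have "\<dots> = (\<Sum>a\<in>{2,3,4}. (1/4) * (\<Sum>r\<in>UNIV. \<Sum>s\<in>UNIV. asdq a $ r $ s *
      ((1/2) * (\<Sum>p\<in>UNIV. \<Sum>q\<in>UNIV. ?W r s p q * (\<Sum>b\<in>{2,3,4}. (1/2) * asdq b $ k $ l * asdq b $ p $ q)))) * asdq a $ i $ j)"
  proof -
    have "(\<chi> i j. (1/2) * (\<Sum>p\<in>UNIV. \<Sum>q\<in>UNIV. ?W i j p q * pi_minus (mat 1) (wedge k l) $ p $ q)) $ r $ s
      = - (\<chi> i j. (1/2) * (\<Sum>p\<in>UNIV. \<Sum>q\<in>UNIV. ?W i j p q * pi_minus (mat 1) (wedge k l) $ p $ q)) $ s $ r" for r s
      unfolding vec_lambda_beta W[of r s] by (simp add: sum_negf)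
    from pi_minus_mat1[OF this, of i j] show ?thesis unfolding vec_lambda_beta p .
  qed
  also have "\<dots> = (\<Sum>a\<in>{2,3,4}. \<Sum>b\<in>{2,3,4}. asdq a $ i $ j * dop_coeff a b * asdq b $ k $ l)"
    unfolding dop_coeff_def sum_234
    by (simp add: distrib_left sum.distrib sum_distrib_left sum_distrib_right algebra_simps)
  finally show ?thesis .
qed

end


section \<open>The array E at the level of second derivatives: \<open>H p q j k\<close> stands for
  the (p,q) derivative of h at (j,k)\<close>

definition sd_hess :: "(4 \<Rightarrow> 4 \<Rightarrow> 4 \<Rightarrow> 4 \<Rightarrow> real) \<Rightarrow> 4 \<Rightarrow> 4 \<Rightarrow> real" where
  "sd_hess H a b = (\<Sum>j\<in>UNIV. \<Sum>k\<in>UNIV. \<Sum>p\<in>UNIV. \<Sum>q\<in>UNIV. asdq a $ p $ j * asdq b $ q $ k * H p q j k)"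

definition asdq_pairing :: "(4 \<Rightarrow> 4 \<Rightarrow> 4 \<Rightarrow> 4 \<Rightarrow> real) \<Rightarrow> 4 \<Rightarrow> 4 \<Rightarrow> real" where
  "asdq_pairing R a b = (\<Sum>i\<in>UNIV. \<Sum>j\<in>UNIV. \<Sum>k\<in>UNIV. \<Sum>l\<in>UNIV. asdq a $ i $ j * R i j k l * asdq b $ k $ l)"

lemma asdq_pairing_linear:
  "asdq_pairing (\<lambda>i j k l. R i j k l - c * S i j k l + d * T i j k l) a b =
    asdq_pairing R a b - c * asdq_pairing S a b + d * asdq_pairing T a b"
  unfolding asdq_pairing_def by (simp add: sum.distrib sum_subtractf sum_distrib_left algebra_simps)

text \<open>The traceless part of a Ricci-type tensor interchanges self-dual and anti-self-dual
  forms, so the anti-self-dual block sees only its trace.\<close>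

lemma asdq_pairing_ric:
  assumes r: "\<And>i j. r i j = r j i" and ab: "a \<in> {2,3,4}" "b \<in> {2,3,4}"
  shows "asdq_pairing (\<lambda>i j k l. delta i k * r j l - delta i l * r j k - delta j k * r i l + delta j l * r i k) a b
    = 4 * delta a b * (\<Sum>j\<in>UNIV. r j j)"
proof -
  have "\<forall>a\<in>{2,3,4}. \<forall>b\<in>{2,3,4}. asdq_pairing (\<lambda>i j k l. delta i k * r j l - delta i l * r j k - delta j k * r i l + delta j l * r i k) a b
    = 4 * delta a b * (\<Sum>j\<in>UNIV. r j j)"
    unfolding asdq_pairing_def sum_4
    by (simp add: asdq_rows vector_4)
       (simp add: delta_def r[of 2 1] r[of 3 1] r[of 4 1] r[of 3 2] r[of 4 2] r[of 4 3])
  with ab show ?thesis by blast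
qed

lemma asdq_pairing_delta:
  assumes ab: "a \<in> {2,3,4}" "b \<in> {2,3,4}"
  shows "asdq_pairing (\<lambda>i j k l. delta i k * delta j l - delta i l * delta j k) a b = 8 * delta a b"
proof -
  have "\<forall>a\<in>{2,3,4}. \<forall>b\<in>{2,3,4}. asdq_pairing (\<lambda>i j k l. delta i k * delta j l - delta i l * delta j k) a b = 8 * delta a b"
    unfolding asdq_pairing_def sum_4
    by (simp add: asdq_rows vector_4) (simp add: delta_def)
  with ab show ?thesis by blast
qed

context
  fixes H :: "4 \<Rightarrow> 4 \<Rightarrow> 4 \<Rightarrow> 4 \<Rightarrow> real" and R
  assumes H: "\<And>p q j k. H p q j k = H q p j k" "\<And>p q j k. H p q j k = H p q k j"
  defines "R \<equiv> \<lambda>i j k l. (1/2) * (H i l j k - H i k j l - H j l i k + H j k i l)"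
begin

lemma hess_array_sorted:
  "H 2 1 j k = H 1 2 j k" "H 3 1 j k = H 1 3 j k" "H 4 1 j k = H 1 4 j k"
  "H 3 2 j k = H 2 3 j k" "H 4 2 j k = H 2 4 j k" "H 4 3 j k = H 3 4 j k"
  "H p q 2 1 = H p q 1 2" "H p q 3 1 = H p q 1 3" "H p q 4 1 = H p q 1 4"
  "H p q 3 2 = H p q 2 3" "H p q 4 2 = H p q 2 4" "H p q 4 3 = H p q 3 4"
  by (rule H(1) H(2))+

text \<open>After renaming indices and using the antisymmetry of the forms, each of the four terms
  of R contributes the same multiple -1/2 of \<open>sd_hess H a b\<close>.\<close>

lemma asdq_pairing_riem:
  assumes ab: "a \<in> {2,3,4}" "b \<in> {2,3,4}"
  shows "asdq_pairing R a b = - 2 * sd_hess H a b"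
proof -
  have "\<forall>a\<in>{2,3,4}. \<forall>b\<in>{2,3,4}. asdq_pairing R a b = - 2 * sd_hess H a b"
    unfolding asdq_pairing_def sd_hess_def sum_4
    by (simp add: asdq_rows vector_4) (simp add: R_def hess_array_sorted field_simps)
  with ab show ?thesis by blast
qed

text \<open>The linearized scalar curvature is div div h - Delta tr h. The entry E_11 is div div h
  and the sum of all four E_cc is Delta tr h, so the remaining three account for its
  negative.\<close>

lemma contr_scal_sd_hess: "contr_scal R = - (\<Sum>c\<in>{2,3,4}. sd_hess H c c)"
  unfolding contr_scal_def contr_ric_def R_def sum_4 sum_234 sd_hess_def
  by (simp add: asdq_rows vector_4) (simp add: hess_array_sorted field_simps)

lemma contr_ric_sym: "contr_ric R i j = contr_ric R j i"
  unfolding contr_ric_def R_def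
  using H by (intro sum.cong refl) (metis (no_types, lifting) add.commute diff_diff_eq diff_add_eq)

lemma weyl_part_asdq:
  assumes ab: "a \<in> {2,3,4}" "b \<in> {2,3,4}"
  shows "asdq_pairing (weyl_part R) a b
    = - 2 * (sd_hess H a b - (1/3) * delta a b * (\<Sum>c\<in>{2,3,4}. sd_hess H c c))"
proof -
  have "asdq_pairing (weyl_part R) a b = asdq_pairing R a b
    - (1/2) * asdq_pairing (\<lambda>i j k l. delta i k * contr_ric R j l - delta i l * contr_ric R j k - delta j k * contr_ric R i l + delta j l * contr_ric R i k) a b
    + (contr_scal R / 6) * asdq_pairing (\<lambda>i j k l. delta i k * delta j l - delta i l * delta j k) a b"
    unfolding weyl_part_def[abs_def] asdq_pairing_linear ..
  \<comment> \<open>The Ricci part contributes -1/2 times 4 and the scalar part 1/6 times 8. Their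
    sum -2/3 is exactly the coefficient that removes the trace of \<open>sd_hess\<close>.\<close>
  also have "\<dots> = - 2 * sd_hess H a b - 2 * delta a b * contr_scal R + (4/3) * delta a b * contr_scal R"
    unfolding asdq_pairing_ric[OF contr_ric_sym ab] asdq_pairing_delta[OF ab] asdq_pairing_riem[OF ab]
      contr_scal_def[symmetric] by simp
  finally show ?thesis unfolding contr_scal_sd_hess by (simp add: algebra_simps)
qed

end

definition hess :: "(real^4 \<Rightarrow> real^4^4) \<Rightarrow> real^4 \<Rightarrow> 4 \<Rightarrow> 4 \<Rightarrow> 4 \<Rightarrow> 4 \<Rightarrow> real" where
  "hess h x p q j k = partial p (partial q (\<lambda>z. h z $ j $ k)) x"

lemma dop_coeff_eq:
  assumes h: "smooth h" and sym: "\<And>x i j. h x $ i $ j = h x $ j $ i" and ab: "a \<in> {2,3,4}" "b \<in> {2,3,4}"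
  shows "dop_coeff h x a b = - (1/8) * (sd_hess (hess h x) a b - (1/3) * delta a b * (\<Sum>c\<in>{2,3,4}. sd_hess (hess h x) c c))"
proof -
  have 1: "hess h x p q j k = hess h x q p j k" "hess h x p q j k = hess h x p q k j" for p q j k
    unfolding hess_def using partial_commute[OF smooth_h_entry[OF h]] sym[of _ j k] by simp_all
  have R: "lin_riem h x = (\<lambda>i j k l. (1/2) * (hess h x i l j k - hess h x i k j l - hess h x j l i k + hess h x j k i l))"
    by (intro ext) (simp add: lin_riem_def hess_def)
  have alg: "(1/16) * (- 2 * t) = - (1/8) * t" for t :: real
    by simp
  show ?thesis
    unfolding dop_coeff_def[OF h] asdq_pairing_def[symmetric] R weyl_part_asdq[of "hess h x", OF 1 ab] alg ..
qed

section \<open>The quaternionic gradients: \<open>qd m j\<close> is component j of I_m applied to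
  the gradient, up to the transpose\<close>

definition qd :: "4 \<Rightarrow> 4 \<Rightarrow> (real^4 \<Rightarrow> real) \<Rightarrow> real^4 \<Rightarrow> real" where
  "qd m j f x = (\<Sum>i\<in>UNIV. asdq m $ i $ j * partial i f x)"

definition lap :: "(real^'n::finite \<Rightarrow> 'b::real_normed_vector) \<Rightarrow> real^'n \<Rightarrow> 'b" where
  "lap f x = (\<Sum>i\<in>UNIV. partial i (partial i f) x)"

lemma smooth_qd: "smooth f \<Longrightarrow> smooth (qd m j f)"
  unfolding qd_def[abs_def] by (intro smooth_intros)

lemma smooth_lap: "smooth f \<Longrightarrow> smooth (lap f)"
  unfolding lap_def[abs_def] by (intro smooth_intros)

lemma partial_sum_smooth:
  "(\<And>k. k \<in> K \<Longrightarrow> smooth (f k)) \<Longrightarrow> partial i (\<lambda>x. \<Sum>k\<in>K. f k x) = (\<lambda>x. \<Sum>k\<in>K. partial i (f k) x)"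
  by (rule ext) (simp add: partial_sum smooth_differentiable)

lemma partial_cmult_smooth:
  fixes f :: "real^'n \<Rightarrow> 'b::real_normed_algebra"
  shows "smooth f \<Longrightarrow> partial i (\<lambda>x. c * f x) = (\<lambda>x. c * partial i f x)"
  by (rule ext) (simp add: partial_cmult smooth_differentiable)

lemma qd_sum:
  "(\<And>k. k \<in> K \<Longrightarrow> smooth (f k)) \<Longrightarrow> qd m j (\<lambda>x. \<Sum>k\<in>K. f k x) = (\<lambda>x. \<Sum>k\<in>K. qd m j (f k) x)"
  by (rule ext, unfold qd_def) (subst sum.swap, simp add: partial_sum_smooth sum_distrib_left)

lemma lap_sum:
  "(\<And>k. k \<in> K \<Longrightarrow> smooth (f k)) \<Longrightarrow> lap (\<lambda>x. \<Sum>k\<in>K. f k x) = (\<lambda>x. \<Sum>k\<in>K. lap (f k) x)"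
  by (rule ext, unfold lap_def) (subst sum.swap, simp add: partial_sum_smooth smooth_partial)

lemma qd_cmult: "smooth f \<Longrightarrow> qd m j (\<lambda>x. c * f x) = (\<lambda>x. c * qd m j f x)"
  by (rule ext) (simp add: qd_def partial_cmult_smooth sum_distrib_left mult.left_commute[of c])

lemma lap_cmult:
  fixes f :: "real^'n::finite \<Rightarrow> 'b::real_normed_algebra"
  assumes "smooth f"
  shows "lap (\<lambda>x. c * f x) = (\<lambda>x. c * lap f x)"
  by (rule ext) (simp add: lap_def partial_cmult_smooth smooth_partial assms sum_distrib_left)

lemma qd_zero [simp]: "qd m j (\<lambda>x. 0) = (\<lambda>x. 0)"
  by (rule ext) (simp add: qd_def)

lemma lap_zero [simp]: "lap (\<lambda>x. 0) = (\<lambda>x. 0)"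
  by (rule ext) (simp add: lap_def)

lemma qd_qd:
  assumes f: "smooth f"
  shows "qd m j (qd n k f) x = (\<Sum>p\<in>UNIV. \<Sum>q\<in>UNIV. asdq m $ p $ j * asdq n $ q $ k * partial p (partial q f) x)"
proof -
  have "partial p (qd n k f) x = (\<Sum>q\<in>UNIV. asdq n $ q $ k * partial p (partial q f) x)" for p
    unfolding qd_def[abs_def]
    by (simp add: partial_sum_smooth partial_cmult_smooth smooth_intros f)
  then show ?thesis by (simp add: qd_def[of m] sum_distrib_left mult.assoc)
qed

lemma partial_lap:
  fixes f :: "real^'n::finite \<Rightarrow> 'b::real_inner"
  assumes f: "smooth f"
  shows "partial i (lap f) = lap (partial i f)"
proof -
  have "partial i (partial k (partial k f)) = partial k (partial k (partial i f))" for k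
    using partial_commute[OF f, of i k] partial_commute[OF smooth_partial[OF f, of k], of i k] by simp
  moreover have "partial i (lap f) = (\<lambda>x. \<Sum>k\<in>UNIV. partial i (partial k (partial k f)) x)"
    unfolding lap_def[abs_def] by (rule partial_sum_smooth) (intro smooth_partial f)
  ultimately show ?thesis by (simp add: lap_def[abs_def])
qed

lemma qd_lap:
  assumes f: "smooth f"
  shows "lap (qd m j f) = qd m j (lap f)"
proof -
  have "lap (qd m j f) = (\<lambda>x. \<Sum>i\<in>UNIV. lap (\<lambda>x. asdq m $ i $ j * partial i f x) x)"
    unfolding qd_def[abs_def] by (rule lap_sum) (intro smooth_intros f)
  also have "\<dots> = (\<lambda>x. \<Sum>i\<in>UNIV. asdq m $ i $ j * lap (partial i f) x)"
    by (simp add: lap_cmult smooth_partial f)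
  finally show ?thesis by (simp add: qd_def[abs_def] partial_lap[OF f])
qed

lemma qd_commute:
  assumes f: "smooth f"
  shows "qd m j (qd n k f) x = qd n k (qd m j f) x"
  unfolding qd_qd[OF f] using partial_commute[OF f]
  by (subst sum.swap) (simp add: mult.commute[of "asdq n $ _ $ _"])

lemma hess_sorted:
  assumes "smooth (f :: real^4 \<Rightarrow> real)"
  shows "partial 2 (partial 1 f) = partial 1 (partial 2 f)" "partial 3 (partial 1 f) = partial 1 (partial 3 f)"
    "partial 4 (partial 1 f) = partial 1 (partial 4 f)" "partial 3 (partial 2 f) = partial 2 (partial 3 f)"
    "partial 4 (partial 2 f) = partial 2 (partial 4 f)" "partial 4 (partial 3 f) = partial 3 (partial 4 f)"
  using partial_commute[OF assms] by blast+

text \<open>For a fixed covector the 4 x 4 symbol of \<open>qd m j\<close> is the matrix of a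
  quaternion multiplication, that is, the length of the covector times an orthogonal matrix. This
  lemma and \<open>qd_sum_indices\<close> are the orthogonality of its columns and of its
  rows.\<close>

lemma qd_sum_forms:
  assumes "smooth f"
  shows "(\<Sum>m\<in>UNIV. qd m j (qd m k f) x) = delta j k * lap f x"
proof -
  have "\<forall>j k. (\<Sum>m\<in>UNIV. qd m j (qd m k f) x) = delta j k * lap f x"
    unfolding qd_qd[OF assms] forall_4 sum_4 lap_def asdq_rows vector_4
    by (simp add: hess_sorted[OF assms] delta_def)
  then show ?thesis by blast
qed

lemma qd_sum_indices:
  assumes "smooth f"
  shows "(\<Sum>j\<in>UNIV. qd m j (qd n j f) x) = delta m n * lap f x"
proof -
  have "\<forall>m n. (\<Sum>j\<in>UNIV. qd m j (qd n j f) x) = delta m n * lap f x"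
    unfolding qd_qd[OF assms] forall_4 sum_4 lap_def asdq_rows vector_4
    by (simp add: hess_sorted[OF assms] delta_def)
  then show ?thesis by blast
qed

text \<open>The hypothesis is the Cauchy--Riemann--Fueter system of the quaternionic structure \<open>asdq\<close>.\<close>

lemma fueter_harmonic:
  assumes Y: "\<And>j. smooth (Y j)" and eq: "\<And>m x. (\<Sum>j\<in>UNIV. qd m j (Y j) x) = 0"
  shows "lap (Y i) x = 0"
proof -
  have "0 = (\<Sum>m\<in>UNIV. qd m i (\<lambda>x. \<Sum>j\<in>UNIV. qd m j (Y j) x) x)"
    by (simp add: eq)
  also have "\<dots> = (\<Sum>j\<in>UNIV. \<Sum>m\<in>UNIV. qd m i (qd m j (Y j)) x)"
    by (subst sum.swap) (simp add: qd_sum smooth_qd Y)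
  also have "\<dots> = (\<Sum>j\<in>UNIV. delta i j * lap (Y j) x)" by (simp add: qd_sum_forms Y)
  finally show ?thesis by (simp add: delta_sum)
qed


section \<open>The kernel of F as a second-order system\<close>

lemma christoffel_gcyl [simp]: "christoffel gcyl x k i j = 0"
  by (simp add: christoffel_def gcyl_const)

lemma div2_gcyl: "div2 gcyl h x $ j = (\<Sum>i\<in>UNIV. partial i (\<lambda>z. h z $ i $ j) x)"
  by (simp add: div2_def nabla2_def gcyl_eq mat1_delta delta_sum)

lemma div1_gcyl: "div1 gcyl w x = (\<Sum>i\<in>UNIV. partial i (\<lambda>z. w z $ i) x)"
  by (simp add: div1_def nabla1_def gcyl_eq mat1_delta delta_sum)

lemma Kop_gcyl: "Kop gcyl w x $ i $ j = partial i (\<lambda>z. w z $ j) x + partial j (\<lambda>z. w z $ i) x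
    - (1/2) * (\<Sum>i\<in>UNIV. partial i (\<lambda>z. w z $ i) x) * delta i j"
  by (simp add: Kop_def nabla1_def gcyl_eq div1_gcyl mat1_delta)

lemma sym_traceless_gcyl:
  "sym_traceless (gcyl x) H \<longleftrightarrow> (\<forall>i j. H $ i $ j = H $ j $ i) \<and> (\<Sum>i\<in>UNIV. H $ i $ i) = 0"
  by (simp add: sym_traceless_def gcyl_eq mat1_delta delta_sum)

lemma qd_1: "qd 1 j f = partial j f"
proof -
  have "(\<Sum>i\<in>UNIV. delta j i * partial i f x) = partial j f x" for x by (rule delta_sum)
  moreover have "asdq 1 $ i $ j = delta j i" for i by (simp add: asdq_def mat1_nth delta_def)
  ultimately show ?thesis by (auto simp: qd_def fun_eq_iff)
qed

lemma sd_hess_qd: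
  assumes h: "smooth h"
  shows "sd_hess (hess h x) a b = (\<Sum>j\<in>UNIV. \<Sum>k\<in>UNIV. qd a j (qd b k (\<lambda>z. h z $ j $ k)) x)"
  by (simp add: sd_hess_def hess_def qd_qd[OF smooth_h_entry[OF h]])

lemma asdq_row1: "a \<in> {2,3,4} \<Longrightarrow> asdq a $ 1 $ j = delta a j"
proof -
  have "\<forall>a\<in>{2,3,4}. \<forall>j. asdq a $ 1 $ j = delta a j"
    by (simp add: forall_4 asdq_rows vector_4 delta_def)
  then show "a \<in> {2,3,4} \<Longrightarrow> ?thesis" by blast
qed

lemma Dop_entry:
  assumes h: "smooth h" and ab: "a \<in> {2,3,4}" "b \<in> {2,3,4}"
  shows "Dop gcyl h x $ 1 $ a $ 1 $ b = dop_coeff h x a b"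
proof -
  have "Dop gcyl h x $ 1 $ a $ 1 $ b = (\<Sum>c\<in>{2,3,4}. \<Sum>d\<in>{2,3,4}. asdq c $ 1 $ a * dop_coeff h x c d * asdq d $ 1 $ b)"
    by (rule Dop_dop_coeff[OF h])
  also have "\<dots> = dop_coeff h x a b"
    using ab unfolding sum_234 by (auto simp: asdq_row1 delta_def)
  finally show ?thesis .
qed

lemma Fop_zero_iff:
  "Fop gcyl h = 0 \<longleftrightarrow> (\<forall>x. Dop gcyl h x = 0) \<and> (\<forall>x j. (\<Sum>i\<in>UNIV. partial i (\<lambda>z. h z $ i $ j) x) = 0)"
  by (auto simp: Fop_def prod_eq_iff fun_eq_iff vec_eq_iff div2_gcyl)

lemma UNIV_4_insert: "(UNIV :: 4 set) = insert 1 {2,3,4}"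
  using exhaust_4 by auto

text \<open>\<open>Dop\<close> controls the block a, b in {2,3,4} only up to its trace. The missing
  trace comes from column orthogonality: the full sum of the diagonal entries E_mm is the Laplacian
  of tr h, hence zero, and E_11 vanishes by the divergence equation.\<close>

lemma kernel_second_order:
  assumes h: "smooth h" and sym: "\<And>x i j. h x $ i $ j = h x $ j $ i"
    and tr: "\<And>x. (\<Sum>i\<in>UNIV. h x $ i $ i) = 0" and F: "Fop gcyl h = 0"
  shows "(\<Sum>j\<in>UNIV. \<Sum>k\<in>UNIV. qd m j (qd n k (\<lambda>z. h z $ j $ k)) x) = 0" (is "?E m n = 0")
proof -
  note s = smooth_h_entry[OF h]
  have div: "(\<lambda>x. \<Sum>i\<in>UNIV. partial i (\<lambda>z. h z $ i $ j) x) = (\<lambda>x. 0)" for j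
    using F by (simp add: Fop_zero_iff)
  have "(\<lambda>z. h z $ j $ i) = (\<lambda>z. h z $ i $ j)" for i j
    by (rule ext) (rule sym)
  then have "(\<Sum>i\<in>UNIV. partial i (\<lambda>z. h z $ j $ i) x) = (\<Sum>i\<in>UNIV. partial i (\<lambda>z. h z $ i $ j) x)" for j x
    by metis
  with div have div': "(\<lambda>x. \<Sum>i\<in>UNIV. partial i (\<lambda>z. h z $ j $ i) x) = (\<lambda>x. 0)" for j
    by simp
  have E1: "?E m 1 = 0" for m
  proof -
    have "?E m 1 = (\<Sum>j\<in>UNIV. qd m j (\<lambda>x. \<Sum>k\<in>UNIV. partial k (\<lambda>z. h z $ j $ k) x) x)"
      by (simp add: qd_1 qd_sum smooth_partial s)
    then show ?thesis by (simp add: div')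
  qed
  have E2: "?E 1 n = 0" for n
  proof -
    have "?E 1 n = (\<Sum>k\<in>UNIV. \<Sum>j\<in>UNIV. qd n k (qd 1 j (\<lambda>z. h z $ j $ k)) x)"
      by (subst sum.swap) (simp add: qd_commute[OF s, of 1])
    also have "\<dots> = (\<Sum>k\<in>UNIV. qd n k (\<lambda>x. \<Sum>j\<in>UNIV. partial j (\<lambda>z. h z $ j $ k) x) x)"
      by (simp add: qd_1 qd_sum smooth_partial s)
    finally show ?thesis by (simp add: div)
  qed
  have "(\<Sum>m\<in>UNIV. ?E m m) = (\<Sum>j\<in>UNIV. \<Sum>k\<in>UNIV. \<Sum>m\<in>UNIV. qd m j (qd m k (\<lambda>z. h z $ j $ k)) x)"
    by (subst sum.swap, rule sum.cong, rule refl, rule sum.swap)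
  also have "\<dots> = (\<Sum>j\<in>UNIV. lap (\<lambda>z. h z $ j $ j) x)"
    by (simp add: qd_sum_forms[OF s] delta_sum)
  also have "\<dots> = lap (\<lambda>z. \<Sum>j\<in>UNIV. h z $ j $ j) x"
    by (simp add: lap_sum s)
  finally have "(\<Sum>m\<in>UNIV. ?E m m) = 0" by (simp add: tr)
  then have tr0: "(\<Sum>c\<in>{2,3,4}. ?E c c) = 0"
    unfolding UNIV_4_insert[THEN arg_cong, of "sum (\<lambda>m. ?E m m)"] by (subst (asm) sum.insert) (auto simp: E1)
  have E3: "?E a b = 0" if ab: "a \<in> {2,3,4}" "b \<in> {2,3,4}" for a b
  proof -
    have "dop_coeff h x a b = 0"
      using F Dop_entry[OF h ab, of x] by (simp add: Fop_zero_iff)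
    then show ?thesis
      unfolding dop_coeff_eq[OF h sym ab] sd_hess_qd[OF h] tr0 by simp
  qed
  show ?thesis
  proof (cases "m = 1 \<or> n = 1")
    case True
    then show ?thesis
    proof
      assume "m = 1"
      show ?thesis unfolding \<open>m = 1\<close> by (rule E2)
    next
      assume "n = 1"
      show ?thesis unfolding \<open>n = 1\<close> by (rule E1)
    qed
  next
    case False
    then have "m \<in> {2,3,4}" "n \<in> {2,3,4}" using exhaust_4[of m] exhaust_4[of n] by auto
    then show ?thesis by (rule E3)
  qed
qed

lemma kernel_biharmonic:
  assumes h: "smooth h" and "\<And>x i j. h x $ i $ j = h x $ j $ i"
    and "\<And>x. (\<Sum>i\<in>UNIV. h x $ i $ i) = 0" and "Fop gcyl h = 0"
  shows "lap (lap (\<lambda>z. h z $ j $ k)) x = 0"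
proof -
  note s = smooth_h_entry[OF h]
  \<comment> \<open>The contraction in the second slot. It solves the Fueter system in its free
    index j, so it is harmonic; then the Laplacian of h solves the Fueter system in the second
    slot.\<close>
  define X where "X n j = (\<lambda>x. \<Sum>k\<in>UNIV. qd n k (\<lambda>z. h z $ j $ k) x)" for n j
  have sX: "smooth (X n j)" for n j
    unfolding X_def by (intro smooth_sum smooth_qd s)
  have "(\<Sum>j\<in>UNIV. qd m j (X n j) x) = 0" for m n x
    using kernel_second_order[OF assms] unfolding X_def by (simp add: qd_sum smooth_qd s)
  then have "lap (X n j) x = 0" for n j x
    by (rule fueter_harmonic[OF sX])
  then have "(\<Sum>k\<in>UNIV. qd n k (lap (\<lambda>z. h z $ j $ k)) x) = 0" for n j x
    unfolding X_def by (simp add: lap_sum smooth_qd s qd_lap)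
  then show ?thesis
    by (rule fueter_harmonic[OF smooth_lap[OF s]])
qed

section \<open>The formal adjoint in flat coordinates\<close>

text \<open>The entries of Z with a = 1 or b = 1 vanish, so summing over all four indices changes
  nothing. It makes contractions with index 1 available as well, and those yield equations for the
  1-form alone.\<close>

definition dstar :: "(real^4 \<Rightarrow> real^4^4^4^4) \<Rightarrow> real^4 \<Rightarrow> real^4^4" where
  "dstar Z x = (\<chi> j k. - (1/2) * (\<Sum>a\<in>UNIV. \<Sum>b\<in>UNIV. qd a j (qd b k (\<lambda>z. Z z $ 1 $ a $ 1 $ b)) x))"

lemma asd_sym_traceless_gcyl:
  assumes "asd_sym_traceless (gcyl x) Z"
  shows "Z $ i $ j $ k $ l = Z $ k $ l $ i $ j" "Z $ 1 $ 1 $ k $ l = 0" "Z $ k $ l $ 1 $ 1 = 0"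
    "Z $ i $ j $ k $ l = (\<Sum>a\<in>{2,3,4}. \<Sum>b\<in>{2,3,4}. asdq a $ i $ j * Z $ 1 $ a $ 1 $ b * asdq b $ k $ l)"
    "(\<Sum>a\<in>UNIV. Z $ 1 $ a $ 1 $ a) = 0"
proof -
  show sym: "Z $ i $ j $ k $ l = Z $ k $ l $ i $ j" for i j k l
    using assms by (simp add: asd_sym_traceless_def)
  have as: "asd_form (mat 1) (\<chi> i j. Z $ i $ j $ k $ l)" for k l
    using assms by (simp add: asd_sym_traceless_def gcyl_eq)
  then have "(\<chi> i j. Z $ i $ j $ k $ l) $ 1 $ 1 = - (\<chi> i j. Z $ i $ j $ k $ l) $ 1 $ 1" for k l
    unfolding asd_form_def by blast
  then show z1: "Z $ 1 $ 1 $ k $ l = 0" for k l by simp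
  then show z2: "Z $ k $ l $ 1 $ 1 = 0" for k l using z1 sym by metis
  have f: "Z $ i $ j $ k $ l = (\<Sum>a\<in>{2,3,4}. Z $ 1 $ a $ k $ l * asdq a $ i $ j)" for i j k l
    using as[of k l, unfolded asd_form_mat1, THEN spec, THEN spec, of i j] by (simp only: vec_lambda_beta)
  show Z: "Z $ i $ j $ k $ l = (\<Sum>a\<in>{2,3,4}. \<Sum>b\<in>{2,3,4}. asdq a $ i $ j * Z $ 1 $ a $ 1 $ b * asdq b $ k $ l)" for i j k l
  proof -
    have "Z $ i $ j $ k $ l = (\<Sum>a\<in>{2,3,4}. Z $ 1 $ a $ k $ l * asdq a $ i $ j)" by (rule f)
    also have "\<dots> = (\<Sum>a\<in>{2,3,4}. (\<Sum>b\<in>{2,3,4}. Z $ 1 $ b $ 1 $ a * asdq b $ k $ l) * asdq a $ i $ j)"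
      by (intro sum.cong refl arg_cong2[of _ _ _ _ "(*)"], subst sym, rule f)
    also have "\<dots> = (\<Sum>a\<in>{2,3,4}. \<Sum>b\<in>{2,3,4}. asdq a $ i $ j * Z $ 1 $ a $ 1 $ b * asdq b $ k $ l)"
      unfolding sum_distrib_right
    proof (intro sum.cong refl)
      fix a b
      show "Z $ 1 $ b $ 1 $ a * asdq b $ k $ l * asdq a $ i $ j = asdq a $ i $ j * Z $ 1 $ a $ 1 $ b * asdq b $ k $ l"
        unfolding sym[of 1 b 1 a] by simp
    qed
    finally show ?thesis .
  qed
  have "(\<Sum>i\<in>UNIV. \<Sum>j\<in>UNIV. \<Sum>k\<in>UNIV. \<Sum>l\<in>UNIV. delta i k * delta j l * Z $ i $ j $ k $ l) = 0"
    using assms by (simp add: asd_sym_traceless_def gcyl_eq mat1_delta)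
  then have "(\<Sum>i\<in>UNIV. \<Sum>j\<in>UNIV. Z $ i $ j $ i $ j) = 0"
    by (simp add: mult.assoc sum_distrib_left[symmetric] delta_sum)
  \<comment> \<open>The squared norm 4 of the basis forms turns the full trace into 4 times the
    trace of the coordinate block.\<close>
  then have "4 * (Z $ 1 $ 2 $ 1 $ 2 + Z $ 1 $ 3 $ 1 $ 3 + Z $ 1 $ 4 $ 1 $ 4) = 0"
    unfolding sum_4 Z[of 1 2 1 2] Z[of 2 1 2 1] Z[of 1 3 1 3] Z[of 3 1 3 1] Z[of 1 4 1 4] Z[of 4 1 4 1]
      Z[of 2 3 2 3] Z[of 3 2 3 2] Z[of 2 4 2 4] Z[of 4 2 4 2] Z[of 3 4 3 4] Z[of 4 3 4 3]
      Z[of 1 1 1 1] Z[of 2 2 2 2] Z[of 3 3 3 3] Z[of 4 4 4 4]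
    by (simp add: sum_234 asdq_rows vector_4)
  then show "(\<Sum>a\<in>UNIV. Z $ 1 $ a $ 1 $ a) = 0" by (simp add: sum_4 z1)
qed

lemma asd_sym_traceless_gcyl_intro:
  assumes "\<And>i j k l. Z $ i $ j $ k $ l = (\<Sum>a\<in>{2,3,4}. \<Sum>b\<in>{2,3,4}. asdq a $ i $ j * c a b * asdq b $ k $ l)"
    and c: "\<And>a b. c a b = c b a" and tr: "c 2 2 + c 3 3 + c 4 4 = (0::real)"
  shows "asd_sym_traceless (gcyl x) Z"
proof -
  have "asd_form (mat 1) (\<chi> i j. Z $ i $ j $ k $ l)" for k l
    unfolding asd_form_mat1 vec_lambda_beta assms(1) forall_4 sum_234
    by (simp add: asdq_rows vector_4)
  moreover have "Z $ i $ j $ k $ l = Z $ k $ l $ i $ j" for i j k l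
    unfolding assms(1) sum_234 by (simp add: c[of 3 2] c[of 4 2] c[of 4 3])
  moreover have "(\<Sum>i\<in>UNIV. \<Sum>j\<in>UNIV. \<Sum>k\<in>UNIV. \<Sum>l\<in>UNIV. delta i k * delta j l * Z $ i $ j $ k $ l) = 0"
  proof -
    have "(\<Sum>i\<in>UNIV. \<Sum>j\<in>UNIV. Z $ i $ j $ i $ j) = 0"
      unfolding sum_4 assms(1) sum_234 using tr by (simp add: asdq_rows vector_4)
    then show ?thesis by (simp add: mult.assoc sum_distrib_left[symmetric] delta_sum)
  qed
  ultimately show ?thesis
    by (simp add: asd_sym_traceless_def gcyl_eq mat1_delta)
qed

lemma cyl_periodic_partial:
  assumes f: "smooth f" and p: "cyl_periodic v f"
  shows "cyl_periodic v (partial i f)"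
  unfolding cyl_periodic_def
proof (intro allI)
  fix a x
  have "(\<lambda>z. f (z + ylift (v $ a))) = f" using p by (simp add: cyl_periodic_def)
  then show "partial i f (x + ylift (v $ a)) = partial i f x"
    using partial_translate[OF smooth_differentiable[OF f], of i "ylift (v $ a)" x] by simp
qed

lemma cyl_periodic_qd: "smooth f \<Longrightarrow> cyl_periodic v f \<Longrightarrow> cyl_periodic v (qd m j f)"
  using cyl_periodic_partial[of f v] by (simp add: cyl_periodic_def qd_def)

lemma dstar_section:
  assumes Z: "Z \<in> sections_S20_asd v"
  shows "dstar Z \<in> sections_S20 v"
proof -
  have sZ: "smooth (\<lambda>z. Z z $ i $ j $ k $ l)" for i j k l
    using Z by (auto simp: sections_S20_asd_def intro!: smooth_intros)
  have az: "asd_sym_traceless (gcyl x) (Z x)" for x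
    using Z by (auto simp: sections_S20_asd_def)
  have per: "Z (x + ylift (v $ a)) = Z x" for a x
    using Z by (auto simp: sections_S20_asd_def cyl_periodic_def)
  have sm: "smooth (dstar Z)"
    unfolding dstar_def[abs_def] by (intro smooth_vec_lambda smooth_mult smooth_const smooth_sum smooth_qd sZ)
  have "cyl_periodic v (dstar Z)"
    using cyl_periodic_qd[OF smooth_qd[OF sZ] cyl_periodic_qd[OF sZ]] per by (simp add: cyl_periodic_def dstar_def)
  moreover have "dstar Z x $ j $ k = dstar Z x $ k $ j" for x j k
    unfolding dstar_def vec_lambda_beta
    by (subst (2) sum.swap) (simp add: qd_commute[OF sZ, of _ j _ k] asd_sym_traceless_gcyl(1)[OF az, of _ 1 _ 1 _])
  moreover have "(\<Sum>j\<in>UNIV. dstar Z x $ j $ j) = 0" for x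
  proof -
    have "(\<Sum>j\<in>UNIV. \<Sum>a\<in>UNIV. \<Sum>b\<in>UNIV. qd a j (qd b j (\<lambda>z. Z z $ 1 $ a $ 1 $ b)) x)
      = (\<Sum>a\<in>UNIV. \<Sum>b\<in>UNIV. \<Sum>j\<in>UNIV. qd a j (qd b j (\<lambda>z. Z z $ 1 $ a $ 1 $ b)) x)"
      by (subst sum.swap, rule sum.cong, rule refl, rule sum.swap)
    \<comment> \<open>Row orthogonality turns the trace over j into the Laplacian of the trace of Z,
      so tracelessness is inherited.\<close>
    also have "\<dots> = lap (\<lambda>x. \<Sum>a\<in>UNIV. Z x $ 1 $ a $ 1 $ a) x"
      by (simp add: qd_sum_indices[OF sZ] delta_sum lap_sum sZ)
    also have "\<dots> = 0"
      by (simp add: asd_sym_traceless_gcyl(5)[OF az])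
    finally show ?thesis
      by (simp add: dstar_def sum_divide_distrib[symmetric] sum_negf)
  qed
  ultimately show ?thesis using sm by (auto simp: sections_S20_def sym_traceless_gcyl)
qed


section \<open>Contractions of the adjoint equation\<close>

lemma qd_comb:
  assumes "smooth f" "smooth g" "smooth u"
  shows "qd m j (\<lambda>x. c * (f x + g x - e * u x)) = (\<lambda>x. c * (qd m j f x + qd m j g x - e * qd m j u x))"
proof -
  have *: "partial i (\<lambda>x. c * (f x + g x - e * u x)) x = c * (partial i f x + partial i g x - e * partial i u x)" for i x
    using assms[THEN smooth_differentiable]
    by (simp add: partial_cmult partial_add partial_diff)
  show ?thesis
    unfolding qd_def * by (intro ext)
      (simp add: sum_distrib_left sum.distrib[symmetric] sum_subtractf[symmetric] algebra_simps)
qed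

context
  fixes Z :: "real^4 \<Rightarrow> real^4^4^4^4" and w :: "real^4 \<Rightarrow> real^4" and v
  assumes Z: "Z \<in> sections_S20_asd v" and w: "smooth w"
    and eq: "\<And>x. dstar Z x = Kop gcyl w x"
begin

definition "zc a b = (\<lambda>x. Z x $ 1 $ a $ 1 $ b)"
definition "wc j = (\<lambda>x. w x $ j)"
text \<open>The Fueter operator applied to the 1-form; its component n = 1 is the
  divergence.\<close>

definition "fdiv n = (\<lambda>x. \<Sum>k\<in>UNIV. qd n k (wc k) x)"

lemma smooth_zc: "smooth (zc a b)" and smooth_wc: "smooth (wc j)"
  using Z w unfolding zc_def wc_def by (auto simp: sections_S20_asd_def intro!: smooth_intros)

lemma smooth_fdiv: "smooth (fdiv n)"
  unfolding fdiv_def by (intro smooth_sum smooth_qd smooth_wc)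

lemma asd_Z: "asd_sym_traceless (gcyl x) (Z x)"
  using Z by (auto simp: sections_S20_asd_def)

lemma zc_1: "zc a 1 = (\<lambda>x. 0)" "zc 1 a = (\<lambda>x. 0)"
  using asd_sym_traceless_gcyl(2,3)[OF asd_Z] by (simp_all add: zc_def)

text \<open>The second index of \<open>dstar Z = Kop gcyl w\<close> is contracted with the gradient
  I_n. Row orthogonality then keeps only b = n on the left and produces a Laplacian; on the right it
  does the same to the term in which the second index is differentiated.\<close>

lemma contracted_equation:
  "(\<Sum>a\<in>UNIV. qd a j (lap (zc a n)) x)
    = - 2 * (partial j (fdiv n) x + delta n 1 * lap (wc j) x - (1/2) * qd n j (fdiv 1) x)"
proof -
  have e: "(\<lambda>x. \<Sum>a\<in>UNIV. \<Sum>b\<in>UNIV. qd a j (qd b k (zc a b)) x)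
    = (\<lambda>x. - 2 * (partial j (wc k) x + partial k (wc j) x - (1/2 * delta j k) * fdiv 1 x))" for j k
  proof
    fix x
    have "dstar Z x $ j $ k = Kop gcyl w x $ j $ k" by (simp add: eq)
    then show "(\<Sum>a\<in>UNIV. \<Sum>b\<in>UNIV. qd a j (qd b k (zc a b)) x)
      = - 2 * (partial j (wc k) x + partial k (wc j) x - (1/2 * delta j k) * fdiv 1 x)"
      unfolding dstar_def Kop_gcyl vec_lambda_beta fdiv_def qd_1 wc_def zc_def by (simp add: mult.commute)
  qed
  have "(\<Sum>k\<in>UNIV. qd n k (\<lambda>x. \<Sum>a\<in>UNIV. \<Sum>b\<in>UNIV. qd a j (qd b k (zc a b)) x) x)
      = (\<Sum>k\<in>UNIV. \<Sum>a\<in>UNIV. \<Sum>b\<in>UNIV. qd n k (qd a j (qd b k (zc a b))) x)"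
    by (simp add: qd_sum smooth_qd smooth_zc smooth_sum)
  also have "\<dots> = (\<Sum>a\<in>UNIV. \<Sum>b\<in>UNIV. \<Sum>k\<in>UNIV. qd n k (qd a j (qd b k (zc a b))) x)"
    by (subst sum.swap, rule sum.cong, rule refl, rule sum.swap)
  also have "\<dots> = (\<Sum>a\<in>UNIV. \<Sum>b\<in>UNIV. \<Sum>k\<in>UNIV. qd a j (qd n k (qd b k (zc a b))) x)"
    by (intro sum.cong refl qd_commute smooth_qd smooth_zc)
  also have "\<dots> = (\<Sum>a\<in>UNIV. \<Sum>b\<in>UNIV. qd a j (\<lambda>x. \<Sum>k\<in>UNIV. qd n k (qd b k (zc a b)) x) x)"
    by (simp add: qd_sum smooth_qd smooth_zc)
  also have "\<dots> = (\<Sum>a\<in>UNIV. \<Sum>b\<in>UNIV. delta n b * qd a j (lap (zc a b)) x)"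
    by (simp add: qd_sum_indices smooth_zc qd_cmult smooth_lap)
  also have "\<dots> = (\<Sum>a\<in>UNIV. qd a j (lap (zc a n)) x)"
    by (simp only: delta_sum)
  finally have L: "(\<Sum>a\<in>UNIV. qd a j (lap (zc a n)) x) = (\<Sum>k\<in>UNIV. qd n k (\<lambda>x. \<Sum>a\<in>UNIV. \<Sum>b\<in>UNIV. qd a j (qd b k (zc a b)) x) x)" ..
  have 1: "(\<Sum>k\<in>UNIV. qd n k (partial j (wc k)) x) = partial j (fdiv n) x"
  proof -
    have "(\<Sum>k\<in>UNIV. qd n k (qd 1 j (wc k)) x) = (\<Sum>k\<in>UNIV. qd 1 j (qd n k (wc k)) x)"
      by (intro sum.cong refl qd_commute smooth_wc)
    also have "\<dots> = qd 1 j (fdiv n) x" unfolding fdiv_def by (simp add: qd_sum smooth_qd smooth_wc)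
    finally show ?thesis by (simp add: qd_1)
  qed
  have 2: "(\<Sum>k\<in>UNIV. qd n k (partial k (wc j)) x) = delta n 1 * lap (wc j) x"
    using qd_sum_indices[OF smooth_wc, of n 1 j x] by (simp add: qd_1)
  have 3: "(\<Sum>k\<in>UNIV. (1/2 * delta j k) * qd n k (fdiv 1) x) = (1/2) * qd n j (fdiv 1) x"
    unfolding mult.assoc sum_distrib_left[symmetric] delta_sum ..
  show ?thesis
    unfolding L e qd_comb[OF smooth_partial[OF smooth_wc] smooth_partial[OF smooth_wc] smooth_fdiv]
    unfolding sum_distrib_left[symmetric] sum_subtractf sum.distrib 1 2 3 ..
qed

lemma twice_contracted_equation:
  "lap (lap (zc m n)) x = - 2 * (delta m 1 * lap (fdiv n) x + delta n 1 * lap (fdiv m) x - (1/2) * (delta m n * lap (fdiv 1) x))"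
proof -
  have e: "(\<lambda>x. \<Sum>a\<in>UNIV. qd a j (lap (zc a n)) x)
    = (\<lambda>x. - 2 * (partial j (fdiv n) x + delta n 1 * lap (wc j) x - (1/2) * qd n j (fdiv 1) x))" for j
    by (rule ext) (rule contracted_equation)
  have "(\<Sum>j\<in>UNIV. qd m j (\<lambda>x. \<Sum>a\<in>UNIV. qd a j (lap (zc a n)) x) x)
     = (\<Sum>a\<in>UNIV. \<Sum>j\<in>UNIV. qd m j (qd a j (lap (zc a n))) x)"
    by (subst sum.swap) (simp add: qd_sum smooth_qd smooth_lap smooth_zc)
  also have "\<dots> = lap (lap (zc m n)) x"
    by (simp add: qd_sum_indices smooth_lap smooth_zc delta_sum)
  finally have L: "lap (lap (zc m n)) x = (\<Sum>j\<in>UNIV. qd m j (\<lambda>x. \<Sum>a\<in>UNIV. qd a j (lap (zc a n)) x) x)" ..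
  have 1: "(\<Sum>j\<in>UNIV. qd m j (partial j (fdiv n)) x) = delta m 1 * lap (fdiv n) x"
    using qd_sum_indices[OF smooth_fdiv, of m 1 n x] by (simp add: qd_1)
  have 2: "(\<Sum>j\<in>UNIV. qd m j (\<lambda>x. delta n 1 * lap (wc j) x) x) = delta n 1 * lap (fdiv m) x"
    by (simp add: qd_cmult smooth_lap smooth_wc fdiv_def lap_sum smooth_qd qd_lap sum_distrib_left)
  have 3: "(\<Sum>j\<in>UNIV. (1/2) * qd m j (qd n j (fdiv 1)) x) = (1/2) * (delta m n * lap (fdiv 1) x)"
    unfolding sum_distrib_left[symmetric] qd_sum_indices[OF smooth_fdiv] ..
  have s: "smooth (\<lambda>x. delta n 1 * lap (wc j) x)" for j
    by (intro smooth_mult smooth_const smooth_lap smooth_wc)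
  show ?thesis
    unfolding L e qd_comb[OF smooth_partial[OF smooth_fdiv] s smooth_qd[OF smooth_fdiv]]
    unfolding sum_distrib_left[symmetric] sum_subtractf sum.distrib 1 2 
    unfolding sum_distrib_left 3 ..
qed

text \<open>For m = n = 1 the left side of \<open>twice_contracted_equation\<close> is zero and the
  right side is -3 times the Laplacian of the divergence.\<close>

lemma lap_fdiv: "lap (fdiv 1) x = 0"
  using twice_contracted_equation[of 1 1 x] by (simp add: zc_1 delta_def)

text \<open>The contraction with n = 1 has no Z in it and says that \<open>lap (wc j)\<close> is
  -1/2 times a derivative of the divergence, which is harmonic. For a, b different from 1 the double
  contraction has only the Laplacian of the divergence on its right side.\<close>

lemma adjoint_biharmonic:
  "lap (lap (\<lambda>x. w x $ j)) x = 0" "lap (lap (\<lambda>x. Z x $ 1 $ a $ 1 $ b)) x = 0"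
proof -
  have "lap (wc j) x = - (1/2) * partial j (fdiv 1) x" for x
    using contracted_equation[of j 1 x] by (simp add: zc_1 delta_def qd_1)
  then have "lap (lap (wc j)) x = lap (\<lambda>x. - (1/2) * partial j (fdiv 1) x) x"
    by presburger
  also have "\<dots> = 0"
    by (subst lap_cmult) (simp_all add: smooth_partial smooth_fdiv partial_lap[OF smooth_fdiv, symmetric] lap_fdiv[abs_def])
  finally show "lap (lap (\<lambda>x. w x $ j)) x = 0" by (simp add: wc_def)
  have "lap (lap (zc a b)) x = 0"
  proof (cases "a = 1 \<or> b = 1")
    case True
    then show ?thesis by (auto simp: zc_1)
  next
    case False
    then show ?thesis using twice_contracted_equation[of a b x] by (simp add: delta_def lap_fdiv)
  qed
  then show "lap (lap (\<lambda>x. Z x $ 1 $ a $ 1 $ b)) x = 0" by (simp add: zc_def)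
qed

end


section \<open>Maximum principles on the torus\<close>

lemma transpose_mult_rows:
  fixes v :: "real^'n^'n"
  shows "transpose v *v s = (\<Sum>a\<in>UNIV. s $ a *\<^sub>R v $ a)"
  by (simp add: matrix_vector_mult_def vec_eq_iff transpose_def mult.commute)

lemma lattice_coordinates:
  fixes v :: "real^'n^'n"
  assumes "det v \<noteq> 0"
  shows "y = (\<Sum>a\<in>UNIV. (matrix_inv (transpose v) *v y) $ a *\<^sub>R v $ a)"
proof -
  have d: "det (transpose v) \<noteq> 0" using assms by (simp add: det_transpose)
  have "transpose v *v (matrix_inv (transpose v) *v y) = y"
    by (simp add: matrix_vector_mul_assoc matrix_inv_mult[OF d])
  then show ?thesis unfolding transpose_mult_rows ..
qed

lemma periodic_of_int_scaleR:
  fixes d :: "'a::real_vector"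
  assumes "\<And>y. f (y + d) = f y"
  shows "f (y + of_int n *\<^sub>R d) = f y"
proof -
  have *: "f (y + real k *\<^sub>R d) = f y" for k y
  proof (induction k)
    case (Suc k)
    have "f (y + real (Suc k) *\<^sub>R d) = f (y + real k *\<^sub>R d + d)"
      by (simp add: algebra_simps)
    then show ?case using Suc assms by presburger
  qed simp
  show ?thesis
  proof (cases "n \<ge> 0")
    case True
    then show ?thesis using *[of y "nat n"] by simp
  next
    case False
    then show ?thesis using *[of "y + of_int n *\<^sub>R d" "nat (- n)"]
      by (simp add: scaleR_left_distrib[symmetric])
  qed
qed

lemma periodic_of_int_sum:
  fixes d :: "'i \<Rightarrow> 'a::real_vector"
  assumes "\<And>a y. f (y + d a) = f y"
  shows "f (y + (\<Sum>a\<in>A. of_int (n a) *\<^sub>R d a)) = f y"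
proof (induction A rule: infinite_finite_induct)
  case (insert a A)
  then show ?case
    using periodic_of_int_scaleR[of f "d a" "y + (\<Sum>a\<in>A. of_int (n a) *\<^sub>R d a)" "n a", OF assms]
    by (simp add: algebra_simps)
qed auto

text \<open>An upper bound for the diameter: it bounds the norm of every point whose lattice
  coordinates lie in [0,1).\<close>

definition torus_diam :: "real^3^3 \<Rightarrow> real" where
  "torus_diam v = (\<Sum>a\<in>UNIV. norm (v $ a))"

text \<open>The lattice coordinates of y - x are reduced modulo 1 by subtracting their
  floors.\<close>

lemma torus_close_representative:
  assumes "det v \<noteq> 0"
  obtains y' where "norm (y' - x) \<le> torus_diam v" "\<And>f. torus_periodic v f \<Longrightarrow> f y' = f y"
proof -
  define s where "s = matrix_inv (transpose v) *v (y - x)"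
  have s: "y - x = (\<Sum>a\<in>UNIV. s $ a *\<^sub>R v $ a)"
    unfolding s_def by (rule lattice_coordinates[OF assms])
  let ?y = "y + (\<Sum>a\<in>UNIV. of_int (- \<lfloor>s $ a\<rfloor>) *\<^sub>R v $ a)"
  have "?y - x = (y - x) + (\<Sum>a\<in>UNIV. of_int (- \<lfloor>s $ a\<rfloor>) *\<^sub>R v $ a)" by simp
  also have "\<dots> = (\<Sum>a\<in>UNIV. frac (s $ a) *\<^sub>R v $ a)"
    unfolding s by (simp add: sum.distrib[symmetric] frac_def scaleR_left_diff_distrib sum_negf sum_subtractf)
  also have "norm \<dots> \<le> (\<Sum>a\<in>UNIV. norm (frac (s $ a) *\<^sub>R v $ a))" by (rule norm_sum)
  also have "\<dots> \<le> torus_diam v"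
    unfolding torus_diam_def
    by (intro sum_mono) (auto simp: frac_ge_0 intro!: mult_left_le_one_le less_imp_le[OF frac_lt_1])
  finally have "norm (?y - x) \<le> torus_diam v" .
  then show thesis
    by (rule that) (rule periodic_of_int_sum, simp add: torus_periodic_def)
qed

lemma torus_attains_max:
  fixes f :: "real^3 \<Rightarrow> real"
  assumes "det v \<noteq> 0" "torus_periodic v f" "continuous_on UNIV f"
  obtains x0 where "\<And>x. f x \<le> f x0"
proof -
  have d: "0 \<le> torus_diam v" unfolding torus_diam_def by (intro sum_nonneg) simp
  have "cball (0::real^3) (torus_diam v) \<noteq> {}" using d by simp
  then obtain x0 where x0: "\<And>x. x \<in> cball 0 (torus_diam v) \<Longrightarrow> f x \<le> f x0"
    using continuous_attains_sup[OF compact_cball _ continuous_on_subset[OF assms(3) subset_UNIV]] by blast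
  have "f x \<le> f x0" for x
  proof -
    obtain y' where "norm (y' - 0) \<le> torus_diam v" "f y' = f x"
      using torus_close_representative[OF assms(1), of 0 x] assms(2) by blast
    then show ?thesis using x0[of y'] by simp
  qed
  then show thesis using that by blast
qed

text \<open>A positive second derivative would make the first one positive just after the critical
  point, and f would then exceed its maximum along the line.\<close>

lemma second_partial_at_max:
  fixes f :: "real^'n::finite \<Rightarrow> real"
  assumes f: "smooth f" and m: "\<And>x. f x \<le> f x0"
  shows "partial i (partial i f) x0 \<le> 0"
proof (rule ccontr)
  assume "\<not> ?thesis"
  then have pos: "partial i (partial i f) x0 > 0" by simp
  define \<phi> where "\<phi> s = f (x0 + s *\<^sub>R axis i 1)" for s
  define \<psi> where "\<psi> s = partial i f (x0 + s *\<^sub>R axis i 1)" for s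
  have \<phi>: "(\<phi> has_real_derivative \<psi> s) (at s)" for s
    unfolding \<phi>_def \<psi>_def has_real_derivative_iff_has_vector_derivative
    by (intro partial_axis_vector_derivative smooth_differentiable f)
  have \<psi>: "(\<psi> has_real_derivative partial i (partial i f) x0) (at 0)"
    using partial_axis_vector_derivative[where f = "partial i f" and x = x0 and s = 0 and i = i,
      OF smooth_differentiable[OF smooth_partial[OF f]]]
    unfolding \<psi>_def has_real_derivative_iff_has_vector_derivative by simp
  have "\<psi> 0 = 0"
    by (rule DERIV_local_max[OF \<phi>, of 1]) (use m in \<open>auto simp: \<phi>_def\<close>)
  obtain d where d: "d > 0" "\<And>h. 0 < h \<Longrightarrow> h < d \<Longrightarrow> \<psi> 0 < \<psi> (0 + h)"
    using DERIV_pos_inc_right[OF \<psi> pos] by blast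
  obtain z where "0 < z" "z < d/2" "\<phi> (d/2) - \<phi> 0 = (d/2 - 0) * \<psi> z"
    using MVT2[of 0 "d/2" \<phi> \<psi>] \<phi> d(1) by auto
  then have "\<phi> (d/2) > \<phi> 0"
    using d \<open>\<psi> 0 = 0\<close> by (smt (verit) add_0 field_sum_of_halves mult_pos_pos)
  then show False using m[of "x0 + (d/2) *\<^sub>R axis i 1"] unfolding \<phi>_def by simp
qed

lemma lap_at_max: "smooth f \<Longrightarrow> (\<And>x. f x \<le> f x0) \<Longrightarrow> lap f x0 \<le> 0"
  for f :: "real^'n::finite \<Rightarrow> real"
  unfolding lap_def by (intro sum_nonpos second_partial_at_max)

lemma torus_periodic_partial:
  assumes f: "smooth f" and p: "torus_periodic v f"
  shows "torus_periodic v (partial i f)"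
  unfolding torus_periodic_def
proof (intro allI)
  fix a x
  have "(\<lambda>z. f (z + v $ a)) = f" using p by (simp add: torus_periodic_def)
  then show "partial i f (x + v $ a) = partial i f x"
    using partial_translate[OF smooth_differentiable[OF f], of i "v $ a" x] by simp
qed

lemma torus_periodic_lap: "smooth f \<Longrightarrow> torus_periodic v f \<Longrightarrow> torus_periodic v (lap f)"
  unfolding lap_def torus_periodic_def
  using torus_periodic_partial[OF smooth_partial torus_periodic_partial, unfolded torus_periodic_def]
  by (metis (no_types, lifting) sum.cong torus_periodic_def)

section \<open>The Laplacian of |u|^2 and eigenfunctions on the torus\<close>

lemma partial_inner_smooth:
  fixes f :: "real^'n::finite \<Rightarrow> 'b::real_inner"
  assumes "smooth f"
  shows "partial i (\<lambda>x. f x \<bullet> f x) = (\<lambda>x. 2 * (f x \<bullet> partial i f x))"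
  using smooth_differentiable[OF assms] by (auto simp: partial_inner inner_commute)

lemma lap_inner_self:
  fixes f :: "real^'n::finite \<Rightarrow> 'b::real_inner"
  assumes f: "smooth f"
  shows "lap (\<lambda>x. f x \<bullet> f x) x = 2 * (f x \<bullet> lap f x) + 2 * (\<Sum>k\<in>UNIV. (norm (partial k f x))\<^sup>2)"
proof -
  have "partial k (partial k (\<lambda>x. f x \<bullet> f x)) x = 2 * (f x \<bullet> partial k (partial k f) x) + 2 * (norm (partial k f x))\<^sup>2" for k
    unfolding partial_inner_smooth[OF f]
    using f smooth_partial[OF f, of k, THEN smooth_differentiable] smooth_differentiable[OF f]
    by (subst partial_cmult) (auto simp: partial_inner power2_norm_eq_inner intro!: smooth_differentiable smooth_inner smooth_partial)
  then show ?thesis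
    by (simp add: lap_def sum.distrib sum_distrib_left inner_sum_right)
qed

lemma inner_mult_complex_ge:
  fixes a \<mu> :: complex
  assumes "cmod \<mu> \<le> \<delta>"
  shows "a \<bullet> (- \<mu> * a) \<ge> - \<delta> * (norm a)\<^sup>2"
proof -
  have "\<bar>a \<bullet> (- \<mu> * a)\<bar> \<le> norm a * norm (- \<mu> * a)" by (rule Cauchy_Schwarz_ineq2)
  also have "\<dots> = cmod \<mu> * (norm a)\<^sup>2" by (simp add: norm_mult power2_eq_square)
  also have "\<dots> \<le> \<delta> * (norm a)\<^sup>2" by (intro mult_right_mono assms) simp
  finally show ?thesis by linarith
qed

context
  fixes v :: "real^3^3"
  assumes v: "det v \<noteq> 0"
begin

text \<open>Bernstein's method: the maximum principle applied to \<open>|\<nabla>u|\<^sup>2 + 2 \<delta> |u|\<^sup>2\<close>.\<close>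

lemma eigenfunction_gradient_bound:
  fixes u :: "real^3 \<Rightarrow> complex"
  assumes u: "smooth u" "torus_periodic v u" and eig: "\<And>x. lap u x = - \<mu> * u x"
    and \<delta>: "cmod \<mu> \<le> \<delta>" "\<delta> > 0" and M: "\<And>x. norm (u x) \<le> M"
  shows "(\<Sum>k\<in>UNIV. (norm (partial k u x))\<^sup>2) \<le> 4 * \<delta> * M\<^sup>2"
proof -
  \<comment> \<open>The gradient terms contribute at worst -2 \<delta> times the squared gradient to
    the Laplacian of P, while the weight 2 \<delta> on |u|^2 contributes +4 \<delta> times it. At
    the maximum of P the squared gradient is therefore at most 2 \<delta> |u|^2.\<close>
  define P where "P = (\<lambda>x. (\<Sum>k\<in>UNIV. partial k u x \<bullet> partial k u x) + (2 * \<delta>) * (u x \<bullet> u x))"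
  have sP: "smooth P"
    unfolding P_def by (intro smooth_intros u)
  have perP: "torus_periodic v P"
    using u(2) torus_periodic_partial[OF u] by (simp add: P_def torus_periodic_def)
  obtain x0 where x0: "\<And>x. P x \<le> P x0"
    using torus_attains_max[OF v perP smooth_continuous[OF sP]] by blast
  let ?G = "\<lambda>x. \<Sum>k\<in>UNIV. (norm (partial k u x))\<^sup>2"
  have su: "smooth (\<lambda>x. u x \<bullet> u x)" "smooth (\<lambda>x. partial k u x \<bullet> partial k u x)" for k
    by (intro smooth_intros u)+
  have lapP: "lap P x = (\<Sum>k\<in>UNIV. lap (\<lambda>x. partial k u x \<bullet> partial k u x) x) + (2 * \<delta>) * lap (\<lambda>x. u x \<bullet> u x) x" for x
  proof -
    have p: "partial i (\<lambda>x. (\<Sum>k\<in>UNIV. f k x) + (2 * \<delta>) * g x) = (\<lambda>x. (\<Sum>k\<in>UNIV. partial i (f k) x) + (2 * \<delta>) * partial i g x)"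
      if "\<And>k. smooth (f k)" "smooth g" for f :: "3 \<Rightarrow> real^3 \<Rightarrow> real" and g i
    proof
      fix x
      have "partial i (\<lambda>x. (\<Sum>k\<in>UNIV. f k x) + (2 * \<delta>) * g x) x = partial i (\<lambda>x. \<Sum>k\<in>UNIV. f k x) x + partial i (\<lambda>x. (2 * \<delta>) * g x) x"
        by (rule partial_add) (intro smooth_differentiable smooth_intros that)+
      then show "partial i (\<lambda>x. (\<Sum>k\<in>UNIV. f k x) + (2 * \<delta>) * g x) x = (\<Sum>k\<in>UNIV. partial i (f k) x) + (2 * \<delta>) * partial i g x"
        by (simp add: partial_sum_smooth partial_cmult_smooth that)
    qed
    show ?thesis
      unfolding lap_def P_def p[OF su(2) su(1)] p[OF smooth_partial[OF su(2)] smooth_partial[OF su(1)]]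
      by (simp add: sum.distrib sum_distrib_left) (rule sum.swap)
  qed
  have lapk: "lap (partial k u) x = - \<mu> * partial k u x" for k x
  proof -
    have "lap (partial k u) x = partial k (lap u) x" by (simp add: partial_lap u)
    also have "lap u = (\<lambda>x. - \<mu> * u x)" using eig by auto
    finally show ?thesis by (simp add: partial_cmult_smooth[OF u(1), of k "- \<mu>", simplified])
  qed
  have "0 \<ge> lap P x0" using lap_at_max[OF sP x0] .
  moreover have "lap P x0 \<ge> (\<Sum>k\<in>UNIV. 2 * (- \<delta> * (norm (partial k u x0))\<^sup>2)) + 2 * \<delta> * (2 * (- \<delta> * (norm (u x0))\<^sup>2) + 2 * ?G x0)"
  proof -
    have "(\<Sum>k\<in>UNIV. lap (\<lambda>x. partial k u x \<bullet> partial k u x) x0) \<ge> (\<Sum>k\<in>UNIV. 2 * (- \<delta> * (norm (partial k u x0))\<^sup>2))"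
    proof (rule sum_mono)
      fix k
      have "0 \<le> (\<Sum>j\<in>UNIV. (norm (partial j (partial k u) x0))\<^sup>2)" by (intro sum_nonneg) simp
      then show "2 * (- \<delta> * (norm (partial k u x0))\<^sup>2) \<le> lap (\<lambda>x. partial k u x \<bullet> partial k u x) x0"
        unfolding lap_inner_self[OF smooth_partial[OF u(1)]] lapk
        using inner_mult_complex_ge[OF \<delta>(1), of "partial k u x0"] by linarith
    qed
    moreover have "lap (\<lambda>x. u x \<bullet> u x) x0 \<ge> 2 * (- \<delta> * (norm (u x0))\<^sup>2) + 2 * ?G x0"
      unfolding lap_inner_self[OF u(1)] eig using inner_mult_complex_ge[OF \<delta>(1), of "u x0"] by linarith
    ultimately show ?thesis unfolding lapP
      by (intro add_mono mult_left_mono) (use \<delta> in auto)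
  qed
  ultimately have "0 \<ge> - 2 * \<delta> * ?G x0 + 2 * \<delta> * (2 * (- \<delta> * (norm (u x0))\<^sup>2) + 2 * ?G x0)"
    by (simp add: sum_distrib_left sum_negf mult.assoc)
  then have "2 * \<delta> * ?G x0 \<le> 2 * \<delta> * (2 * \<delta> * (norm (u x0))\<^sup>2)"
    by (simp add: algebra_simps)
  then have "?G x0 \<le> 2 * \<delta> * (norm (u x0))\<^sup>2" using \<delta>(2) by simp
  then have "P x0 \<le> 4 * \<delta> * (norm (u x0))\<^sup>2"
    by (simp add: P_def power2_norm_eq_inner)
  also have "\<dots> \<le> 4 * \<delta> * M\<^sup>2"
    using \<delta> M by (intro mult_left_mono power_mono) auto
  finally have "P x \<le> 4 * \<delta> * M\<^sup>2" using x0 order_trans by blast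
  moreover have "?G x \<le> P x"
    using \<delta> by (simp add: P_def power2_norm_eq_inner)
  ultimately show ?thesis by simp
qed

lemma eigenfunction_bounded:
  fixes u :: "real^3 \<Rightarrow> complex"
  assumes u: "smooth u" "torus_periodic v u"
  obtains x0 where "\<And>x. norm (u x) \<le> norm (u x0)"
proof (rule torus_attains_max[OF v])
  show "torus_periodic v (\<lambda>x. norm (u x))" using u by (simp add: torus_periodic_def)
  show "continuous_on UNIV (\<lambda>x. norm (u x))" by (intro continuous_on_norm smooth_continuous u)
qed (use that in blast)

lemma eigenfunction_oscillation:
  fixes u :: "real^3 \<Rightarrow> complex"
  assumes u: "smooth u" "torus_periodic v u" and eig: "\<And>x. lap u x = - \<mu> * u x"
    and \<delta>: "cmod \<mu> \<le> \<delta>" "\<delta> > 0" and M: "\<And>x. norm (u x) \<le> M"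
  shows "norm (u y - u x) \<le> 6 * sqrt \<delta> * M * torus_diam v"
proof -
  have M0: "M \<ge> 0" using M[of 0] norm_ge_zero order_trans by blast
  obtain y' where y': "norm (y' - x) \<le> torus_diam v" "u y' = u y"
    using torus_close_representative[OF v, of x y] u(2) by blast
  have k: "norm (partial k u z) \<le> 2 * sqrt \<delta> * M" for k z
  proof -
    have "(norm (partial k u z))\<^sup>2 \<le> (\<Sum>k\<in>UNIV. (norm (partial k u z))\<^sup>2)"
      by (rule member_le_sum) auto
    also have "\<dots> \<le> 4 * \<delta> * M\<^sup>2" by (rule eigenfunction_gradient_bound[OF assms])
    also have "\<dots> = (2 * sqrt \<delta> * M)\<^sup>2" using \<delta> by (simp add: power_mult_distrib)
    finally show ?thesis by (rule power2_le_imp_le) (use M0 \<delta> in auto)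
  qed
  have "norm (u y' - u x) \<le> (6 * sqrt \<delta> * M) * norm (y' - x)"
  proof (rule differentiable_bound[where S = UNIV and f' = "\<lambda>x v. \<Sum>a\<in>UNIV. v $ a *\<^sub>R partial a u x"])
    show "(u has_derivative (\<lambda>v. \<Sum>a\<in>UNIV. v $ a *\<^sub>R partial a u z)) (at z within UNIV)" for z
      using has_derivative_partial[OF smooth_differentiable[OF u(1)]] by simp
    \<comment> \<open>The constant 6 is a crude operator norm: three partial derivatives, each
      bounded by \<open>2 * sqrt \<delta> * M\<close>.\<close>
    show "onorm (\<lambda>v. \<Sum>a\<in>UNIV. v $ a *\<^sub>R partial a u z) \<le> 6 * sqrt \<delta> * M" for z
    proof (rule onorm_le)
      fix w :: "real^3"
      have "norm (\<Sum>a\<in>UNIV. w $ a *\<^sub>R partial a u z) \<le> (\<Sum>a\<in>UNIV. norm (w $ a *\<^sub>R partial a u z))" by (rule norm_sum)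
      also have "\<dots> \<le> (\<Sum>a\<in>(UNIV::3 set). norm w * (2 * sqrt \<delta> * M))"
        by (rule sum_mono) (auto intro!: mult_mono k component_le_norm_cart)
      finally show "norm (\<Sum>a\<in>UNIV. w $ a *\<^sub>R partial a u z) \<le> 6 * sqrt \<delta> * M * norm w" by (simp add: mult_ac)
    qed
  qed auto
  also have "\<dots> \<le> (6 * sqrt \<delta> * M) * torus_diam v"
    using y' M0 \<delta> by (intro mult_left_mono) auto
  finally show ?thesis using y' by simp
qed

text \<open>The eigenvalue 0 satisfies the hypothesis of the oscillation bound for every positive
  \<delta>; let \<delta> tend to 0.\<close>

lemma harmonic_constant:
  fixes u :: "real^3 \<Rightarrow> complex"
  assumes u: "smooth u" "torus_periodic v u" and eig: "\<And>x. lap u x = 0"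
  shows "u x = u y"
proof -
  obtain x0 where M: "\<And>x. norm (u x) \<le> norm (u x0)" using eigenfunction_bounded[OF u] by blast
  have b: "norm (u x - u y) \<le> 6 * sqrt \<delta> * norm (u x0) * torus_diam v" if "\<delta> > 0" for \<delta>
    using eigenfunction_oscillation[OF u _ _ that M, of 0] eig that by simp
  have "((\<lambda>\<delta>. 6 * sqrt \<delta> * norm (u x0) * torus_diam v) \<longlongrightarrow> 6 * sqrt 0 * norm (u x0) * torus_diam v) (at_right 0)"
    by (intro tendsto_intros)
  then have "norm (u x - u y) \<le> 6 * sqrt 0 * norm (u x0) * torus_diam v"
    by (rule tendsto_lowerbound) (auto simp: eventually_at_right_field intro!: exI[of _ 1] b)
  then show ?thesis by simp
qed

text \<open>The real function u . c has Laplacian |c|^2 everywhere, and at its maximum this is at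
  most 0.\<close>

lemma lap_constant:
  fixes u :: "real^3 \<Rightarrow> complex"
  assumes u: "smooth u" "torus_periodic v u" and c: "\<And>x. lap u x = c"
  shows "c = 0"
proof -
  define w where "w = (\<lambda>x. u x \<bullet> c)"
  have sw: "smooth w" unfolding w_def by (intro smooth_intros u)
  have "torus_periodic v w" using u(2) by (simp add: w_def torus_periodic_def)
  then obtain x0 where "\<And>x. w x \<le> w x0"
    using torus_attains_max[OF v _ smooth_continuous[OF sw]] by blast
  then have "lap w x0 \<le> 0" by (rule lap_at_max[OF sw])
  have p: "partial i (\<lambda>x. g x \<bullet> c) = (\<lambda>x. partial i g x \<bullet> c)" if "smooth g" for g :: "real^3 \<Rightarrow> complex" and i
    using partial_bounded_linear[OF bounded_linear_inner_left[of c] smooth_differentiable[OF that]] by auto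
  have "lap w x0 = lap u x0 \<bullet> c"
    by (simp add: lap_def w_def p u smooth_partial inner_sum_left)
  with \<open>lap w x0 \<le> 0\<close> have "c \<bullet> c \<le> 0" by (simp add: c)
  then show ?thesis by (metis inner_gt_zero_iff not_le)
qed

text \<open>At a maximum of |u|^2 its Laplacian, -2 Re \<mu> |u|^2 + 2 |grad u|^2, is at most
  0.\<close>

lemma eigenvalue_Re_nonneg:
  fixes u :: "real^3 \<Rightarrow> complex"
  assumes u: "smooth u" "torus_periodic v u" and eig: "\<And>x. lap u x = - \<mu> * u x" and "u y \<noteq> 0"
  shows "Re \<mu> \<ge> 0"
proof -
  have s: "smooth (\<lambda>x. u x \<bullet> u x)" by (intro smooth_intros u)
  have "torus_periodic v (\<lambda>x. u x \<bullet> u x)" using u(2) by (simp add: torus_periodic_def)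
  then obtain x0 where x0: "\<And>x. u x \<bullet> u x \<le> u x0 \<bullet> u x0"
    using torus_attains_max[OF v _ smooth_continuous[OF s]] by blast
  have "0 \<ge> 2 * (u x0 \<bullet> (- \<mu> * u x0)) + 2 * (\<Sum>k\<in>UNIV. (norm (partial k u x0))\<^sup>2)"
    using lap_at_max[OF s x0] unfolding lap_inner_self[OF u(1)] eig .
  moreover have "0 \<le> (\<Sum>k\<in>UNIV. (norm (partial k u x0))\<^sup>2)" by (intro sum_nonneg) simp
  moreover have "u x0 \<bullet> (- \<mu> * u x0) = - Re \<mu> * (norm (u x0))\<^sup>2"
    unfolding inner_complex_def cmod_power2 by (simp add: power2_eq_square algebra_simps)
  ultimately have "Re \<mu> * (norm (u x0))\<^sup>2 \<ge> 0" by linarith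
  moreover have "norm (u x0) > 0"
    using x0[of y] assms(4) by (auto simp: inner_eq_zero_iff) (metis inner_gt_zero_iff inner_eq_zero_iff not_le)
  ultimately show ?thesis by (simp add: zero_le_mult_iff)
qed

lemma small_eigenvalue:
  obtains \<delta> where "\<delta> > 0" "\<And>\<mu> (u :: real^3 \<Rightarrow> complex) y. \<lbrakk>smooth u; torus_periodic v u; \<And>x. lap u x = - \<mu> * u x;
      \<mu> \<noteq> 0; cmod \<mu> \<le> \<delta>\<rbrakk> \<Longrightarrow> u y = 0"
proof -
  have D: "0 \<le> torus_diam v" unfolding torus_diam_def by (intro sum_nonneg) simp
  \<comment> \<open>Chosen so that the oscillation bound
    \<open>6 * sqrt \<delta> * M * torus_diam v\<close> is at most M / 2.\<close>
  define \<delta> where "\<delta> = (1 / (12 * (torus_diam v + 1)))\<^sup>2"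
  have \<delta>: "\<delta> > 0" unfolding \<delta>_def using D by auto
  have sq: "sqrt \<delta> = 1 / (12 * (torus_diam v + 1))" unfolding \<delta>_def using D by simp
  have "u y = 0" if u: "smooth u" "torus_periodic v u" and eig: "\<And>x. lap u x = - \<mu> * u x"
      and \<mu>: "\<mu> \<noteq> 0" "cmod \<mu> \<le> \<delta>" for \<mu> y and u :: "real^3 \<Rightarrow> complex"
  proof (rule ccontr)
    assume "u y \<noteq> 0"
    obtain x0 where M: "\<And>x. norm (u x) \<le> norm (u x0)" using eigenfunction_bounded[OF u] by blast
    have pos: "norm (u x0) > 0" using M[of y] \<open>u y \<noteq> 0\<close> by (metis norm_le_zero_iff not_le order_trans)
    have osc: "norm (u x - u x0) \<le> norm (u x0) / 2" for x
    proof -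
      have "norm (u x - u x0) \<le> 6 * sqrt \<delta> * norm (u x0) * torus_diam v"
        by (rule eigenfunction_oscillation[OF u eig \<mu>(2) \<delta> M])
      also have "\<dots> = norm (u x0) / 2 * (torus_diam v / (torus_diam v + 1))"
        unfolding sq using D by (simp add: field_simps)
      also have "\<dots> \<le> norm (u x0) / 2 * 1"
        using D by (intro mult_left_mono) auto
      finally show ?thesis by simp
    qed
    \<comment> \<open>The linear functional is the pairing with the Laplacian of u at x0. The
      Laplacian of w is then |\<mu>|^2 times u . u(x0), which is positive everywhere because u stays
      within half of |u(x0)| from u(x0).\<close>
    define e where "e = - \<mu> * u x0"
    define w where "w = (\<lambda>x. u x \<bullet> e)"
    have sw: "smooth w" unfolding w_def by (intro smooth_intros u)
    have "torus_periodic v w" using u(2) by (simp add: w_def torus_periodic_def)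
    then obtain x1 where "\<And>x. w x \<le> w x1"
      using torus_attains_max[OF v _ smooth_continuous[OF sw]] by blast
    then have "lap w x1 \<le> 0" by (rule lap_at_max[OF sw])
    have p: "partial i (\<lambda>x. g x \<bullet> e) = (\<lambda>x. partial i g x \<bullet> e)" if "smooth g" for g :: "real^3 \<Rightarrow> complex" and i
      using partial_bounded_linear[OF bounded_linear_inner_left[of e] smooth_differentiable[OF that]] by auto
    have "lap w x1 = (- \<mu> * u x1) \<bullet> (- \<mu> * u x0)"
      unfolding eig[of x1, symmetric] e_def[symmetric] by (simp add: lap_def w_def p u smooth_partial inner_sum_left)
    also have "\<dots> = (cmod \<mu>)\<^sup>2 * (u x1 \<bullet> u x0)"
      unfolding inner_complex_def cmod_power2 by (simp add: power2_eq_square algebra_simps)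
    also have "u x1 \<bullet> u x0 = (norm (u x0))\<^sup>2 + (u x1 - u x0) \<bullet> u x0"
      by (simp add: inner_diff_left power2_norm_eq_inner)
    finally have "(cmod \<mu>)\<^sup>2 * ((norm (u x0))\<^sup>2 + (u x1 - u x0) \<bullet> u x0) \<le> 0"
      using \<open>lap w x1 \<le> 0\<close> by simp
    moreover have "\<bar>(u x1 - u x0) \<bullet> u x0\<bar> \<le> norm (u x0) / 2 * norm (u x0)"
      using Cauchy_Schwarz_ineq2[of "u x1 - u x0" "u x0"] osc[of x1] mult_right_mono[OF osc[of x1] norm_ge_zero[of "u x0"]]
      by linarith
    then have "(norm (u x0))\<^sup>2 + (u x1 - u x0) \<bullet> u x0 > 0"
      using pos unfolding power2_eq_square by (smt (verit) field_sum_of_halves mult_pos_pos half_gt_zero_iff times_divide_eq_left)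
    ultimately show False using \<mu>(1) by (simp add: mult_le_0_iff)
  qed
  with \<delta> show thesis using that by blast
qed

end


section \<open>Indicial expansions\<close>

lemma bounded_linear_ypart: "bounded_linear ypart"
  unfolding linear_conv_bounded_linear[symmetric]
  by (rule linearI) (auto simp: ypart_def vec_eq_iff forall_3)

lemma partial_ypart:
  fixes g :: "real^3 \<Rightarrow> 'b::real_normed_vector"
  assumes "g differentiable (at (ypart x))"
  shows "partial 1 (\<lambda>x. g (ypart x)) x = 0" "partial 2 (\<lambda>x. g (ypart x)) x = partial 1 g (ypart x)"
    "partial 3 (\<lambda>x. g (ypart x)) x = partial 2 g (ypart x)" "partial 4 (\<lambda>x. g (ypart x)) x = partial 3 g (ypart x)"
  unfolding partial_compose_linear[OF bounded_linear_ypart assms] sum_3 ypart_axis by simp_all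

lemma has_derivative_tcoord:
  assumes "(a has_vector_derivative a') (at (tcoord x))"
  shows "((\<lambda>x. a (tcoord x)) has_derivative (\<lambda>v. tcoord v *\<^sub>R a')) (at x)"
proof -
  have "(tcoord has_derivative tcoord) (at x)"
    unfolding tcoord_def[abs_def] by (rule bounded_linear_imp_has_derivative[OF bounded_linear_vec_nth])
  from diff_chain_at[OF this assms[unfolded has_vector_derivative_def]]
  show ?thesis by (simp add: o_def)
qed

lemma tcoord_axis: "tcoord (axis i 1) = (if i = 1 then 1 else 0)"
  by (simp add: tcoord_def axis_def)

lemma smooth_tcoord: "smooth tcoord"
proof (rule smooth_coinduct[where P = "\<lambda>g. g = tcoord \<or> (\<exists>c. g = (\<lambda>x. c))"])
  have d: "(tcoord has_derivative tcoord) (at x)" for x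
    unfolding tcoord_def[abs_def] by (rule bounded_linear_imp_has_derivative[OF bounded_linear_vec_nth])
  then have "partial i tcoord = (\<lambda>x. tcoord (axis i 1))" for i
    using partial_eq by blast
  then show "partial i g = tcoord \<or> (\<exists>c. partial i g = (\<lambda>x. c))" if "g = tcoord \<or> (\<exists>c. g = (\<lambda>x. c))" for g i
    using that by auto
  show "g differentiable (at x)" if "g = tcoord \<or> (\<exists>c. g = (\<lambda>x. c))" for g x
    using that d by (auto simp: differentiable_def intro: exI[of _ "\<lambda>x. 0"])
qed simp

lemma separated_partial:
  fixes a :: "real \<Rightarrow> complex" and g :: "real^3 \<Rightarrow> complex"
  assumes a: "\<And>t. (a has_vector_derivative a' t) (at t)" and g: "smooth g"
  shows "(\<lambda>x. a (tcoord x) * g (ypart x)) differentiable (at x)"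
    "partial 1 (\<lambda>x. a (tcoord x) * g (ypart x)) x = a' (tcoord x) * g (ypart x)"
    "partial 2 (\<lambda>x. a (tcoord x) * g (ypart x)) x = a (tcoord x) * partial 1 g (ypart x)"
    "partial 3 (\<lambda>x. a (tcoord x) * g (ypart x)) x = a (tcoord x) * partial 2 g (ypart x)"
    "partial 4 (\<lambda>x. a (tcoord x) * g (ypart x)) x = a (tcoord x) * partial 3 g (ypart x)"
proof -
  have 1: "(\<lambda>x. a (tcoord x)) differentiable (at x)"
    using has_derivative_tcoord[OF a] by (auto simp: differentiable_def)
  have 2: "(\<lambda>x. g (ypart x)) differentiable (at x)"
    by (rule differentiable_compose_linear[OF bounded_linear_ypart smooth_differentiable[OF g]])
  show "(\<lambda>x. a (tcoord x) * g (ypart x)) differentiable (at x)"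
    by (rule differentiable_mult[OF 1 2])
  have p: "partial i (\<lambda>x. a (tcoord x)) x = (if i = 1 then a' (tcoord x) else 0)" for i
    using partial_eq[OF has_derivative_tcoord[OF a]] by (simp add: tcoord_axis)
  note q = partial_ypart[OF smooth_differentiable[OF g]]
  show "partial 1 (\<lambda>x. a (tcoord x) * g (ypart x)) x = a' (tcoord x) * g (ypart x)"
    "partial 2 (\<lambda>x. a (tcoord x) * g (ypart x)) x = a (tcoord x) * partial 1 g (ypart x)"
    "partial 3 (\<lambda>x. a (tcoord x) * g (ypart x)) x = a (tcoord x) * partial 2 g (ypart x)"
    "partial 4 (\<lambda>x. a (tcoord x) * g (ypart x)) x = a (tcoord x) * partial 3 g (ypart x)"
    unfolding partial_mult[OF 1 2] p q by simp_all
qed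

definition indf :: "complex \<Rightarrow> nat \<Rightarrow> (nat \<Rightarrow> real^3 \<Rightarrow> complex) \<Rightarrow> real^4 \<Rightarrow> complex" where
  "indf lam N p x = (\<Sum>m\<le>N. (exp (lam * of_real (tcoord x)) * of_real (tcoord x) ^ m) * p m (ypart x))"

text \<open>The coefficients are continued by zero beyond N, so the recursions in m below need no
  separate top case.\<close>

lemma indicial_form_indf:
  assumes "indicial_form v lam f"
  obtains N p where "\<And>m. smooth (p m)" "\<And>m. torus_periodic v (p m)" "\<And>m. N < m \<Longrightarrow> p m = (\<lambda>y. 0)" "f = indf lam N p"
proof -
  obtain N p where p: "\<And>m. m \<le> N \<Longrightarrow> smooth (p m) \<and> torus_periodic v (p m)"
    and f: "\<And>x. f x = exp (lam * of_real (tcoord x)) * (\<Sum>m\<le>N. of_real (tcoord x) ^ m * p m (ypart x))"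
    using assms unfolding indicial_form_def by blast
  define q where "q m = (if m \<le> N then p m else (\<lambda>y. 0))" for m
  show thesis
  proof (rule that[of q N])
    show "f = indf lam N q"
      by (auto simp: fun_eq_iff f indf_def q_def sum_distrib_left mult.assoc)
  qed (auto simp: q_def p torus_periodic_def[of v "\<lambda>_. 0"])
qed

lemma exp_power_vector_derivative:
  fixes lam :: complex
  shows "((\<lambda>t. exp (lam * of_real t) * of_real t ^ m) has_vector_derivative
    (lam * (exp (lam * of_real t) * of_real t ^ m) + of_nat m * (exp (lam * of_real t) * of_real t ^ (m - 1)))) (at t)"
proof -
  have "((\<lambda>z. exp (lam * z) * z ^ m) has_field_derivative
    (lam * (exp (lam * of_real t) * of_real t ^ m) + of_nat m * (exp (lam * of_real t) * of_real t ^ (m - 1)))) (at (of_real t))"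
    by (auto intro!: derivative_eq_intros simp: algebra_simps)
  from field_vector_diff_chain_at[OF has_vector_derivative_of_real[OF DERIV_ident] this]
  show ?thesis by (simp add: o_def)
qed

text \<open>The summand m = 0 vanishes because of its factor m, whatever \<open>b (0 - 1)\<close>
  is, and the hypothesis removes the extra summand \<open>Suc N\<close> at the top.\<close>

lemma sum_power_shift:
  fixes b p :: "nat \<Rightarrow> complex"
  assumes "p (Suc N) = 0"
  shows "(\<Sum>m\<le>N. of_nat m * b (m - 1) * p m) = (\<Sum>m\<le>N. b m * (of_nat (Suc m) * p (Suc m)))"
proof -
  have "(\<Sum>m\<le>Suc N. of_nat m * b (m - 1) * p m) = (\<Sum>m\<le>N. of_nat (Suc m) * b m * p (Suc m))"
    by (subst sum.atMost_Suc_shift) simp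
  then show ?thesis using assms by (simp add: mult.left_commute mult.assoc)
qed

text \<open>The t-derivative acting on the coefficients of exp (lam t) t^m.\<close>

definition tder :: "complex \<Rightarrow> (nat \<Rightarrow> real^3 \<Rightarrow> complex) \<Rightarrow> nat \<Rightarrow> real^3 \<Rightarrow> complex" where
  "tder lam p m y = lam * p m y + of_nat (Suc m) * p (Suc m) y"

lemma partial_indf:
  assumes p: "\<And>m. smooth (p m)" "p (Suc N) = (\<lambda>y. 0)"
  shows "partial 1 (indf lam N p) = indf lam N (tder lam p)"
    "partial 2 (indf lam N p) = indf lam N (\<lambda>m. partial 1 (p m))"
    "partial 3 (indf lam N p) = indf lam N (\<lambda>m. partial 2 (p m))"
    "partial 4 (indf lam N p) = indf lam N (\<lambda>m. partial 3 (p m))"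
proof -
  note s = separated_partial[OF exp_power_vector_derivative p(1)]
  have e: "partial i (indf lam N p) x = (\<Sum>m\<le>N. partial i (\<lambda>x. (exp (lam * of_real (tcoord x)) * of_real (tcoord x) ^ m) * p m (ypart x)) x)" for i x
    unfolding indf_def[abs_def] by (rule partial_sum) (rule s(1))
  show "partial 2 (indf lam N p) = indf lam N (\<lambda>m. partial 1 (p m))"
    "partial 3 (indf lam N p) = indf lam N (\<lambda>m. partial 2 (p m))"
    "partial 4 (indf lam N p) = indf lam N (\<lambda>m. partial 3 (p m))"
    unfolding fun_eq_iff e s by (simp_all add: indf_def)
  show "partial 1 (indf lam N p) = indf lam N (tder lam p)"
  proof
    fix x
    let ?b = "\<lambda>m. exp (lam * of_real (tcoord x)) * of_real (tcoord x) ^ m"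
    have "partial 1 (indf lam N p) x = (\<Sum>m\<le>N. ?b m * (lam * p m (ypart x))) + (\<Sum>m\<le>N. of_nat m * ?b (m - 1) * p m (ypart x))"
      unfolding e s by (simp add: sum.distrib[symmetric] algebra_simps)
    also have "(\<Sum>m\<le>N. of_nat m * ?b (m - 1) * p m (ypart x)) = (\<Sum>m\<le>N. ?b m * (of_nat (Suc m) * p (Suc m) (ypart x)))"
      using sum_power_shift[of "\<lambda>m. p m (ypart x)" N ?b] p(2) by simp
    also have "(\<Sum>m\<le>N. ?b m * (lam * p m (ypart x))) + \<dots> = indf lam N (tder lam p) x"
      by (simp add: indf_def tder_def sum.distrib[symmetric] distrib_left)
    finally show "partial 1 (indf lam N p) x = indf lam N (tder lam p) x" .
  qed
qed

definition indlap :: "complex \<Rightarrow> (nat \<Rightarrow> real^3 \<Rightarrow> complex) \<Rightarrow> nat \<Rightarrow> real^3 \<Rightarrow> complex" where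
  "indlap lam p m y = lap (p m) y + tder lam (tder lam p) m y"

lemma smooth_tder: "(\<And>m. smooth (p m)) \<Longrightarrow> smooth (tder lam p m)"
  unfolding tder_def[abs_def] by (intro smooth_intros) auto

lemma smooth_indlap: "(\<And>m. smooth (p m)) \<Longrightarrow> smooth (indlap lam p m)"
  unfolding indlap_def[abs_def] by (intro smooth_add smooth_lap smooth_tder) auto

lemma torus_periodic_indlap:
  "(\<And>m. smooth (p m)) \<Longrightarrow> (\<And>m. torus_periodic v (p m)) \<Longrightarrow> torus_periodic v (indlap lam p m)"
  using torus_periodic_lap[of "p m" v] by (simp add: torus_periodic_def indlap_def tder_def)

lemma lap_indf:
  assumes p: "\<And>m. smooth (p m)" "\<And>m. N < m \<Longrightarrow> p m = (\<lambda>y. 0)"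
  shows "lap (indf lam N p) = indf lam N (indlap lam p)" "N < m \<Longrightarrow> indlap lam p m = (\<lambda>y. 0)"
proof -
  have t0: "N < m \<Longrightarrow> tder lam p m = (\<lambda>y. 0)" for m
    by (simp add: tder_def fun_eq_iff p)
  have "partial 1 (partial 1 (indf lam N p)) = indf lam N (tder lam (tder lam p))"
    by (simp add: partial_indf p smooth_tder t0)
  moreover have "partial 2 (partial 2 (indf lam N p)) = indf lam N (\<lambda>m. partial 1 (partial 1 (p m)))"
    "partial 3 (partial 3 (indf lam N p)) = indf lam N (\<lambda>m. partial 2 (partial 2 (p m)))"
    "partial 4 (partial 4 (indf lam N p)) = indf lam N (\<lambda>m. partial 3 (partial 3 (p m)))"
    by (simp_all add: partial_indf p smooth_partial)
  ultimately show "lap (indf lam N p) = indf lam N (indlap lam p)"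
    by (simp add: fun_eq_iff lap_def sum_4 indf_def indlap_def sum_3 sum.distrib[symmetric] distrib_left add_ac)
  show "N < m \<Longrightarrow> indlap lam p m = (\<lambda>y. 0)"
    using t0[of m] t0[of "Suc m"] by (simp add: indlap_def fun_eq_iff p tder_def[of lam "tder lam p"])
qed

text \<open>For fixed y the exponential can be cancelled, and what remains is a polynomial vanishing
  at every real t.\<close>

lemma indf_zero:
  assumes "\<And>x. indf lam N q x = 0" "m \<le> N"
  shows "q m y = 0"
proof -
  have "(\<Sum>m\<le>N. q m y * of_real t ^ m) = 0" for t
  proof -
    let ?x = "vector [t, y $ 1, y $ 2, y $ 3] :: real^4"
    have "ypart ?x = y" "tcoord ?x = t"
      by (simp_all add: ypart_def tcoord_def vector_4 vec_eq_iff forall_3)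
    then have "exp (lam * of_real t) * (\<Sum>m\<le>N. q m y * of_real t ^ m) = 0"
      using assms(1)[of ?x] by (simp add: indf_def sum_distrib_left mult_ac)
    then show ?thesis by simp
  qed
  then have "range of_real \<subseteq> {z :: complex. (\<Sum>m\<le>N. q m y * z ^ m) = 0}" by auto
  moreover have "infinite (range (of_real :: real \<Rightarrow> complex))"
    by (simp add: finite_image_iff inj_of_real infinite_UNIV_char_0)
  ultimately have "infinite {z. (\<Sum>m\<le>N. q m y * z ^ m) = 0}" using finite_subset by blast
  then show ?thesis
    using polyfun_finite_roots[where n = N and c = "\<lambda>m. q m y"] assms(2) by auto
qed

text \<open>Coefficient m of the equation is the Laplacian of q m plus lam^2 times q m plus
  multiples of the next two coefficients. Descending induction on m, expressed by
  \<open>N < m + k\<close>, removes these and leaves the eigenvalue equation.\<close>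

lemma indlap_kernel_eigen:
  assumes q: "\<And>m. smooth (q m)" "\<And>m. torus_periodic v (q m)" "\<And>m. N < m \<Longrightarrow> q m = (\<lambda>y. 0)"
    and T: "\<And>m y. indlap lam q m y = 0"
    and no_eigen: "\<And>u y. \<lbrakk>smooth u; torus_periodic v u; \<And>x. lap u x = - (lam\<^sup>2) * u x\<rbrakk> \<Longrightarrow> u y = 0"
  shows "q m = (\<lambda>y. 0)"
proof -
  have "\<forall>m. N < m + k \<longrightarrow> q m = (\<lambda>y. 0)" for k
  proof (induction k)
    case 0
    then show ?case using q(3) by simp
  next
    case (Suc k)
    show ?case
    proof (intro allI impI ext)
      fix m y assume m: "N < m + Suc k"
      then have "q (Suc m) = (\<lambda>y. 0)" "q (Suc (Suc m)) = (\<lambda>y. 0)" using Suc by auto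
      then have "lap (q m) x = - (lam\<^sup>2) * q m x" for x
        using T[of m x] by (simp add: indlap_def tder_def power2_eq_square add_eq_0_iff2)
      then show "q m y = 0" by (rule no_eigen[OF q(1,2)])
    qed
  qed
  from this[of "Suc N"] show ?thesis by simp
qed

text \<open>At lam = 0 coefficient m of the Laplacian is the Laplacian of q m plus (m + 1) (m + 2)
  times q (m + 2). By descending induction the second term is constant, so q m has constant
  Laplacian; \<open>lap_constant\<close> and \<open>harmonic_constant\<close> finish. The hypothesis
  asks for constancy in y rather than vanishing so that the lemma can be applied twice to the
  bi-Laplace equation.\<close>

lemma indlap_constant:
  assumes v: "det v \<noteq> 0"
    and q: "\<And>m. smooth (q m)" "\<And>m. torus_periodic v (q m)" "\<And>m. N < m \<Longrightarrow> q m = (\<lambda>y. 0)"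
    and T: "\<And>m x y. indlap 0 q m x = indlap 0 q m y"
  shows "q m x = q m y"
proof -
  have "\<forall>m. N < m + k \<longrightarrow> (\<forall>x y. q m x = q m y)" for k
  proof (induction k)
    case 0
    then show ?case using q(3) by simp
  next
    case (Suc k)
    show ?case
    proof (intro allI impI)
      fix m x y assume m: "N < m + Suc k"
      then have c: "q (Suc (Suc m)) x = q (Suc (Suc m)) 0" for x using Suc by force
      define C where "C = indlap 0 q m 0 - of_nat (Suc m) * (of_nat (Suc (Suc m)) * q (Suc (Suc m)) 0)"
      have L: "lap (q m) x = C" for x
        using T[of m x 0] c[of x] by (simp add: indlap_def tder_def C_def algebra_simps)
      then have "C = 0" by (rule lap_constant[OF v q(1,2)])
      with L show "q m x = q m y" using harmonic_constant[OF v q(1,2)] by blast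
    qed
  qed
  from this[of "Suc N"] have "\<forall>x y. q m x = q m y" by simp
  then show ?thesis by blast
qed

lemma indicial_biharmonic_zero:
  assumes f: "indicial_form v lam f" and ll: "\<And>x. lap (lap f) x = 0"
    and no_eigen: "\<And>u y. \<lbrakk>smooth u; torus_periodic v u; \<And>x. lap u x = - (lam\<^sup>2) * u x\<rbrakk> \<Longrightarrow> u y = 0"
  shows "f x = 0"
proof -
  obtain p N where p: "\<And>m. smooth (p m)" "\<And>m. torus_periodic v (p m)" "\<And>m. N < m \<Longrightarrow> p m = (\<lambda>y. 0)" "f = indf lam N p"
    by (rule indicial_form_indf[OF f], rule that) assumption+
  have q: "smooth (indlap lam p m)" "torus_periodic v (indlap lam p m)" "N < m \<Longrightarrow> indlap lam p m = (\<lambda>y. 0)" for m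
    by (rule smooth_indlap[OF p(1)] torus_periodic_indlap[OF p(1,2)] lap_indf(2)[OF p(1,3)])+
  have "indf lam N (indlap lam (indlap lam p)) x = 0" for x
    using ll[of x] unfolding p(4) by (simp add: lap_indf p q)
  from indf_zero[OF this] have t1: "indlap lam (indlap lam p) m y = 0" for m y
    by (cases "m \<le> N") (auto simp: lap_indf(2)[of "indlap lam p" N] q p)
  have "indlap lam p m = (\<lambda>y. 0)" for m
    by (rule indlap_kernel_eigen[where N = N and lam = lam and v = v]) (rule q t1 no_eigen; assumption)+
  then have t2: "indlap lam p m y = 0" for m y by simp
  have "p m = (\<lambda>y. 0)" for m
    by (rule indlap_kernel_eigen[where N = N and lam = lam and v = v]) (rule p(1,2,3) t2 no_eigen; assumption)+
  then show ?thesis by (simp add: p(4) indf_def)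
qed

text \<open>In \<open>kernelFadj\<close> the smoothness of the 1-form is implied by the indicial
  form of its components; this lemma extracts it.\<close>

lemma indicial_form_0_smooth:
  assumes f: "indicial_form v 0 f"
  shows "smooth f"
proof -
  obtain p N where p: "\<And>m. smooth (p m)" "\<And>m. torus_periodic v (p m)" "\<And>m. N < m \<Longrightarrow> p m = (\<lambda>y. 0)" "f = indf 0 N p"
    by (rule indicial_form_indf[OF f], rule that) assumption+
  show ?thesis
    unfolding p(4) indf_def[abs_def]
    by (intro smooth_sum smooth_mult smooth_power smooth_of_real smooth_tcoord smooth_compose_linear[OF bounded_linear_ypart] p) simp
qed

lemma indicial_biharmonic_y_independent:
  assumes v: "det v \<noteq> 0" and f: "indicial_form v 0 f" and ll: "\<And>x. lap (lap f) x = 0"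
    and "i \<noteq> 1"
  shows "partial i f x = 0"
proof -
  obtain p N where p: "\<And>m. smooth (p m)" "\<And>m. torus_periodic v (p m)" "\<And>m. N < m \<Longrightarrow> p m = (\<lambda>y. 0)" "f = indf 0 N p"
    by (rule indicial_form_indf[OF f], rule that) assumption+
  have q: "smooth (indlap 0 p m)" "torus_periodic v (indlap 0 p m)" "N < m \<Longrightarrow> indlap 0 p m = (\<lambda>y. 0)" for m
    by (rule smooth_indlap[OF p(1)] torus_periodic_indlap[OF p(1,2)] lap_indf(2)[OF p(1,3)])+
  have "indf 0 N (indlap 0 (indlap 0 p)) x = 0" for x
    using ll[of x] unfolding p(4) by (simp add: lap_indf p q)
  from indf_zero[OF this] have "indlap 0 (indlap 0 p) m y = 0" for m y
    by (cases "m \<le> N") (auto simp: lap_indf(2)[of "indlap 0 p" N] q p)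
  then have "indlap 0 (indlap 0 p) m x = indlap 0 (indlap 0 p) m y" for m x y by simp
  from indlap_constant[where q = "indlap 0 p" and N = N, OF v q this]
  have "indlap 0 p m x = indlap 0 p m y" for m x y by blast
  from indlap_constant[where q = p and N = N, OF v p(1,2,3) this]
  have c: "p m x = p m y" for m x y by blast
  then have "p m = (\<lambda>y. p m 0)" for m by blast
  then have "partial i (p m) = (\<lambda>x. 0)" for i m by (metis partial_const)
  then have "partial i f x = 0" if "i \<in> {2,3,4}" for i x
    using that unfolding p(4) by (auto simp: partial_indf p indf_def)
  then show ?thesis using exhaust_4[of i] assms(4) by auto
qed


section \<open>Integration by parts on the cylinder\<close>

context
  fixes v :: "real^3^3"
  assumes v: "det v \<noteq> 0"
begin

definition lcoord :: "3 \<Rightarrow> real^4 \<Rightarrow> real" where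
  "lcoord a x = (matrix_inv (transpose v) *v ypart x) $ a"

lemma bounded_linear_lcoord: "bounded_linear (lcoord a)"
proof -
  have "linear (\<lambda>x. (matrix_inv (transpose v) *v ypart x) $ a)"
    by (intro linear_compose[where g = "\<lambda>x. x $ a" and f = "\<lambda>x. matrix_inv (transpose v) *v ypart x", unfolded o_def]
      linear_compose[where g = "(*v) (matrix_inv (transpose v))" and f = ypart, unfolded o_def]
      bounded_linear.linear[OF bounded_linear_ypart] matrix_vector_mul_linear bounded_linear.linear[OF bounded_linear_vec_nth])
  then show ?thesis unfolding lcoord_def[abs_def] linear_conv_bounded_linear .
qed

lemma ypart_lcoord: "ypart x = (\<Sum>a\<in>UNIV. lcoord a x *\<^sub>R v $ a)"
  unfolding lcoord_def by (rule lattice_coordinates[OF v])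

lemma lcoord_unique:
  assumes "ypart x = (\<Sum>a\<in>UNIV. s $ a *\<^sub>R v $ a)"
  shows "lcoord a x = s $ a"
proof -
  have d: "det (transpose v) \<noteq> 0" using v by (simp add: det_transpose)
  have "ypart x = transpose v *v s"
    unfolding assms transpose_mult_rows ..
  then have "matrix_inv (transpose v) *v ypart x = s"
    by (simp only: matrix_vector_mul_assoc matrix_inv_mult(2)[OF d] matrix_vector_mul_lid)
  then show ?thesis by (simp add: lcoord_def)
qed

lemma ypart_ylift: "ypart (ylift y) = y"
  by (simp add: ypart_def ylift_def vector_4 vec_eq_iff forall_3)

lemma lcoord_ylift: "lcoord a (ylift (v $ b)) = (if a = b then 1 else 0)"
proof -
  have "v $ b = (\<Sum>a\<in>UNIV. axis b 1 $ a *\<^sub>R v $ a)"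
    by (simp add: axis_def if_distrib[of "\<lambda>c. c *\<^sub>R _"] cong: if_cong)
  from lcoord_unique[of "ylift (v $ b)" "axis b 1" a, unfolded ypart_ylift, OF this]
  show ?thesis by (auto simp: axis_def)
qed

lemma lcoord_axis1: "lcoord a (axis 1 1) = 0"
proof -
  have "ypart (axis 1 1) = 0" by (simp add: ypart_def axis_def vec_eq_iff forall_3)
  then show ?thesis by (simp add: lcoord_def)
qed

lemma lcoord_linear: "lcoord a (x + c *\<^sub>R d) = lcoord a x + c * lcoord a d"
  using bounded_linear.linear[OF bounded_linear_lcoord[of a]] by (simp add: linear_add linear_scale)

lemma fundamental_domain_lcoord: "cyl_fundamental_domain v = {x. \<forall>a. 0 \<le> lcoord a x \<and> lcoord a x < 1}"
proof -
  have "x \<in> cyl_fundamental_domain v" if "\<forall>a. 0 \<le> lcoord a x \<and> lcoord a x < 1" for x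
    unfolding cyl_fundamental_domain_def using that ypart_lcoord[of x]
    by (auto intro!: exI[of _ "\<chi> a. lcoord a x"])
  moreover have "0 \<le> lcoord a x \<and> lcoord a x < 1" if "x \<in> cyl_fundamental_domain v" for a x
    using that lcoord_unique[of x] unfolding cyl_fundamental_domain_def by fastforce
  ultimately show ?thesis by blast
qed

text \<open>The fundamental domain with its interval in direction a replaced by [\<alpha>, \<beta>),
  so that translated domains can be cut and reassembled.\<close>

definition slab :: "3 \<Rightarrow> real \<Rightarrow> real \<Rightarrow> (real^4) set" where
  "slab a \<alpha> \<beta> = {x. \<alpha> \<le> lcoord a x \<and> lcoord a x < \<beta> \<and> (\<forall>b. b \<noteq> a \<longrightarrow> 0 \<le> lcoord b x \<and> lcoord b x < 1)}"

lemma fundamental_domain_slab: "cyl_fundamental_domain v = slab a 0 1"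
  unfolding fundamental_domain_lcoord slab_def by auto

lemma slab_borel [measurable]: "slab a \<alpha> \<beta> \<in> sets borel"
proof -
  have [measurable]: "lcoord b \<in> borel_measurable borel" for b
    by (intro borel_measurable_continuous_onI bounded_linear.continuous_on[OF bounded_linear_lcoord] continuous_on_id)
  have "slab a \<alpha> \<beta> = {x \<in> space borel. \<alpha> \<le> lcoord a x \<and> lcoord a x < \<beta> \<and> (\<forall>b\<in>UNIV. b \<noteq> a \<longrightarrow> 0 \<le> lcoord b x \<and> lcoord b x < 1)}"
    by (auto simp: slab_def)
  also have "\<dots> \<in> sets borel" by measurable
  finally show ?thesis .
qed

lemma slab_bounded:
  assumes "x \<in> slab a \<alpha> \<beta>" "0 \<le> \<alpha>" "\<beta> \<le> 2" "\<bar>tcoord x\<bar> \<le> R"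
  shows "norm x \<le> R + 6 * torus_diam v"
proof -
  have l: "\<bar>lcoord b x\<bar> \<le> 2" for b
    using assms by (cases "b = a") (auto simp: slab_def abs_le_iff intro: order_trans less_imp_le)
  have "norm (ypart x) \<le> (\<Sum>b\<in>UNIV. norm (lcoord b x *\<^sub>R v $ b))"
    by (subst ypart_lcoord) (rule norm_sum)
  also have "\<dots> \<le> (\<Sum>b\<in>UNIV. 2 * norm (v $ b))"
    by (rule sum_mono) (auto intro!: mult_right_mono l)
  also have "\<dots> = 2 * torus_diam v" by (simp add: torus_diam_def sum_distrib_left)
  finally have y: "\<bar>ypart x $ b\<bar> \<le> 2 * torus_diam v" for b
    using component_le_norm_cart[of "ypart x" b] by simp
  have "norm x \<le> (\<Sum>i\<in>UNIV. \<bar>x $ i\<bar>)" by (rule norm_le_l1_cart)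
  also have "\<dots> \<le> R + 6 * torus_diam v"
    \<comment> \<open>Lattice coordinates are at most 2 in absolute value, so each of the three
      y-coordinates is at most twice \<open>torus_diam v\<close>; hence the 6.\<close>
    using y[of 1] y[of 2] y[of 3] assms(4) unfolding sum_4 ypart_def tcoord_def by simp
  finally show ?thesis .
qed

lemma bounded_on_ball:
  fixes f :: "real^4 \<Rightarrow> real"
  assumes "continuous_on UNIV f"
  obtains C where "C > 0" "\<And>x. norm x \<le> r \<Longrightarrow> \<bar>f x\<bar> \<le> C"
proof -
  have "bounded (f ` cball 0 r)"
    by (intro compact_imp_bounded compact_continuous_image continuous_on_subset[OF assms]) auto
  then obtain C where "C > 0" "\<And>x. x \<in> cball 0 r \<Longrightarrow> norm (f x) \<le> C"
    unfolding bounded_pos by auto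
  then show thesis by (intro that[of C]) auto
qed

lemma integrable_cball_indicator: "integrable lborel (\<lambda>x :: real^4. C * indicator (cball 0 r) x :: real)"
  by (intro integrable_mult_right integrable_real_indicator emeasure_bounded_finite) auto

lemma integrable_on_ball:
  assumes g: "g \<in> borel_measurable borel" "\<And>x. \<bar>g x\<bar> \<le> C" "\<And>x. norm x > r \<Longrightarrow> g x = 0"
  shows "integrable lborel (g :: real^4 \<Rightarrow> real)"
proof (rule Bochner_Integration.integrable_bound)
  show "integrable lborel (\<lambda>x :: real^4. C * indicator (cball 0 r) x)"
    by (rule integrable_cball_indicator)
  show "AE x in lborel. norm (g x) \<le> norm (C * indicator (cball 0 r) x)"
    using g(2,3) by (auto simp: indicator_def not_le intro!: AE_I2 order_trans[OF g(2) abs_ge_self])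
qed (use g in simp)

lemma integrable_slab:
  fixes f :: "real^4 \<Rightarrow> real"
  assumes f: "continuous_on UNIV f" "compactly_supported f" and ab: "0 \<le> \<alpha>" "\<beta> \<le> 2"
  shows "integrable lborel (\<lambda>x. indicator (slab a \<alpha> \<beta>) x * f x)"
proof -
  obtain R where R: "\<And>x. \<bar>tcoord x\<bar> > R \<Longrightarrow> f x = 0" using f(2) by (auto simp: compactly_supported_def)
  let ?r = "R + 6 * torus_diam v"
  obtain C where C: "C > 0" "\<And>x. norm x \<le> ?r \<Longrightarrow> \<bar>f x\<bar> \<le> C" using bounded_on_ball[OF f(1)] by blast
  have z: "indicator (slab a \<alpha> \<beta>) x * f x = 0" if "norm x > ?r" for x
    using slab_bounded[of x a \<alpha> \<beta> R] R[of x] ab that by (fastforce simp: indicator_def)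
  show ?thesis
  proof (rule integrable_on_ball[where C = C and r = ?r])
    show "\<bar>indicator (slab a \<alpha> \<beta>) x * f x\<bar> \<le> C" for x
      using C z[of x] by (cases "norm x \<le> ?r") (auto simp: indicator_def)
    have "f \<in> borel_measurable borel" using f(1) by (rule borel_measurable_continuous_onI)
    then show "(\<lambda>x. indicator (slab a \<alpha> \<beta>) x * f x) \<in> borel_measurable borel" by measurable
  qed (use z in blast)
qed

lemma lborel_integral_translate:
  fixes g :: "real^4 \<Rightarrow> real"
  assumes "g \<in> borel_measurable borel"
  shows "(\<integral>x. g (x + c) \<partial>lborel) = (\<integral>x. g x \<partial>lborel)"
proof -
  have "(\<integral>x. g x \<partial>lborel) = (\<integral>x. g x \<partial>distr lborel borel ((+) c))" by (simp add: lborel_distr_plus)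
  also have "\<dots> = (\<integral>x. g (c + x) \<partial>lborel)" by (rule integral_distr) (use assms in auto)
  finally show ?thesis by (simp add: add.commute)
qed

lemma cyl_integral_indicator: "cyl_integral v f = (\<integral>x. indicator (slab a 0 1) x * f x \<partial>lborel)"
  by (simp add: cyl_integral_def set_lebesgue_integral_def fundamental_domain_slab[of a])

lemma tcoord_ylift: "tcoord (ylift y) = 0"
  by (simp add: tcoord_def ylift_def vector_4)

lemma cyl_integral_translate_t:
  assumes f: "continuous_on UNIV f"
  shows "cyl_integral v (\<lambda>x. f (x + \<tau> *\<^sub>R axis 1 1)) = cyl_integral v f"
proof -
  have i: "indicator (slab 1 0 1) (x + \<tau> *\<^sub>R axis 1 1) = (indicator (slab 1 0 1) x :: real)" for x
    by (simp add: indicator_def slab_def lcoord_linear lcoord_axis1)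
  have [measurable]: "f \<in> borel_measurable borel" using f by (rule borel_measurable_continuous_onI)
  have "(\<integral>x. indicator (slab 1 0 1) (x + \<tau> *\<^sub>R axis 1 1) * f (x + \<tau> *\<^sub>R axis 1 1) \<partial>lborel) = (\<integral>x. indicator (slab 1 0 1) x * f x \<partial>lborel)"
    by (rule lborel_integral_translate) measurable
  then show ?thesis by (simp add: cyl_integral_indicator[of _ 1] i)
qed

text \<open>Translation carries the slab [0,1) to [\<tau>, 1 + \<tau>); by periodicity the overhang
  [1, 1 + \<tau>) has the same integral as the missing piece [0, \<tau>).\<close>

lemma cyl_integral_translate_y:
  assumes f: "continuous_on UNIV f" "cyl_periodic v f" "compactly_supported f" and \<tau>: "0 \<le> \<tau>" "\<tau> \<le> 1"
  shows "cyl_integral v (\<lambda>x. f (x + \<tau> *\<^sub>R ylift (v $ a))) = cyl_integral v f"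
proof -
  let ?d = "ylift (v $ a)" and ?I = "\<lambda>X. \<integral>x. indicator X x * f x \<partial>lborel"
  have [measurable]: "f \<in> borel_measurable borel" using f(1) by (rule borel_measurable_continuous_onI)
  note int = integrable_slab[OF f(1,3)]
  have sh: "indicator (slab a \<alpha> \<beta>) (x + c *\<^sub>R ?d) = (indicator (slab a (\<alpha> - c) (\<beta> - c)) x :: real)" for \<alpha> \<beta> c x
    by (auto simp: indicator_def slab_def lcoord_linear lcoord_ylift)
  have "(\<integral>x. indicator (slab a \<tau> (1 + \<tau>)) (x + \<tau> *\<^sub>R ?d) * f (x + \<tau> *\<^sub>R ?d) \<partial>lborel) = ?I (slab a \<tau> (1 + \<tau>))"
    by (rule lborel_integral_translate) measurable
  then have 1: "cyl_integral v (\<lambda>x. f (x + \<tau> *\<^sub>R ?d)) = ?I (slab a \<tau> (1 + \<tau>))"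
    by (simp add: cyl_integral_indicator[of _ a] sh)
  have "(\<integral>x. indicator (slab a 1 (1 + \<tau>)) (x + 1 *\<^sub>R ?d) * f (x + 1 *\<^sub>R ?d) \<partial>lborel) = ?I (slab a 1 (1 + \<tau>))"
    by (rule lborel_integral_translate) measurable
  then have 2: "?I (slab a 0 \<tau>) = ?I (slab a 1 (1 + \<tau>))"
    using f(2) by (simp add: sh[of _ _ _ 1, simplified] cyl_periodic_def)
  have split: "?I (slab a \<alpha> \<gamma>) = ?I (slab a \<alpha> \<beta>) + ?I (slab a \<beta> \<gamma>)" if "0 \<le> \<alpha>" "\<alpha> \<le> \<beta>" "\<beta> \<le> \<gamma>" "\<gamma> \<le> 2" for \<alpha> \<beta> \<gamma>
  proof -
    have "indicator (slab a \<alpha> \<gamma>) x * f x = indicator (slab a \<alpha> \<beta>) x * f x + indicator (slab a \<beta> \<gamma>) x * f x" for x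
      using that by (auto simp: indicator_def slab_def)
    then show ?thesis using that by (simp add: Bochner_Integration.integral_add int)
  qed
  show ?thesis
    unfolding 1 cyl_integral_indicator[of f a]
    using split[of \<tau> 1 "1 + \<tau>"] split[of 0 \<tau> 1] 2 \<tau> by simp
qed

text \<open>The integral of the derivative is the limit, by dominated convergence, of integrals of
  difference quotients, all of which are zero by translation invariance. Steps 1 / (n + 1) stay in
  the range [0,1] covered by \<open>cyl_integral_translate_y\<close>.\<close>

lemma dir_derivative_zero_integral:
  fixes f :: "real^4 \<Rightarrow> real"
  assumes f: "smooth f" and supp: "compactly_supported f"
    and inv: "\<And>n. cyl_integral v (\<lambda>x. f (x + (1 / real (Suc n)) *\<^sub>R d)) = cyl_integral v f"
  shows "cyl_integral v (\<lambda>x. \<Sum>k\<in>UNIV. d $ k * partial k f x) = 0"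
proof -
  note c = smooth_continuous[OF f]
  have [measurable]: "f \<in> borel_measurable borel" using c by (rule borel_measurable_continuous_onI)
  define D where "D x = (\<Sum>k\<in>UNIV. d $ k * partial k f x)" for x
  have sD: "smooth D" unfolding D_def by (intro smooth_intros f)
  have [measurable]: "D \<in> borel_measurable borel"
    using smooth_continuous[OF sD] by (rule borel_measurable_continuous_onI)
  define g where "g n x = real (Suc n) * (f (x + (1 / real (Suc n)) *\<^sub>R d) - f x)" for n x
  obtain R where R: "\<And>x. \<bar>tcoord x\<bar> > R \<Longrightarrow> f x = 0" using supp by (auto simp: compactly_supported_def)
  \<comment> \<open>Beyond R' both x and every shifted point lie outside the support; r also
    contains the intermediate points from the mean value theorem.\<close>
  define R' where "R' = R + \<bar>tcoord d\<bar>"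
  define r where "r = R' + 6 * torus_diam v + norm d"
  obtain C where C: "C > 0" "\<And>x. norm x \<le> r \<Longrightarrow> \<bar>D x\<bar> \<le> C"
    using bounded_on_ball[OF smooth_continuous[OF sD]] by blast
  have der: "((\<lambda>s. f (x + s *\<^sub>R d)) has_real_derivative D (x + s *\<^sub>R d)) (at s)" for x s
    using partial_eq_vector_derivative[where x = x and s = s and v = d, OF smooth_differentiable[OF f]]
    by (simp add: has_real_derivative_iff_has_vector_derivative D_def)
  have tl: "tcoord (x + s *\<^sub>R d) = tcoord x + s * tcoord d" for x s by (simp add: tcoord_def)
  let ?A = "slab 1 0 1"
  have bound: "\<bar>indicator ?A x * g n x\<bar> \<le> C * indicator (cball 0 r) x" for n x
  proof (cases "x \<in> ?A \<and> \<bar>tcoord x\<bar> \<le> R'")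
    case True
    then have nx: "norm x \<le> R' + 6 * torus_diam v" using slab_bounded[of x 1 0 1 R'] by simp
    have p: "0 < 1 / real (Suc n)" by simp
    obtain z where z: "0 < z" "z < 1 / real (Suc n)" "f (x + (1 / real (Suc n)) *\<^sub>R d) - f (x + 0 *\<^sub>R d) = (1 / real (Suc n) - 0) * D (x + z *\<^sub>R d)"
      using MVT2[of 0 "1 / real (Suc n)" "\<lambda>s. f (x + s *\<^sub>R d)" "\<lambda>s. D (x + s *\<^sub>R d)", OF p der] by blast
    have "z \<le> 1" using z(2) by (rule order_trans[OF less_imp_le]) simp
    then have "norm (x + z *\<^sub>R d) \<le> r"
      using nx z(1) norm_triangle_ineq[of x "z *\<^sub>R d"] mult_left_le_one_le[of "norm d" z] by (simp add: r_def)
    moreover have "g n x = D (x + z *\<^sub>R d)" using z(3) by (simp add: g_def)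
    moreover have "norm x \<le> r" using nx norm_ge_zero[of d] unfolding r_def by linarith
    ultimately show ?thesis using C by (simp add: indicator_def)
  next
    case False
    have "g n x = 0" if "\<bar>tcoord x\<bar> > R'"
    proof -
      have "\<bar>1 / real (Suc n) * tcoord d\<bar> \<le> \<bar>tcoord d\<bar>"
        unfolding abs_mult by (rule mult_left_le_one_le) auto
      then have "\<bar>tcoord (x + (1 / real (Suc n)) *\<^sub>R d)\<bar> > R" "\<bar>tcoord x\<bar> > R" using that unfolding tl R'_def by linarith+
      then show ?thesis by (simp add: g_def R)
    qed
    then have "indicator ?A x * g n x = 0" using False by (auto simp: indicator_def)
    then show ?thesis using C(1) by (simp add: indicator_def)
  qed
  have lim: "(\<lambda>n. indicator ?A x * g n x) \<longlonglongrightarrow> indicator ?A x * D x" for x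
  proof -
    have "((\<lambda>s. (f (x + s *\<^sub>R d) - f x) / s) \<longlongrightarrow> D x) (at 0)"
      using der[of x 0] by (simp add: has_field_derivative_iff)
    moreover have "filterlim (\<lambda>n. 1 / real (Suc n)) (at 0) sequentially"
      using LIMSEQ_inverse_real_of_nat by (auto simp: filterlim_at inverse_eq_divide)
    ultimately have "(\<lambda>n. (f (x + (1 / real (Suc n)) *\<^sub>R d) - f x) / (1 / real (Suc n))) \<longlonglongrightarrow> D x"
      by (rule filterlim_compose)
    then have "(\<lambda>n. g n x) \<longlonglongrightarrow> D x" by (simp add: g_def mult.commute)
    then show ?thesis by (intro tendsto_mult tendsto_const)
  qed
  have "(\<lambda>n. \<integral>x. indicator ?A x * g n x \<partial>lborel) \<longlonglongrightarrow> (\<integral>x. indicator ?A x * D x \<partial>lborel)"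
  proof (rule integral_dominated_convergence[where w = "\<lambda>x. C * indicator (cball 0 r) x"])
    show "integrable lborel (\<lambda>x :: real^4. C * indicator (cball 0 r) x)"
      by (rule integrable_cball_indicator)
    show "(\<lambda>x. indicator ?A x * g n x) \<in> borel_measurable lborel" for n
      unfolding g_def by measurable
    show "(\<lambda>x. indicator ?A x * D x) \<in> borel_measurable lborel" by measurable
  qed (use lim bound in auto)
  moreover have "(\<integral>x. indicator ?A x * g n x \<partial>lborel) = 0" for n
  proof -
    let ?s = "(1 / real (Suc n)) *\<^sub>R d"
    have "continuous_on UNIV (\<lambda>x. f (x + ?s))"
      by (intro continuous_on_compose2[OF c] continuous_intros) auto
    moreover have "compactly_supported (\<lambda>x. f (x + ?s))"
      unfolding compactly_supported_def
    proof (intro exI allI impI)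
      fix x assume "\<bar>tcoord x\<bar> > R'"
      moreover have "\<bar>1 / real (Suc n) * tcoord d\<bar> \<le> \<bar>tcoord d\<bar>"
        unfolding abs_mult by (rule mult_left_le_one_le) auto
      ultimately show "f (x + ?s) = 0" unfolding R'_def by (intro R) (unfold tl, linarith)
    qed
    ultimately have i: "integrable lborel (\<lambda>x. indicator ?A x * f (x + ?s))" by (rule integrable_slab) auto
    have "(\<integral>x. indicator ?A x * g n x \<partial>lborel) = (\<integral>x. real (Suc n) * (indicator ?A x * f (x + ?s) - indicator ?A x * f x) \<partial>lborel)"
      by (rule Bochner_Integration.integral_cong) (auto simp: g_def algebra_simps)
    also have "\<dots> = real (Suc n) * (cyl_integral v (\<lambda>x. f (x + ?s)) - cyl_integral v f)"
      using Bochner_Integration.integral_diff[OF i integrable_slab[OF c supp, of 0 1 1]]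
      by (simp add: cyl_integral_indicator[of _ 1])
    finally show ?thesis unfolding inv by simp
  qed
  ultimately have "(\<integral>x. indicator ?A x * D x \<partial>lborel) = 0" by (simp add: LIMSEQ_const_iff)
  then show ?thesis by (simp add: cyl_integral_indicator[of _ 1] D_def)
qed

end


section \<open>Integration by parts for \<open>qd\<close> and the formal adjoint of
  \<open>Dop\<close>\<close>

lemma ylift_linear: "ylift (\<Sum>a\<in>A. c a *\<^sub>R w a) = (\<Sum>a\<in>A. c a *\<^sub>R ylift (w a))"
proof -
  have "linear ylift"
    by (rule linearI) (auto simp: ylift_def vec_eq_iff forall_4 vector_4)
  then show ?thesis by (simp add: linear_sum linear_scale)
qed

lemma compactly_supported_partial:
  fixes f :: "real^4 \<Rightarrow> 'b::real_normed_vector"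
  assumes "compactly_supported f"
  shows "compactly_supported (partial i f)"
proof -
  obtain R where R: "\<And>x. \<bar>tcoord x\<bar> > R \<Longrightarrow> f x = 0" using assms by (auto simp: compactly_supported_def)
  have "partial i f x = 0" if x: "\<bar>tcoord x\<bar> > R" for x
  proof -
    have "open {x. \<bar>tcoord x\<bar> > R}"
      unfolding tcoord_def by (intro open_Collect_less continuous_intros)
    then have "\<forall>\<^sub>F z in nhds x. \<bar>tcoord z\<bar> > R"
      using x by (auto simp: eventually_nhds)
    then have "\<forall>\<^sub>F z in nhds x. 0 = f z" by eventually_elim (simp add: R)
    then have ev: "\<forall>\<^sub>F z in at x. 0 = f z" by (simp add: eventually_nhds_conv_at)
    have "(f has_derivative (\<lambda>v. 0)) (at x)"
      by (rule has_derivative_transform_eventually[OF _ ev]) (auto simp: R x)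
    then show ?thesis by (simp add: partial_eq)
  qed
  then show ?thesis by (auto simp: compactly_supported_def)
qed

lemma compactly_supported_qd: "compactly_supported f \<Longrightarrow> compactly_supported (qd m j f)"
proof -
  assume f: "compactly_supported f"
  have "\<forall>i. \<exists>R. \<forall>x. \<bar>tcoord x\<bar> > R \<longrightarrow> partial i f x = 0"
    using compactly_supported_partial[OF f] by (simp add: compactly_supported_def)
  then obtain R where R: "\<And>i x. \<bar>tcoord x\<bar> > R i \<Longrightarrow> partial i f x = 0" by metis
  have "qd m j f x = 0" if "\<bar>tcoord x\<bar> > Max (range R)" for x
  proof -
    have "\<bar>tcoord x\<bar> > R i" for i using that Max_ge[of "range R" "R i"] by simp
    then show ?thesis by (simp add: qd_def R)
  qed
  then show ?thesis unfolding compactly_supported_def by blast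
qed

lemma compactly_supported_mult:
  fixes f g :: "real^4 \<Rightarrow> real"
  shows "compactly_supported f \<Longrightarrow> compactly_supported (\<lambda>x. f x * g x)"
  by (auto simp: compactly_supported_def)

context
  fixes v :: "real^3^3"
  assumes v: "det v \<noteq> 0"
begin

lemma cyl_integrable:
  fixes f :: "real^4 \<Rightarrow> real"
  assumes "smooth f" "compactly_supported f"
  shows "integrable lborel (\<lambda>x. indicator (slab v 1 0 1) x * f x)"
  using integrable_slab[OF v smooth_continuous[OF assms(1)] assms(2)] by simp

lemma cyl_integral_sum:
  fixes f :: "'k \<Rightarrow> real^4 \<Rightarrow> real"
  assumes "\<And>k. k \<in> K \<Longrightarrow> smooth (f k)" "\<And>k. k \<in> K \<Longrightarrow> compactly_supported (f k)"
  shows "cyl_integral v (\<lambda>x. \<Sum>k\<in>K. f k x) = (\<Sum>k\<in>K. cyl_integral v (f k))"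
  unfolding cyl_integral_indicator[OF v, of _ 1] sum_distrib_left
  by (rule Bochner_Integration.integral_sum) (rule cyl_integrable[OF assms])

lemma cyl_integral_cmult: "cyl_integral v (\<lambda>x. c * f x) = c * cyl_integral v f"
  unfolding cyl_integral_indicator[OF v, of _ 1] by (simp add: mult.left_commute[of _ c])

text \<open>Invariance is known along t and along the lattice vectors. A coordinate vector is a real
  combination of these, and the integral of a directional derivative is linear in the
  direction.\<close>

lemma cyl_integral_partial:
  fixes f :: "real^4 \<Rightarrow> real"
  assumes f: "smooth f" "cyl_periodic v f" "compactly_supported f"
  shows "cyl_integral v (partial i f) = 0"
proof -
  note c = smooth_continuous[OF f(1)]
  have t: "cyl_integral v (\<lambda>x. \<Sum>k\<in>UNIV. axis 1 1 $ k * partial k f x) = 0"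
    by (rule dir_derivative_zero_integral[OF v f(1,3)]) (rule cyl_integral_translate_t[OF v c])
  have y: "cyl_integral v (\<lambda>x. \<Sum>k\<in>UNIV. ylift (v $ a) $ k * partial k f x) = 0" for a
    by (rule dir_derivative_zero_integral[OF v f(1,3)]) (rule cyl_integral_translate_y[OF v c f(2,3)], auto)
  have sp: "smooth (partial k f)" "compactly_supported (partial k f)" for k
    using f by (auto intro: smooth_partial compactly_supported_partial)
  have L: "(\<Sum>k\<in>UNIV. d $ k * cyl_integral v (partial k f)) = cyl_integral v (\<lambda>x. \<Sum>k\<in>UNIV. d $ k * partial k f x)" for d :: "real^4"
    by (subst cyl_integral_sum) (auto intro!: smooth_mult sp(1) compactly_supported_mult[OF sp(2), of _ "\<lambda>_. d $ _", simplified mult.commute]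
      simp: cyl_integral_cmult)
  define s where "s = matrix_inv (transpose v) *v ypart (axis i 1)"
  have s: "ypart (axis i 1) = (\<Sum>a\<in>UNIV. s $ a *\<^sub>R v $ a)"
    unfolding s_def by (rule lattice_coordinates[OF v])
  have "(axis i 1 :: real^4) = tcoord (axis i 1) *\<^sub>R axis 1 1 + ylift (ypart (axis i 1))"
    by (simp add: vec_eq_iff forall_4 ylift_def vector_4 ypart_def tcoord_def axis_def)
  also have "\<dots> = tcoord (axis i 1) *\<^sub>R axis 1 1 + (\<Sum>a\<in>UNIV. s $ a *\<^sub>R ylift (v $ a))"
    unfolding s ylift_linear ..
  finally have e: "axis i (1::real) $ k = tcoord (axis i 1) * axis 1 1 $ k + (\<Sum>a\<in>UNIV. s $ a * ylift (v $ a) $ k)" for k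
    by (simp add: vec_eq_iff)
  have "cyl_integral v (partial i f) = (\<Sum>k\<in>UNIV. axis i 1 $ k * cyl_integral v (partial k f))"
    by (simp add: axis_nth_delta delta_sum)
  also have "\<dots> = tcoord (axis i 1) * (\<Sum>k\<in>UNIV. axis 1 1 $ k * cyl_integral v (partial k f))
      + (\<Sum>a\<in>UNIV. s $ a * (\<Sum>k\<in>UNIV. ylift (v $ a) $ k * cyl_integral v (partial k f)))"
    unfolding e distrib_right sum.distrib sum_distrib_left sum_distrib_right
    by (subst (2) sum.swap) (simp add: mult.assoc)
  also have "\<dots> = 0" by (simp add: L t y)
  finally show ?thesis .
qed

lemma integration_by_parts_qd:
  fixes f g :: "real^4 \<Rightarrow> real"
  assumes f: "smooth f" "cyl_periodic v f" "compactly_supported f" and g: "smooth g" "cyl_periodic v g"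
  shows "cyl_integral v (\<lambda>x. qd m j f x * g x) = - cyl_integral v (\<lambda>x. f x * qd m j g x)"
proof -
  have fg: "smooth (\<lambda>x. f x * g x)" "cyl_periodic v (\<lambda>x. f x * g x)" "compactly_supported (\<lambda>x. f x * g x)"
    using f g by (auto intro!: smooth_mult compactly_supported_mult simp: cyl_periodic_def)
  have p: "partial i (\<lambda>x. f x * g x) x = f x * partial i g x + partial i f x * g x" for i x
    by (rule partial_mult) (intro smooth_differentiable f g)+
  have q: "qd m j (\<lambda>x. f x * g x) x = f x * qd m j g x + qd m j f x * g x" for x
    by (simp add: qd_def p sum_distrib_left sum_distrib_right sum.distrib algebra_simps)
  have "cyl_integral v (qd m j (\<lambda>x. f x * g x)) = 0"
    unfolding qd_def[abs_def]
    by (subst cyl_integral_sum)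
      (auto intro!: smooth_mult smooth_partial fg(1) compactly_supported_mult[OF compactly_supported_partial[OF fg(3)], of _ "\<lambda>_. asdq m $ _ $ j", simplified mult.commute]
       simp: cyl_integral_cmult cyl_integral_partial[OF fg])
  then have "cyl_integral v (\<lambda>x. f x * qd m j g x + qd m j f x * g x) = 0"
    unfolding q[abs_def] .
  moreover have "cyl_integral v (\<lambda>x. f x * qd m j g x + qd m j f x * g x) = cyl_integral v (\<lambda>x. f x * qd m j g x) + cyl_integral v (\<lambda>x. qd m j f x * g x)"
    unfolding cyl_integral_indicator[OF v, of _ 1] distrib_left
    by (rule Bochner_Integration.integral_add)
      (rule cyl_integrable; intro smooth_mult smooth_qd f(1) g(1) compactly_supported_mult compactly_supported_qd f(3))+
  ultimately show ?thesis by linarith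
qed

lemma integration_by_parts_qd_qd:
  fixes f g :: "real^4 \<Rightarrow> real"
  assumes f: "smooth f" "cyl_periodic v f" "compactly_supported f" and g: "smooth g" "cyl_periodic v g"
  shows "cyl_integral v (\<lambda>x. qd m j (qd n k f) x * g x) = cyl_integral v (\<lambda>x. f x * qd m j (qd n k g) x)"
proof -
  have "cyl_integral v (\<lambda>x. qd m j (qd n k f) x * g x) = cyl_integral v (\<lambda>x. f x * qd n k (qd m j g) x)"
    using integration_by_parts_qd[OF smooth_qd[OF f(1)] cyl_periodic_qd[OF f(1,2)] compactly_supported_qd[OF f(3)] g]
      integration_by_parts_qd[OF f smooth_qd[OF g(1)] cyl_periodic_qd[OF g]] by simp
  then show ?thesis by (simp add: qd_commute[OF g(1), of n k m j])
qed

text \<open>Orthogonality of the basis forms gives 16 times the pairing of coordinate blocks, and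
  the trace correction in \<open>dop_coeff\<close> drops out against the traceless Z. With 1/4 from
  the inner product and -1/8 from \<open>dop_coeff_eq\<close> this is the factor -1/2 of
  \<open>dstar\<close>.\<close>

lemma Dop_inner:
  assumes h: "smooth h" "\<And>x i j. h x $ i $ j = h x $ j $ i" and Z: "asd_sym_traceless (gcyl x) Z"
  shows "(1/4) * (Dop gcyl h x \<bullet> Z) =
    - (1/2) * (\<Sum>a\<in>UNIV. \<Sum>b\<in>UNIV. \<Sum>j\<in>UNIV. \<Sum>k\<in>UNIV. qd a j (qd b k (\<lambda>z. h z $ j $ k)) x * Z $ 1 $ a $ 1 $ b)"
proof -
  let ?c = "dop_coeff h x" and ?z = "\<lambda>a b. Z $ 1 $ a $ 1 $ b" and ?E = "sd_hess (hess h x)"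
  note z0 = asd_sym_traceless_gcyl(2,3)[OF Z]
  have orth: "(\<Sum>i\<in>UNIV. \<Sum>j\<in>UNIV. asdq a $ i $ j * asdq c $ i $ j) = 4 * delta a c" if "a \<in> {2,3,4}" "c \<in> {2,3,4}" for a c
  proof -
    have "\<forall>a\<in>{2,3,4}. \<forall>c\<in>{2,3,4}. (\<Sum>i\<in>UNIV. \<Sum>j\<in>UNIV. asdq a $ i $ j * asdq c $ i $ j) = 4 * delta a c"
      by (simp add: sum_4 asdq_rows vector_4 delta_def)
    with that show ?thesis by blast
  qed
  have "Dop gcyl h x \<bullet> Z = (\<Sum>i\<in>UNIV. \<Sum>j\<in>UNIV. \<Sum>k\<in>UNIV. \<Sum>l\<in>UNIV. Dop gcyl h x $ i $ j $ k $ l * Z $ i $ j $ k $ l)"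
    by (simp add: inner_vec_def)
  also have "\<dots> = (\<Sum>i\<in>UNIV. \<Sum>j\<in>UNIV. \<Sum>k\<in>UNIV. \<Sum>l\<in>UNIV.
      (\<Sum>a\<in>{2,3,4}. \<Sum>b\<in>{2,3,4}. asdq a $ i $ j * ?c a b * asdq b $ k $ l) * Z $ i $ j $ k $ l)"
    by (simp only: Dop_dop_coeff[OF h(1)])
  also have "\<dots> = (\<Sum>a\<in>{2,3,4}. \<Sum>b\<in>{2,3,4}. ?c a b * (\<Sum>i\<in>UNIV. \<Sum>j\<in>UNIV. \<Sum>k\<in>UNIV. \<Sum>l\<in>UNIV.
      asdq a $ i $ j * Z $ i $ j $ k $ l * asdq b $ k $ l))"
    unfolding sum_234 sum_distrib_left by (simp add: sum.distrib[symmetric] algebra_simps)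
  also have "\<dots> = (\<Sum>a\<in>{2,3,4}. \<Sum>b\<in>{2,3,4}. ?c a b * (16 * ?z a b))"
  proof (intro sum.cong refl arg_cong2[of _ _ _ _ "(*)"])
    fix a b :: 4 assume ab: "a \<in> {2,3,4}" "b \<in> {2,3,4}"
    have "(\<Sum>i\<in>UNIV. \<Sum>j\<in>UNIV. \<Sum>k\<in>UNIV. \<Sum>l\<in>UNIV. asdq a $ i $ j * Z $ i $ j $ k $ l * asdq b $ k $ l)
      = (\<Sum>i\<in>UNIV. \<Sum>j\<in>UNIV. \<Sum>k\<in>UNIV. \<Sum>l\<in>UNIV. asdq a $ i $ j * (\<Sum>c\<in>{2,3,4}. \<Sum>d\<in>{2,3,4}. asdq c $ i $ j * ?z c d * asdq d $ k $ l) * asdq b $ k $ l)"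
      by (subst asd_sym_traceless_gcyl(4)[OF Z]) (rule refl)
    also have "\<dots> = (\<Sum>c\<in>{2,3,4}. \<Sum>d\<in>{2,3,4}. ?z c d * (\<Sum>i\<in>UNIV. \<Sum>j\<in>UNIV. asdq a $ i $ j * asdq c $ i $ j * (\<Sum>k\<in>UNIV. \<Sum>l\<in>UNIV. asdq b $ k $ l * asdq d $ k $ l)))"
      unfolding sum_234 sum_distrib_left sum_distrib_right by (simp add: sum.distrib[symmetric] algebra_simps)
    also have "\<dots> = (\<Sum>c\<in>{2,3,4}. \<Sum>d\<in>{2,3,4}. ?z c d * ((4 * delta a c) * (4 * delta b d)))"
      by (intro sum.cong refl) (simp only: orth[OF ab(1)] orth[OF ab(2)] sum_distrib_right[symmetric])
    also have "\<dots> = 16 * ?z a b" using ab unfolding sum_234 by (auto simp: delta_def)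
    finally show "(\<Sum>i\<in>UNIV. \<Sum>j\<in>UNIV. \<Sum>k\<in>UNIV. \<Sum>l\<in>UNIV. asdq a $ i $ j * Z $ i $ j $ k $ l * asdq b $ k $ l) = 16 * ?z a b" .
  qed
  also have "\<dots> = (\<Sum>a\<in>{2,3,4}. \<Sum>b\<in>{2,3,4}. - 2 * (?E a b - (1/3) * delta a b * (\<Sum>c\<in>{2,3,4}. ?E c c)) * ?z a b)"
  proof (intro sum.cong refl)
    fix a b :: 4 assume ab: "a \<in> {2,3,4}" "b \<in> {2,3,4}"
    have alg: "- (1/8) * t * (16 * u) = - 2 * t * u" for t u :: real by simp
    show "?c a b * (16 * ?z a b) = - 2 * (?E a b - (1/3) * delta a b * (\<Sum>c\<in>{2,3,4}. ?E c c)) * ?z a b"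
      unfolding dop_coeff_eq[OF h ab] by (rule alg)
  qed
  also have "\<dots> = - 2 * (\<Sum>a\<in>{2,3,4}. \<Sum>b\<in>{2,3,4}. ?E a b * ?z a b) + (2/3) * (\<Sum>c\<in>{2,3,4}. ?E c c) * (?z 2 2 + ?z 3 3 + ?z 4 4)"
    unfolding sum_234 by (simp add: delta_def algebra_simps)
  also have "?z 2 2 + ?z 3 3 + ?z 4 4 = 0"
    using asd_sym_traceless_gcyl(5)[OF Z] by (simp add: sum_4 z0)
  also have "(\<Sum>a\<in>{2,3,4}. \<Sum>b\<in>{2,3,4}. ?E a b * ?z a b) = (\<Sum>a\<in>UNIV. \<Sum>b\<in>UNIV. ?E a b * ?z a b)"
    unfolding sum_4 sum_234 by (simp add: z0)
  finally show ?thesis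
    unfolding sd_hess_qd[OF h(1)] sum_distrib_right by simp
qed

lemma dstar_adjoint:
  assumes Z: "Z \<in> sections_S20_asd v" and h: "h \<in> sections_S20 v" "compactly_supported h"
  shows "cyl_integral v (\<lambda>x. (1/4) * (Dop gcyl h x \<bullet> Z x)) = cyl_integral v (\<lambda>x. h x \<bullet> dstar Z x)"
proof -
  have sh: "smooth h" and hs: "\<And>x i j. h x $ i $ j = h x $ j $ i" and hp: "cyl_periodic v h"
    using h by (auto simp: sections_S20_def sym_traceless_gcyl)
  have az: "asd_sym_traceless (gcyl x) (Z x)" for x
    using Z by (auto simp: sections_S20_asd_def)
  define hc where "hc j k = (\<lambda>z. h z $ j $ k)" for j k
  define z where "z a b = (\<lambda>x. Z x $ 1 $ a $ 1 $ b)" for a b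
  have hc: "smooth (hc j k)" "cyl_periodic v (hc j k)" "compactly_supported (hc j k)" for j k
    using sh hp h(2) unfolding hc_def cyl_periodic_def compactly_supported_def
    by (auto intro!: smooth_intros) (metis zero_index)
  have z: "smooth (z a b)" "cyl_periodic v (z a b)" for a b
    using Z by (auto simp: z_def sections_S20_asd_def cyl_periodic_def intro!: smooth_intros)
  have s1: "smooth (\<lambda>x. qd a j (qd b k (hc j k)) x * z a b x)" for a b j k
    by (intro smooth_mult smooth_qd hc z)
  have c1: "compactly_supported (\<lambda>x. qd a j (qd b k (hc j k)) x * z a b x)" for a b j k
    by (intro compactly_supported_mult compactly_supported_qd hc)
  have s2: "smooth (\<lambda>x. hc j k x * qd a j (qd b k (z a b)) x)" for a b j k
    by (intro smooth_mult smooth_qd hc z)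
  have c2: "compactly_supported (\<lambda>x. hc j k x * qd a j (qd b k (z a b)) x)" for a b j k
    by (intro compactly_supported_mult hc)
  have cs: "compactly_supported (\<lambda>x. \<Sum>k\<in>K. f k x)" if "finite K" "\<And>k. k \<in> K \<Longrightarrow> compactly_supported (f k)"
    for K :: "4 set" and f :: "4 \<Rightarrow> real^4 \<Rightarrow> real"
    using that
  proof (induction K)
    case empty
    then show ?case by (auto simp: compactly_supported_def)
  next
    case (insert k K)
    then obtain R1 R2 where "\<And>x. \<bar>tcoord x\<bar> > R1 \<Longrightarrow> f k x = 0" "\<And>x. \<bar>tcoord x\<bar> > R2 \<Longrightarrow> (\<Sum>k\<in>K. f k x) = 0"
      unfolding compactly_supported_def by (metis insertCI)
    then show ?case using insert by (auto simp: compactly_supported_def intro!: exI[of _ "max R1 R2"])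
  qed
  have "cyl_integral v (\<lambda>x. (1/4) * (Dop gcyl h x \<bullet> Z x))
    = cyl_integral v (\<lambda>x. - (1/2) * (\<Sum>a\<in>UNIV. \<Sum>b\<in>UNIV. \<Sum>j\<in>UNIV. \<Sum>k\<in>UNIV. qd a j (qd b k (hc j k)) x * z a b x))"
    by (simp only: Dop_inner[OF sh hs az] hc_def z_def)
  also have "\<dots> = - (1/2) * (\<Sum>a\<in>UNIV. \<Sum>b\<in>UNIV. \<Sum>j\<in>UNIV. \<Sum>k\<in>UNIV. cyl_integral v (\<lambda>x. qd a j (qd b k (hc j k)) x * z a b x))"
    unfolding cyl_integral_cmult by (simp only: cyl_integral_sum smooth_sum s1 cs c1 finite)
  also have "\<dots> = - (1/2) * (\<Sum>a\<in>UNIV. \<Sum>b\<in>UNIV. \<Sum>j\<in>UNIV. \<Sum>k\<in>UNIV. cyl_integral v (\<lambda>x. hc j k x * qd a j (qd b k (z a b)) x))"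
    by (simp only: integration_by_parts_qd_qd[OF hc z])
  also have "\<dots> = cyl_integral v (\<lambda>x. - (1/2) * (\<Sum>a\<in>UNIV. \<Sum>b\<in>UNIV. \<Sum>j\<in>UNIV. \<Sum>k\<in>UNIV. hc j k x * qd a j (qd b k (z a b)) x))"
    unfolding cyl_integral_cmult by (simp only: cyl_integral_sum smooth_sum s2 cs c2 finite)
  also have "\<dots> = cyl_integral v (\<lambda>x. h x \<bullet> dstar Z x)"
  proof -
    have "h x \<bullet> dstar Z x = - (1/2) * (\<Sum>a\<in>UNIV. \<Sum>b\<in>UNIV. \<Sum>j\<in>UNIV. \<Sum>k\<in>UNIV. hc j k x * qd a j (qd b k (z a b)) x)" for x
    proof -
      have "h x \<bullet> dstar Z x = (\<Sum>j\<in>UNIV. \<Sum>k\<in>UNIV. hc j k x * (- (1/2) * (\<Sum>a\<in>UNIV. \<Sum>b\<in>UNIV. qd a j (qd b k (z a b)) x)))"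
        by (simp add: inner_vec_def dstar_def hc_def z_def)
      also have "\<dots> = - (1/2) * (\<Sum>j\<in>UNIV. \<Sum>k\<in>UNIV. \<Sum>a\<in>UNIV. \<Sum>b\<in>UNIV. hc j k x * qd a j (qd b k (z a b)) x)"
        by (simp add: sum_distrib_left sum_negf)
      also have "(\<Sum>j\<in>UNIV. \<Sum>k\<in>UNIV. \<Sum>a\<in>UNIV. \<Sum>b\<in>UNIV. hc j k x * qd a j (qd b k (z a b)) x)
        = (\<Sum>j\<in>UNIV. \<Sum>a\<in>UNIV. \<Sum>k\<in>UNIV. \<Sum>b\<in>UNIV. hc j k x * qd a j (qd b k (z a b)) x)"
        by (rule sum.cong, rule refl, rule sum.swap)
      also have "\<dots> = (\<Sum>a\<in>UNIV. \<Sum>j\<in>UNIV. \<Sum>k\<in>UNIV. \<Sum>b\<in>UNIV. hc j k x * qd a j (qd b k (z a b)) x)"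
        by (rule sum.swap)
      also have "\<dots> = (\<Sum>a\<in>UNIV. \<Sum>j\<in>UNIV. \<Sum>b\<in>UNIV. \<Sum>k\<in>UNIV. hc j k x * qd a j (qd b k (z a b)) x)"
        by (intro sum.cong refl sum.swap)
      also have "\<dots> = (\<Sum>a\<in>UNIV. \<Sum>b\<in>UNIV. \<Sum>j\<in>UNIV. \<Sum>k\<in>UNIV. hc j k x * qd a j (qd b k (z a b)) x)"
        by (intro sum.cong refl sum.swap)
      finally show ?thesis .
    qed
    then show ?thesis by simp
  qed
  finally show ?thesis .
qed

end


section \<open>A smooth bump function and uniqueness of the adjoint\<close>

text \<open>The flat function exp (-1/s), together with its multiples by powers of 1/s, because the
  family over n is closed under differentiation up to linear combinations.\<close>

definition flat_exp :: "nat \<Rightarrow> real \<Rightarrow> real" where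
  "flat_exp n s = (if s \<le> 0 then 0 else (1 / s) ^ n * exp (- (1 / s)))"

lemma flat_exp_tendsto: "(flat_exp n \<longlongrightarrow> 0) (at_right 0)"
proof -
  have "filterlim (\<lambda>s::real. 1 / s) at_top (at_right 0)"
    using filterlim_inverse_at_top_right by (simp add: inverse_eq_divide)
  from filterlim_compose[OF tendsto_power_div_exp_0[of n] this]
  have "((\<lambda>s::real. (1 / s) ^ n * exp (- (1 / s))) \<longlongrightarrow> 0) (at_right 0)"
    by (simp add: exp_minus divide_inverse)
  then show ?thesis
    by (rule Lim_transform_eventually) (auto simp: flat_exp_def eventually_at_right_field intro!: exI[of _ 1])
qed

lemma DERIV_flat_exp: "(flat_exp n has_real_derivative (flat_exp (n + 2) s - real n * flat_exp (n + 1) s)) (at s)"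
proof -
  consider "s > 0" | "s < 0" | "s = 0" by linarith
  then show ?thesis
  proof cases
    case 1
    have "((\<lambda>s. (1 / s) ^ n * exp (- (1 / s))) has_real_derivative (flat_exp (n + 2) s - real n * flat_exp (n + 1) s)) (at s)"
    proof -
      have inv: "((\<lambda>s. 1 / s) has_real_derivative - ((1 / s)\<^sup>2)) (at s)"
        using 1 by (auto intro!: derivative_eq_intros simp: power2_eq_square)
      have "((\<lambda>s. (1 / s) ^ n * exp (- (1 / s))) has_real_derivative
        (of_nat n * (- ((1 / s)\<^sup>2) * (1 / s) ^ (n - Suc 0))) * exp (- (1 / s)) + (exp (- (1 / s)) * (- (- ((1 / s)\<^sup>2)))) * (1 / s) ^ n) (at s)"
        by (rule DERIV_mult[OF DERIV_power[OF inv] DERIV_chain2[OF DERIV_exp DERIV_minus[OF inv]]])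
      moreover have "(of_nat n * (- (u\<^sup>2) * u ^ (n - Suc 0))) * e + (e * (- (- (u\<^sup>2)))) * u ^ n
        = u ^ (n + 2) * e - real n * (u ^ (n + 1) * e)" for u e :: real
        by (cases n) (simp_all add: power2_eq_square algebra_simps)
      ultimately show ?thesis using 1 by (simp add: flat_exp_def)
    qed
    then show ?thesis
      by (rule has_field_derivative_transform_within_open[of _ _ _ "{0<..}"]) (use 1 in \<open>auto simp: flat_exp_def\<close>)
  next
    case 2
    have "((\<lambda>s. 0) has_real_derivative (flat_exp (n + 2) s - real n * flat_exp (n + 1) s)) (at s)"
      using 2 by (simp add: flat_exp_def)
    then show ?thesis
      by (rule has_field_derivative_transform_within_open[of _ _ _ "{..<0}"]) (use 2 in \<open>auto simp: flat_exp_def\<close>)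
  next
    case 3
    have "((\<lambda>h. (flat_exp n h - flat_exp n 0) / (h - 0)) \<longlongrightarrow> 0) (at 0)"
    proof (rule filterlim_split_at_real)
      show "((\<lambda>h. (flat_exp n h - flat_exp n 0) / (h - 0)) \<longlongrightarrow> 0) (at_left 0)"
        by (rule Lim_transform_eventually[OF tendsto_const]) (auto simp: flat_exp_def eventually_at_left_field intro!: exI[of _ "-1"])
      \<comment> \<open>The difference quotient at 0 from the right is the next member
        \<open>flat_exp (Suc n)\<close>, which tends to 0.\<close>
      show "((\<lambda>h. (flat_exp n h - flat_exp n 0) / (h - 0)) \<longlongrightarrow> 0) (at_right 0)"
        by (rule Lim_transform_eventually[OF flat_exp_tendsto[of "Suc n"]])
          (auto simp: flat_exp_def eventually_at_right_field intro!: exI[of _ 1])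
    qed
    then show ?thesis using 3 by (simp add: has_field_derivative_iff flat_exp_def)
  qed
qed

lemma smooth_flat_exp: "smooth (\<lambda>x. flat_exp n (c * tcoord x + R))"
proof -
  have d: "((\<lambda>x. flat_exp n (c * tcoord x + R)) has_derivative
    (\<lambda>w. tcoord w *\<^sub>R ((flat_exp (n + 2) (c * tcoord x + R) - real n * flat_exp (n + 1) (c * tcoord x + R)) * c))) (at x)" for n x
  proof (rule has_derivative_tcoord)
    have "((\<lambda>t. c * t + R) has_real_derivative c) (at t)" for t
      by (auto intro!: derivative_eq_intros)
    from DERIV_chain2[OF DERIV_flat_exp this]
    show "((\<lambda>t. flat_exp n (c * t + R)) has_vector_derivative
      (flat_exp (n + 2) (c * tcoord x + R) - real n * flat_exp (n + 1) (c * tcoord x + R)) * c) (at (tcoord x))"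
      unfolding has_real_derivative_iff_has_vector_derivative .
  qed
  have "\<forall>n. Ck m (\<lambda>x. flat_exp n (c * tcoord x + R))" for m
  proof (induction m)
    case 0
    show ?case
      using has_derivative_continuous[OF d] by (auto simp: continuous_on_eq_continuous_at)
  next
    case (Suc m)
    show ?case
    proof
      fix n
      have "partial i (\<lambda>x. flat_exp n (c * tcoord x + R)) = (\<lambda>x. (tcoord (axis i 1) * c) * flat_exp (n + 2) (c * tcoord x + R)
         + (- (tcoord (axis i 1) * c * real n)) * flat_exp (n + 1) (c * tcoord x + R))" for i
        using partial_eq[OF d] by (auto simp: algebra_simps)
      moreover have "Ck m (\<lambda>x. a * flat_exp (n + 2) (c * tcoord x + R) + b * flat_exp (n + 1) (c * tcoord x + R))" for a b
        using Suc by (intro Ck_add Ck_bounded_linear[OF bounded_linear_mult_right]) blast+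
      ultimately have "Ck m (partial i (\<lambda>x. flat_exp n (c * tcoord x + R)))" for i by presburger
      moreover have "(\<lambda>x. flat_exp n (c * tcoord x + R)) differentiable (at x)" for x
        using d unfolding differentiable_def by blast
      ultimately show "Ck (Suc m) (\<lambda>x. flat_exp n (c * tcoord x + R))" by simp
    qed
  qed
  then show ?thesis by (simp add: smooth_def)
qed

text \<open>A bump in t alone, so multiplying a section by it preserves periodicity and membership
  in the fibre.\<close>

definition tbump :: "real \<Rightarrow> real^4 \<Rightarrow> real" where
  "tbump R x = flat_exp 0 (1 * tcoord x + R) * flat_exp 0 (- 1 * tcoord x + R)"

lemma smooth_tbump: "smooth (tbump R)"
  unfolding tbump_def[abs_def] by (intro smooth_mult smooth_flat_exp)

lemma tbump_nonneg: "0 \<le> tbump R x"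
  and tbump_pos: "\<bar>tcoord x\<bar> < R \<Longrightarrow> 0 < tbump R x"
  and tbump_zero: "\<bar>tcoord x\<bar> > R \<Longrightarrow> tbump R x = 0"
  by (auto simp: tbump_def flat_exp_def)

context
  fixes v :: "real^3^3"
  assumes v: "det v \<noteq> 0"
begin

text \<open>In the interior of the domain the set where f is positive is open and null, hence empty.
  The domain is half-open, so its boundary faces are reached by continuity.\<close>

lemma nonneg_integral_zero:
  fixes f :: "real^4 \<Rightarrow> real"
  assumes f: "smooth f" "compactly_supported f" "\<And>x. 0 \<le> f x" and i: "cyl_integral v f = 0"
    and x: "x \<in> cyl_fundamental_domain v"
  shows "f x = 0"
proof -
  let ?U = "{x. \<forall>a. 0 < lcoord v a x \<and> lcoord v a x < 1}"
  have cl: "continuous_on UNIV (lcoord v a)" for a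
    by (intro bounded_linear.continuous_on[OF bounded_linear_lcoord[OF v]] continuous_on_id)
  have U: "f z = 0" if z: "z \<in> ?U" for z
  proof (rule ccontr)
    assume "f z \<noteq> 0"
    let ?O = "(\<Inter>a. {x. 0 < lcoord v a x} \<inter> {x. lcoord v a x < 1}) \<inter> {x. 0 < f x}"
    have op: "open ?O"
      by (intro open_Int open_INT open_Collect_less cl smooth_continuous f(1) continuous_on_const ballI finite)
    have "z \<in> ?O" using z \<open>f z \<noteq> 0\<close> f(3)[of z] by (auto simp: less_le)
    have "AE x in lborel. indicator (slab v 1 0 1) x * f x = 0"
      using i integral_nonneg_eq_0_iff_AE[OF cyl_integrable[OF v f(1,2)]] f(3)
      by (auto simp: cyl_integral_indicator[OF v, of _ 1] indicator_def)
    then have "AE x in lborel. x \<notin> ?O"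
      by eventually_elim (auto simp: indicator_def slab_def[OF v] less_imp_le)
    then have "?O \<in> null_sets lborel"
      using op by (subst AE_iff_null_sets) auto
    then have "negligible ?O"
      by (simp add: negligible_iff_null_sets null_sets_completionI)
    with open_not_negligible[OF op] \<open>z \<in> ?O\<close> show False by blast
  qed
  \<comment> \<open>Moving along d raises all three lattice coordinates at equal speed and thus
    leads from any point of the half-open domain into its interior.\<close>
  define d where "d = (\<Sum>a\<in>UNIV. ylift (v $ a))"
  have ld: "lcoord v a d = 1" for a
  proof -
    have "lcoord v a d = (\<Sum>b\<in>UNIV. lcoord v a (ylift (v $ b)))"
      unfolding d_def by (rule linear_sum[OF bounded_linear.linear[OF bounded_linear_lcoord[OF v]]])
    then show ?thesis by (simp add: lcoord_ylift[OF v])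
  qed
  have x': "0 \<le> lcoord v a x" "lcoord v a x < 1" for a
    using x by (auto simp: fundamental_domain_lcoord[OF v])
  have "\<forall>\<^sub>F s in at_right 0. \<forall>a. lcoord v a x + s < 1"
  proof (rule eventually_all_finite)
    fix a
    show "\<forall>\<^sub>F s in at_right 0. lcoord v a x + s < 1"
      using x'(2)[of a] by (auto simp: eventually_at_right_field intro!: exI[of _ "1 - lcoord v a x"])
  qed
  moreover have "\<forall>\<^sub>F s in at_right (0::real). 0 < s" by (simp add: eventually_at_right_less)
  ultimately have "\<forall>\<^sub>F s in at_right 0. f (x + s *\<^sub>R d) = 0"
  proof eventually_elim
    case (elim s)
    then show ?case using x'(1) by (intro U) (auto simp: lcoord_linear[OF v] ld add_nonneg_pos)
  qed
  then have 1: "((\<lambda>s. f (x + s *\<^sub>R d)) \<longlongrightarrow> 0) (at_right 0)"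
    by (rule tendsto_eventually)
  have "isCont f x"
    using smooth_continuous[OF f(1), of UNIV] by (simp add: continuous_on_eq_continuous_at)
  moreover have "((\<lambda>s. x + s *\<^sub>R d) \<longlongrightarrow> x + 0 *\<^sub>R d) (at_right 0)"
    by (intro tendsto_intros)
  ultimately have "((\<lambda>s. f (x + s *\<^sub>R d)) \<longlongrightarrow> f x) (at_right 0)"
    using isCont_tendsto_compose[of x f "\<lambda>s. x + s *\<^sub>R d"] by simp
  from tendsto_unique[OF _ 1 this] show ?thesis by simp
qed

lemma fundamental_domain_representative:
  obtains x' where "x' \<in> cyl_fundamental_domain v" "tcoord x' = tcoord x" "\<And>f. cyl_periodic v f \<Longrightarrow> f x' = f x"
proof -
  let ?w = "\<Sum>a\<in>UNIV. of_int (- \<lfloor>lcoord v a x\<rfloor>) *\<^sub>R ylift (v $ a)"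
  have "lcoord v b ?w = (\<Sum>a\<in>UNIV. of_int (- \<lfloor>lcoord v a x\<rfloor>) * lcoord v b (ylift (v $ a)))" for b
  proof -
    note l = bounded_linear.linear[OF bounded_linear_lcoord[OF v, of b]]
    show ?thesis by (simp only: linear_sum[OF l] linear_scale[OF l] real_scaleR_def)
  qed
  then have "lcoord v b (x + 1 *\<^sub>R ?w) = frac (lcoord v b x)" for b
    unfolding lcoord_linear[OF v] by (simp add: lcoord_ylift[OF v] frac_def if_distrib cong: if_cong)
  then have "x + ?w \<in> cyl_fundamental_domain v"
    unfolding fundamental_domain_lcoord[OF v] by (simp add: frac_lt_1)
  moreover have "tcoord (x + ?w) = tcoord x"
    using tcoord_ylift[OF v] by (simp add: tcoord_def)
  ultimately show thesis by (rule that) (rule periodic_of_int_sum, simp add: cyl_periodic_def)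
qed

text \<open>Testing with k times a bump that is positive at x makes the integrand a nonnegative
  multiple of |k|^2.\<close>

lemma sections_S20_orthogonal_zero:
  assumes k: "k \<in> sections_S20 v"
    and o: "\<And>h. h \<in> sections_S20 v \<Longrightarrow> compactly_supported h \<Longrightarrow> cyl_integral v (\<lambda>x. h x \<bullet> k x) = 0"
  shows "k x = 0"
proof -
  obtain x' where x': "x' \<in> cyl_fundamental_domain v" "tcoord x' = tcoord x"
    "\<And>f :: real^4 \<Rightarrow> real^4^4. cyl_periodic v f \<Longrightarrow> f x' = f x"
    using fundamental_domain_representative by blast
  define R where "R = \<bar>tcoord x\<bar> + 1"
  define h where "h = (\<lambda>x. tbump R x *\<^sub>R k x)"
  have sk: "smooth k" and kp: "cyl_periodic v k" and st: "\<And>x. sym_traceless (gcyl x) (k x)"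
    using k by (auto simp: sections_S20_def)
  have tp: "tbump R (z + ylift (v $ a)) = tbump R z" for z a
    using tcoord_ylift[OF v, of "v $ a"] by (simp add: tbump_def tcoord_def)
  have "h \<in> sections_S20 v"
    unfolding sections_S20_def mem_Collect_eq
  proof (intro conjI allI)
    show "smooth h" unfolding h_def by (intro smooth_scaleR smooth_tbump sk)
    show "cyl_periodic v h" using kp by (simp add: h_def cyl_periodic_def tp)
    show "sym_traceless (gcyl x) (h x)" for x
      using st[of x] by (simp add: h_def sym_traceless_gcyl sum_distrib_left[symmetric])
  qed
  moreover have hc: "compactly_supported h"
    unfolding compactly_supported_def h_def by (intro exI[of _ R]) (simp add: tbump_zero)
  ultimately have "cyl_integral v (\<lambda>x. h x \<bullet> k x) = 0" by (rule o)
  then have "h x' \<bullet> k x' = 0"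
  proof (rule nonneg_integral_zero[rotated 3])
    show "smooth (\<lambda>x. h x \<bullet> k x)" unfolding h_def by (intro smooth_inner smooth_scaleR smooth_tbump sk)
    show "compactly_supported (\<lambda>x. h x \<bullet> k x)"
      using hc unfolding compactly_supported_def by (metis inner_zero_left)
    show "0 \<le> h x \<bullet> k x" for x by (simp add: h_def tbump_nonneg)
  qed (rule x')
  moreover have "tbump R x' > 0" by (rule tbump_pos) (simp add: x' R_def)
  ultimately have "k x' = 0" by (simp add: h_def)
  with x'(3)[OF kp] show ?thesis by simp
qed

text \<open>\<open>Dadj\<close> is a definite description: \<open>dstar_adjoint\<close> supplies
  existence, and two candidates differ by a section orthogonal to all test sections.\<close>

lemma Dadj_eq_dstar:
  assumes Z: "Z \<in> sections_S20_asd v"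
  shows "Dadj v Z = dstar Z"
  unfolding Dadj_def
proof (rule the_equality)
  show "dstar Z \<in> sections_S20 v \<and> (\<forall>h\<in>sections_S20 v. compactly_supported h \<longrightarrow>
        cyl_integral v (\<lambda>x. (1/4) * (Dop gcyl h x \<bullet> Z x)) = cyl_integral v (\<lambda>x. h x \<bullet> dstar Z x))"
    using dstar_section[OF Z] dstar_adjoint[OF v Z] by blast
next
  fix k
  assume k: "k \<in> sections_S20 v \<and> (\<forall>h\<in>sections_S20 v. compactly_supported h \<longrightarrow>
        cyl_integral v (\<lambda>x. (1/4) * (Dop gcyl h x \<bullet> Z x)) = cyl_integral v (\<lambda>x. h x \<bullet> k x))"
  have s: "smooth k" "smooth (dstar Z)" using k dstar_section[OF Z] by (auto simp: sections_S20_def)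
  have "(\<lambda>x. k x - dstar Z x) \<in> sections_S20 v"
    using k dstar_section[OF Z] unfolding sections_S20_def
    by (auto simp: cyl_periodic_def sym_traceless_gcyl sum_subtractf intro!: smooth_diff)
  moreover have "cyl_integral v (\<lambda>x. h x \<bullet> (k x - dstar Z x)) = 0"
    if h: "h \<in> sections_S20 v" "compactly_supported h" for h
  proof -
    have sh: "smooth h" using h by (auto simp: sections_S20_def)
    have c: "compactly_supported (\<lambda>x. h x \<bullet> g x)" for g
      using h(2) unfolding compactly_supported_def by (metis inner_zero_left)
    have "cyl_integral v (\<lambda>x. h x \<bullet> (k x - dstar Z x)) = cyl_integral v (\<lambda>x. h x \<bullet> k x) - cyl_integral v (\<lambda>x. h x \<bullet> dstar Z x)"
      unfolding cyl_integral_indicator[OF v, of _ 1] inner_diff_right right_diff_distrib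
      by (rule Bochner_Integration.integral_diff) (rule cyl_integrable[OF v smooth_inner[OF sh] c]; rule s)+
    then show ?thesis using k h dstar_adjoint[OF v Z h] by simp
  qed
  ultimately have "k x - dstar Z x = 0" for x
    by (rule sections_S20_orthogonal_zero)
  then show "k = dstar Z" by auto
qed

end


section \<open>The kernels\<close>

lemma constant_if_partials_vanish:
  fixes f :: "real^'n::finite \<Rightarrow> 'b::real_normed_vector"
  assumes f: "smooth f" and "\<And>i x. partial i f x = 0"
  shows "f x = f y"
proof -
  have "(f has_derivative (\<lambda>h. 0)) (at x within UNIV)" for x
    using has_derivative_partial[OF smooth_differentiable[OF f]] assms(2) by simp
  then obtain c where "\<And>x. f x = c"
    using has_derivative_zero_constant[OF convex_UNIV, of f] by auto
  then show ?thesis by simp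
qed

lemma partial_affine:
  "partial i (\<lambda>x. c + tcoord x * d) = (\<lambda>x. if i = 1 then d else (0::real))"
proof
  fix x :: "real^4"
  have "((\<lambda>t. c + t * d) has_vector_derivative d) (at (tcoord x))"
    unfolding has_real_derivative_iff_has_vector_derivative[symmetric] by (auto intro!: derivative_eq_intros)
  from partial_eq[OF has_derivative_tcoord[OF this]]
  show "partial i (\<lambda>x. c + tcoord x * d) x = (if i = 1 then d else 0)"
    by (simp add: tcoord_axis)
qed

lemma affine_in_t:
  fixes f :: "real^4 \<Rightarrow> real"
  assumes f: "smooth f" and y: "\<And>i x. i \<noteq> 1 \<Longrightarrow> partial i f x = 0" and t: "\<And>x. partial 1 (partial 1 f) x = 0"
  shows "f x = f 0 + tcoord x * (f (axis 1 1) - f 0)"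
proof -
  have "partial i (partial 1 f) x = 0" for i x
  proof (cases "i = 1")
    case False
    have "partial i (partial 1 f) x = partial 1 (partial i f) x" by (simp add: partial_commute[OF f, of i 1])
    also have "partial i f = (\<lambda>x. 0)" using y[OF False] by auto
    finally show ?thesis by simp
  qed (simp add: t)
  then have d: "partial 1 f x = partial 1 f 0" for x
    by (rule constant_if_partials_vanish[OF smooth_partial[OF f]])
  define g where "g = (\<lambda>x. f x - (0 + tcoord x * partial 1 f 0))"
  have s: "smooth (\<lambda>x. 0 + tcoord x * partial 1 f 0)" by (intro smooth_add smooth_const smooth_mult smooth_tcoord)
  have "partial i g x = 0" for i x
    unfolding g_def partial_diff[OF smooth_differentiable[OF f] smooth_differentiable[OF s]] partial_affine
    using y d[of x] by simp
  then have c: "g x = g 0" for x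
    using constant_if_partials_vanish[of g] f s unfolding g_def by (simp add: smooth_diff)
  have "tcoord 0 = 0" "tcoord (axis 1 1) = 1" by (simp_all add: tcoord_def)
  with c[of x] c[of "axis 1 1"] have "f x = f 0 + tcoord x * partial 1 f 0" "partial 1 f 0 = f (axis 1 1) - f 0"
    by (simp_all add: g_def algebra_simps)
  then show ?thesis by simp
qed

lemma const_if_t_derivative_vanishes:
  fixes f :: "real^4 \<Rightarrow> real"
  assumes "smooth f" and "\<And>i x. i \<noteq> 1 \<Longrightarrow> partial i f x = 0" and "\<And>x. partial 1 f x = 0"
  shows "f x = f y"
  by (rule constant_if_partials_vanish[OF assms(1)]) (metis assms(2,3))

lemma qd_qd_t_only:
  assumes f: "smooth f" and y: "\<And>i x. i \<noteq> 1 \<Longrightarrow> partial i f x = 0"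
  shows "qd a j (qd b k f) x = asdq a $ 1 $ j * asdq b $ 1 $ k * partial 1 (partial 1 f) x"
proof -
  have 0: "partial q f = (\<lambda>x. 0)" if "q \<noteq> 1" for q using y[OF that] by auto
  have "partial p (partial q f) x = 0" if "p \<noteq> 1 \<or> q \<noteq> 1" for p q
  proof (cases "q = 1")
    case True
    then show ?thesis using that partial_commute[OF f, of p q] by (simp add: 0)
  qed (simp add: 0)
  then show ?thesis unfolding qd_qd[OF f] by (simp add: sum_4)
qed

text \<open>Without y-dependence the divergence is the t-derivative of the first row, so that row is
  constant. Since the first row of \<open>asdq a\<close> is a unit vector, the entry E_jk is the
  second t-derivative of g_jk, so the remaining entries are affine.\<close>

lemma kernel_affine_real:
  assumes g: "g \<in> sections_S20 v" "Fop gcyl g = 0"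
    and y: "\<And>i j k x. i \<noteq> 1 \<Longrightarrow> partial i (\<lambda>z. g z $ j $ k) x = 0"
  shows "g x $ j $ k = g 0 $ j $ k + tcoord x * (g (axis 1 1) $ j $ k - g 0 $ j $ k)"
    "g x $ 1 $ k = g 0 $ 1 $ k"
proof -
  have sg: "smooth g" and sym: "\<And>x i j. g x $ i $ j = g x $ j $ i" and tr: "\<And>x. (\<Sum>i\<in>UNIV. g x $ i $ i) = 0"
    using g(1) by (auto simp: sections_S20_def sym_traceless_gcyl)
  note s = smooth_h_entry[OF sg]
  have 1: "partial 1 (\<lambda>z. g z $ 1 $ k) x = 0" for k x
  proof -
    have "(\<Sum>i\<in>UNIV. partial i (\<lambda>z. g z $ i $ k) x) = 0"
      using g(2) unfolding Fop_zero_iff by blast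
    then show ?thesis unfolding sum_4 using y[of 2 2 k x] y[of 3 3 k x] y[of 4 4 k x] by simp
  qed
  show c1: "g x $ 1 $ k = g 0 $ 1 $ k" for k x
    by (rule const_if_t_derivative_vanishes[of "\<lambda>z. g z $ 1 $ k", OF s y 1])
  show "g x $ j $ k = g 0 $ j $ k + tcoord x * (g (axis 1 1) $ j $ k - g 0 $ j $ k)"
  proof (cases "j = 1 \<or> k = 1")
    case True
    then show ?thesis using c1[of x j] c1[of x k] c1[of "axis 1 1" j] c1[of "axis 1 1" k] sym[of _ j k] by auto
  next
    case False
    then have jk: "j \<in> {2,3,4}" "k \<in> {2,3,4}" using exhaust_4[of j] exhaust_4[of k] by auto
    show ?thesis
    proof (rule affine_in_t[OF s y])
      fix x
      have "0 = (\<Sum>p\<in>UNIV. \<Sum>q\<in>UNIV. qd j p (qd k q (\<lambda>z. g z $ p $ q)) x)"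
        using kernel_second_order[OF sg sym tr g(2)] by simp
      also have "\<dots> = (\<Sum>p\<in>UNIV. \<Sum>q\<in>UNIV. delta j p * (delta k q * partial 1 (partial 1 (\<lambda>z. g z $ p $ q)) x))"
        by (simp add: qd_qd_t_only[OF s y] asdq_row1[OF jk(1)] asdq_row1[OF jk(2)] mult.assoc)
      also have "\<dots> = partial 1 (partial 1 (\<lambda>z. g z $ j $ k)) x"
        by (simp only: sum_distrib_left[symmetric] delta_sum)
      finally show "partial 1 (partial 1 (\<lambda>z. g z $ j $ k)) x = 0" by simp
    qed auto
  qed
qed

lemma affine_second_partial: "partial p (partial q (\<lambda>x. c + tcoord x * d)) x = (0::real)"
  by (simp add: partial_affine)

lemma smooth_affine: "smooth (\<lambda>x. c + tcoord x * d)"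
  for c d :: real
  by (intro smooth_add smooth_const smooth_mult smooth_tcoord)

lemma tcoord_ylift_add: "tcoord (x + ylift y) = tcoord x"
  by (simp add: tcoord_def ylift_def vector_4)

text \<open>Second derivatives of affine fields vanish, which disposes of \<open>Dop\<close>; the
  divergence sees only the first row of D.\<close>

lemma affine_in_kernel_real:
  assumes g: "\<And>x j k. g x $ j $ k = C $ j $ k + tcoord x * D $ j $ k"
    and C: "\<And>j k. C $ j $ k = C $ k $ j" "(\<Sum>j\<in>UNIV. C $ j $ j) = 0"
    and D: "\<And>j k. D $ j $ k = D $ k $ j" "(\<Sum>j\<in>UNIV. D $ j $ j) = 0" "\<And>k. D $ 1 $ k = 0"
  shows "g \<in> sections_S20 v \<and> Fop gcyl g = 0"
proof
  have e: "(\<lambda>z. g z $ j $ k) = (\<lambda>x. C $ j $ k + tcoord x * D $ j $ k)" for j k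
    by (simp add: g fun_eq_iff)
  have sg: "smooth g"
    by (intro smooth_componentwise_vec) (simp add: e smooth_affine)
  have sym: "g x $ j $ k = g x $ k $ j" for x j k
    unfolding g C(1)[of j k] D(1)[of j k] ..
  show "g \<in> sections_S20 v"
    unfolding sections_S20_def mem_Collect_eq sym_traceless_gcyl cyl_periodic_def
  proof (intro conjI allI)
    show "(\<Sum>i\<in>UNIV. g x $ i $ i) = 0" for x
      by (simp add: g sum.distrib sum_distrib_left[symmetric] C(2) D(2))
  qed (auto simp: sg sym vec_eq_iff g tcoord_ylift_add)
  have "hess g x p q j k = 0" for x p q j k
    unfolding hess_def e by (rule affine_second_partial)
  then have "sd_hess (hess g x) a b = 0" for x a b by (simp add: sd_hess_def)
  then have "Dop gcyl g x = 0" for x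
    by (simp add: vec_eq_iff Dop_dop_coeff[OF sg] dop_coeff_eq[OF sg sym])
  moreover have "(\<Sum>i\<in>UNIV. partial i (\<lambda>z. g z $ i $ j) x) = 0" for x j
    unfolding e by (simp add: partial_affine sum_4 D(3))
  ultimately show "Fop gcyl g = 0" by (simp add: Fop_zero_iff)
qed

text \<open>Here \<open>dstar Z\<close> is -1/2 times the second t-derivative of the coordinate
  block, with zero entries where an index is 1. Entry (1,1) of the equation gives (3/2) w_1' = 0,
  the entries (1,j) give w_j' = 0, and then the second derivative of the block vanishes.\<close>

lemma adjoint_affine_real:
  assumes Z: "Z \<in> sections_S20_asd v" and w: "smooth w" and eq: "\<And>x. dstar Z x = Kop gcyl w x"
    and yZ: "\<And>i a b x. i \<noteq> 1 \<Longrightarrow> partial i (\<lambda>z. Z z $ 1 $ a $ 1 $ b) x = 0"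
    and yw: "\<And>i j x. i \<noteq> 1 \<Longrightarrow> partial i (\<lambda>z. w z $ j) x = 0"
  shows "Z x $ 1 $ a $ 1 $ b = Z 0 $ 1 $ a $ 1 $ b + tcoord x * (Z (axis 1 1) $ 1 $ a $ 1 $ b - Z 0 $ 1 $ a $ 1 $ b)"
    "w x $ j = w 0 $ j"
proof -
  have sZ: "smooth (\<lambda>z. Z z $ 1 $ a $ 1 $ b)" for a b
    using Z by (auto simp: sections_S20_asd_def intro!: smooth_intros)
  have sw: "smooth (\<lambda>z. w z $ j)" for j by (intro smooth_intros w)
  have az: "asd_sym_traceless (gcyl x) (Z x)" for x
    using Z by (auto simp: sections_S20_asd_def)
  have z0: "(\<lambda>z. Z z $ 1 $ 1 $ 1 $ b) = (\<lambda>x. 0)" "(\<lambda>z. Z z $ 1 $ a $ 1 $ 1) = (\<lambda>x. 0)" for a b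
    using asd_sym_traceless_gcyl(2,3)[OF az] by auto
  have d: "dstar Z x $ j $ k = - (1/2) * partial 1 (partial 1 (\<lambda>z. Z z $ 1 $ j $ 1 $ k)) x" for x j k
  proof -
    have "qd a j (qd b k (\<lambda>z. Z z $ 1 $ a $ 1 $ b)) x = delta j a * (delta k b * partial 1 (partial 1 (\<lambda>z. Z z $ 1 $ a $ 1 $ b)) x)" for a b
    proof (cases "a = 1 \<or> b = 1")
      case True
      then show ?thesis by (auto simp: z0)
    next
      case False
      then have ab: "a \<in> {2,3,4}" "b \<in> {2,3,4}" using exhaust_4[of a] exhaust_4[of b] by auto
      show ?thesis
        by (subst qd_qd_t_only[OF sZ], erule yZ, unfold asdq_row1[OF ab(1)] asdq_row1[OF ab(2)]) (simp add: delta_def)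
    qed
    then show ?thesis
      unfolding dstar_def vec_lambda_beta by (simp only: sum_distrib_left[symmetric] delta_sum)
  qed
  have K: "- (1/2) * partial 1 (partial 1 (\<lambda>z. Z z $ 1 $ j $ 1 $ k)) x
      = partial j (\<lambda>z. w z $ k) x + partial k (\<lambda>z. w z $ j) x - (1/2) * partial 1 (\<lambda>z. w z $ 1) x * delta j k" for x j k
    using eq[of x] d[of x j k] by (simp add: Kop_gcyl sum_4 yw)
  have w1: "partial 1 (\<lambda>z. w z $ 1) x = 0" for x
    using K[of 1 1 x] by (simp add: z0 delta_def)
  have wj: "partial 1 (\<lambda>z. w z $ j) x = 0" for x j
    using K[of 1 j x] w1[of x] yw[of j 1 x] by (cases "j = 1") (simp_all add: z0 delta_def)
  show "w x $ j = w 0 $ j"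
    by (rule const_if_t_derivative_vanishes[OF sw yw wj])
  have "partial 1 (partial 1 (\<lambda>z. Z z $ 1 $ a $ 1 $ b)) x = 0" for x
    using K[of a b x] w1[of x] wj[of a x] wj[of b x] yw[of a b x] yw[of b a x]
    by (cases "a = 1"; cases "b = 1") simp_all
  then show "Z x $ 1 $ a $ 1 $ b = Z 0 $ 1 $ a $ 1 $ b + tcoord x * (Z (axis 1 1) $ 1 $ a $ 1 $ b - Z 0 $ 1 $ a $ 1 $ b)"
    by (intro affine_in_t[OF sZ yZ])
qed

lemma affine_in_adjoint_kernel_real:
  assumes v: "det v \<noteq> 0"
    and Z: "\<And>x i j k l. Z x $ i $ j $ k $ l = (\<Sum>a\<in>{2,3,4}. \<Sum>b\<in>{2,3,4}. asdq a $ i $ j * (C $ a $ b + tcoord x * D $ a $ b) * asdq b $ k $ l)"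
    and C: "\<And>j k. C $ j $ k = C $ k $ j" "C $ 2 $ 2 + C $ 3 $ 3 + C $ 4 $ 4 = 0"
    and D: "\<And>j k. D $ j $ k = D $ k $ j" "D $ 2 $ 2 + D $ 3 $ 3 + D $ 4 $ 4 = 0"
    and w: "\<And>x. w x = w 0"
  shows "Z \<in> sections_S20_asd v \<and> Fadj v (Z, w) = 0"
proof
  have sZ: "smooth Z"
    by (intro smooth_componentwise_vec) (unfold Z, intro smooth_sum smooth_mult smooth_const smooth_affine)
  show sec: "Z \<in> sections_S20_asd v"
    unfolding sections_S20_asd_def mem_Collect_eq cyl_periodic_def
  proof (intro conjI allI)
    show "asd_sym_traceless (gcyl x) (Z x)" for x
    proof (rule asd_sym_traceless_gcyl_intro[OF Z])
      show "C $ a $ b + tcoord x * D $ a $ b = C $ b $ a + tcoord x * D $ b $ a" for a b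
        unfolding C(1)[of a b] D(1)[of a b] ..
      have "C $ 2 $ 2 + tcoord x * D $ 2 $ 2 + (C $ 3 $ 3 + tcoord x * D $ 3 $ 3) + (C $ 4 $ 4 + tcoord x * D $ 4 $ 4)
        = (C $ 2 $ 2 + C $ 3 $ 3 + C $ 4 $ 4) + tcoord x * (D $ 2 $ 2 + D $ 3 $ 3 + D $ 4 $ 4)"
        by (simp add: algebra_simps)
      then show "C $ 2 $ 2 + tcoord x * D $ 2 $ 2 + (C $ 3 $ 3 + tcoord x * D $ 3 $ 3) + (C $ 4 $ 4 + tcoord x * D $ 4 $ 4) = 0"
        by (simp add: C(2) D(2))
    qed
  qed (auto simp: sZ vec_eq_iff Z tcoord_ylift_add)
  define c where "c a b = (\<Sum>p\<in>{2,3,4}. \<Sum>q\<in>{2,3,4}. asdq p $ 1 $ a * C $ p $ q * asdq q $ 1 $ b)" for a b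
  define d where "d a b = (\<Sum>p\<in>{2,3,4}. \<Sum>q\<in>{2,3,4}. asdq p $ 1 $ a * D $ p $ q * asdq q $ 1 $ b)" for a b
  have e: "(\<lambda>z. Z z $ 1 $ a $ 1 $ b) = (\<lambda>x. c a b + tcoord x * d a b)" for a b
    unfolding Z c_def d_def sum_234 by (simp add: fun_eq_iff algebra_simps)
  have "dstar Z x = 0" for x
    unfolding vec_eq_iff dstar_def vec_lambda_beta e qd_qd[OF smooth_affine] affine_second_partial by simp
  moreover have "Kop gcyl w x = 0" for x
  proof -
    have "(\<lambda>z. w z $ j) = (\<lambda>z. w 0 $ j)" for j using w by metis
    then have "partial i (\<lambda>z. w z $ j) = (\<lambda>x. 0)" for i j using partial_const by metis
    then show ?thesis by (simp add: vec_eq_iff Kop_gcyl)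
  qed
  ultimately show "Fadj v (Z, w) = 0"
    by (simp add: Fadj_def Dadj_eq_dstar[OF v sec] fun_eq_iff)
qed

section \<open>Complex fields and the gap around the root zero\<close>

lemma partial_Re_Im:
  assumes "smooth f"
  shows "partial i (\<lambda>x. Re (f x)) = (\<lambda>x. Re (partial i f x))" "partial i (\<lambda>x. Im (f x)) = (\<lambda>x. Im (partial i f x))"
  using partial_bounded_linear[OF bounded_linear_Re smooth_differentiable[OF assms]]
    partial_bounded_linear[OF bounded_linear_Im smooth_differentiable[OF assms]] by auto

lemma smooth_complex: "smooth (\<lambda>x. Re (f x)) \<Longrightarrow> smooth (\<lambda>x. Im (f x)) \<Longrightarrow> smooth f"
  using smooth_add[OF smooth_of_real smooth_cmult[OF smooth_of_real], of "\<lambda>x. Re (f x)" "\<lambda>x. Im (f x)" \<i>]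
  by (simp add: complex_eq[symmetric])

lemma lap_Re_Im:
  assumes "smooth f"
  shows "lap (\<lambda>x. Re (f x)) = (\<lambda>x. Re (lap f x))" "lap (\<lambda>x. Im (f x)) = (\<lambda>x. Im (lap f x))"
  by (auto simp: lap_def partial_Re_Im assms smooth_partial fun_eq_iff)

text \<open>The operators act on real and imaginary parts, whereas the indicial expansion is that of
  the complex component; the two biharmonic equations are recombined before the expansion is
  used.\<close>

lemma complex_biharmonic:
  assumes "smooth (\<lambda>x. Re (f x))" "smooth (\<lambda>x. Im (f x))"
    and "\<And>x. lap (lap (\<lambda>x. Re (f x))) x = 0" "\<And>x. lap (lap (\<lambda>x. Im (f x))) x = 0"
  shows "lap (lap f) x = 0"
proof -
  have f: "smooth f" using assms smooth_complex by blast
  have "Re (lap (lap f) x) = 0" "Im (lap (lap f) x) = 0"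
    using assms(3,4)[of x] unfolding lap_Re_Im[OF f] lap_Re_Im[OF smooth_lap[OF f]] .
  then show ?thesis by (simp add: complex_eq_iff)
qed

lemma kernelF_component:
  assumes "h \<in> kernelF v lam"
  shows "smooth (\<lambda>x. h x $ j $ k)" "lap (lap (\<lambda>x. h x $ j $ k)) x = 0" "indicial_form v lam (\<lambda>x. h x $ j $ k)"
proof -
  have r: "re2 h \<in> sections_S20 v" "Fop gcyl (re2 h) = 0" and i: "im2 h \<in> sections_S20 v" "Fop gcyl (im2 h) = 0"
    and f: "indicial_form v lam (\<lambda>x. h x $ j $ k)"
    using assms by (auto simp: kernelF_def)
  have b: "smooth (\<lambda>x. g x $ j $ k) \<and> (\<forall>x. lap (lap (\<lambda>x. g x $ j $ k)) x = 0)" if "g \<in> sections_S20 v" "Fop gcyl g = 0" for g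
    using that kernel_biharmonic[of g] smooth_h_entry[of g] by (auto simp: sections_S20_def sym_traceless_gcyl)
  have c: "smooth (\<lambda>x. Re (h x $ j $ k))" "smooth (\<lambda>x. Im (h x $ j $ k))"
    "lap (lap (\<lambda>x. Re (h x $ j $ k))) x = 0" "lap (lap (\<lambda>x. Im (h x $ j $ k))) x = 0" for x
    using b[OF r] b[OF i] by (auto simp: re2_def im2_def)
  show "smooth (\<lambda>x. h x $ j $ k)" by (rule smooth_complex[OF c(1,2)])
  show "lap (lap (\<lambda>x. h x $ j $ k)) x = 0" by (rule complex_biharmonic[OF c])
  show "indicial_form v lam (\<lambda>x. h x $ j $ k)" by (rule f)
qed

lemma indicial_roots_gap:
  assumes v: "det v \<noteq> 0"
  shows "\<exists>\<epsilon>>0. \<forall>\<beta>\<in>indicial_roots v. \<bar>Re \<beta>\<bar> < \<epsilon> \<longrightarrow> \<beta> = 0"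
proof -
  obtain \<delta> where \<delta>: "\<delta> > 0" "\<And>\<mu> (u :: real^3 \<Rightarrow> complex) y. \<lbrakk>smooth u; torus_periodic v u; \<And>x. lap u x = - \<mu> * u x;
      \<mu> \<noteq> 0; cmod \<mu> \<le> \<delta>\<rbrakk> \<Longrightarrow> u y = 0"
    using small_eigenvalue[OF v] by blast
  \<comment> \<open>Since Re (\<beta>^2) is nonnegative, |\<beta>^2| is at most 2 (Re \<beta>)^2, so
    the bound sqrt (\<delta> / 2) brings the eigenvalue \<beta>^2 below \<delta>.\<close>
  have "\<beta> = 0" if \<beta>: "\<beta> \<in> indicial_roots v" and small: "\<bar>Re \<beta>\<bar> < sqrt (\<delta> / 2)" for \<beta>
  proof (rule ccontr)
    assume nz: "\<beta> \<noteq> 0"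
    obtain h where h: "h \<in> kernelF v \<beta>" "h \<noteq> 0" using \<beta> by (auto simp: indicial_roots_def)
    have no: "u y = 0" if u: "smooth u" "torus_periodic v u" "\<And>x. lap u x = - (\<beta>\<^sup>2) * u x" for u y
    proof (rule ccontr)
      assume "u y \<noteq> 0"
      then have "0 \<le> Re (\<beta>\<^sup>2)" using eigenvalue_Re_nonneg[OF v u] by blast
      then have "(Im \<beta>)\<^sup>2 \<le> (Re \<beta>)\<^sup>2" by (simp add: power2_eq_square)
      moreover have "(Re \<beta>)\<^sup>2 \<le> \<delta> / 2"
        using small \<delta>(1) by (metis abs_le_square_iff abs_of_nonneg half_gt_zero less_imp_le real_sqrt_ge_zero real_sqrt_pow2)
      ultimately have "cmod (\<beta>\<^sup>2) \<le> \<delta>" by (simp add: norm_power cmod_power2)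
      then have "u y = 0" using \<delta>(2)[OF u] nz by simp
      with \<open>u y \<noteq> 0\<close> show False by blast
    qed
    have "h x $ j $ k = 0" for x j k
      by (rule indicial_biharmonic_zero[OF kernelF_component(3,2)[OF h(1)]]) (rule no)
    then have "h = 0" by (simp add: fun_eq_iff vec_eq_iff)
    with h show False by blast
  qed
  then show ?thesis using \<delta>(1) by (intro exI[of _ "sqrt (\<delta> / 2)"]) auto
qed


section \<open>The kernels at the root zero in coordinates\<close>

lemma indicial_form_affine:
  assumes "\<And>x. f x = c + of_real (tcoord x) * d"
  shows "indicial_form v 0 f"
  unfolding indicial_form_def
  by (intro exI[of _ 1] exI[of _ "\<lambda>m y. if m = 0 then c else d"]) (simp add: assms torus_periodic_def)

text \<open>The values at \<open>0\<close> and at \<open>axis 1 1\<close>, that is at t = 0 and t =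
  1, name the constant term and the slope, so the description is a list of linear conditions on h
  itself.\<close>

lemma kernelF_0_iff:
  assumes v: "det v \<noteq> 0"
  shows "h \<in> kernelF v 0 \<longleftrightarrow>
    (\<forall>x j k. h x $ j $ k = h 0 $ j $ k + of_real (tcoord x) * (h (axis 1 1) $ j $ k - h 0 $ j $ k)) \<and>
    (\<forall>x j k. h x $ j $ k = h x $ k $ j) \<and> (\<forall>x. (\<Sum>j\<in>UNIV. h x $ j $ j) = 0) \<and>
    (\<forall>x k. h x $ 1 $ k = h 0 $ 1 $ k)" (is "_ \<longleftrightarrow> ?A h \<and> ?S h \<and> ?T h \<and> ?C h")
proof
  assume h: "h \<in> kernelF v 0"
  then have r: "re2 h \<in> sections_S20 v" "Fop gcyl (re2 h) = 0" and i: "im2 h \<in> sections_S20 v" "Fop gcyl (im2 h) = 0"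
    by (auto simp: kernelF_def)
  note c = kernelF_component[OF h]
  have y: "partial i (\<lambda>x. h x $ j $ k) x = 0" if "i \<noteq> 1" for i j k x
    by (rule indicial_biharmonic_y_independent[OF v c(3,2) that])
  have "(\<lambda>z. re2 h z $ j $ k) = (\<lambda>z. Re (h z $ j $ k))" "(\<lambda>z. im2 h z $ j $ k) = (\<lambda>z. Im (h z $ j $ k))" for j k
    by (simp_all add: re2_def im2_def)
  then have "partial i (\<lambda>z. re2 h z $ j $ k) x = 0" "partial i (\<lambda>z. im2 h z $ j $ k) x = 0" if "i \<noteq> 1" for i j k x
    using partial_Re_Im[OF c(1)] y[OF that] by simp_all
  note R = kernel_affine_real[OF r this(1)] and I = kernel_affine_real[OF i this(2)]
  have "?A h"
  proof (intro allI complex_eqI)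
    fix x j k
    show "Re (h x $ j $ k) = Re (h 0 $ j $ k + of_real (tcoord x) * (h (axis 1 1) $ j $ k - h 0 $ j $ k))"
      using R(1)[of x j k] by (simp add: re2_def)
    show "Im (h x $ j $ k) = Im (h 0 $ j $ k + of_real (tcoord x) * (h (axis 1 1) $ j $ k - h 0 $ j $ k))"
      using I(1)[of x j k] by (simp add: im2_def)
  qed
  moreover have "?C h"
  proof (intro allI complex_eqI)
    fix x k
    show "Re (h x $ 1 $ k) = Re (h 0 $ 1 $ k)" using R(2)[of x k] by (simp add: re2_def)
    show "Im (h x $ 1 $ k) = Im (h 0 $ 1 $ k)" using I(2)[of x k] by (simp add: im2_def)
  qed
  moreover have "?S h" "?T h"
    using r(1) i(1) unfolding sections_S20_def sym_traceless_gcyl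
    by (auto simp: complex_eq_iff re2_def im2_def)
  ultimately show "?A h \<and> ?S h \<and> ?T h \<and> ?C h" by blast
next
  assume "?A h \<and> ?S h \<and> ?T h \<and> ?C h"
  then have A: "?A h" and S: "?S h" and T: "?T h" and C: "?C h" by blast+
  \<comment> \<open>L stands for both \<open>Re\<close> and \<open>Im\<close>.\<close>
  have part: "(\<lambda>x. \<chi> j k. L (h x $ j $ k)) \<in> sections_S20 v \<and> Fop gcyl (\<lambda>x. \<chi> j k. L (h x $ j $ k)) = 0"
    if L: "linear L" for L :: "complex \<Rightarrow> real"
  proof (rule affine_in_kernel_real[where C = "\<chi> j k. L (h 0 $ j $ k)"
        and D = "\<chi> j k. L (h (axis 1 1) $ j $ k - h 0 $ j $ k)"], unfold vec_lambda_beta)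
    show "L (h x $ j $ k) = L (h 0 $ j $ k) + tcoord x * L (h (axis 1 1) $ j $ k - h 0 $ j $ k)" for x j k
      by (subst A[rule_format]) (simp add: linear_add[OF L] linear_scale[OF L] scaleR_conv_of_real[symmetric])
    show "L (h 0 $ j $ k) = L (h 0 $ k $ j)" "L (h (axis 1 1) $ j $ k - h 0 $ j $ k) = L (h (axis 1 1) $ k $ j - h 0 $ k $ j)" for j k
      using S[rule_format, of _ j k] by simp_all
    show "(\<Sum>j\<in>UNIV. L (h 0 $ j $ j)) = 0" "(\<Sum>j\<in>UNIV. L (h (axis 1 1) $ j $ j - h 0 $ j $ j)) = 0"
      using T by (simp_all add: linear_sum[OF L, symmetric] linear_0[OF L] sum_subtractf)
    show "L (h (axis 1 1) $ 1 $ k - h 0 $ 1 $ k) = 0" for k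
      using C[rule_format, of "axis 1 1" k] by (simp add: linear_0[OF L])
  qed
  note part[OF bounded_linear.linear[OF bounded_linear_Re], folded re2_def]
    part[OF bounded_linear.linear[OF bounded_linear_Im], folded im2_def]
  moreover have "indicial_form v 0 (\<lambda>x. h x $ j $ k)" for j k
    by (rule indicial_form_affine) (rule A[rule_format])
  ultimately show "h \<in> kernelF v 0" by (simp add: kernelF_def)
qed

text \<open>The block \<open>Z x $ 1 $ a $ 1 $ b\<close> holds the coordinates of Z in the basis of
  the anti-self-dual forms. The first condition recovers Z from it, and the next three say that it
  is affine in t, symmetric and traceless.\<close>

lemma kernelFadj_0_iff:
  assumes v: "det v \<noteq> 0"
  shows "(Z, w) \<in> kernelFadj v 0 \<longleftrightarrow>
    (\<forall>x i j k l. Z x $ i $ j $ k $ l = (\<Sum>a\<in>{2,3,4}. \<Sum>b\<in>{2,3,4}. of_real (asdq a $ i $ j) * Z x $ 1 $ a $ 1 $ b * of_real (asdq b $ k $ l))) \<and>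
    (\<forall>x a b. Z x $ 1 $ a $ 1 $ b = Z 0 $ 1 $ a $ 1 $ b + of_real (tcoord x) * (Z (axis 1 1) $ 1 $ a $ 1 $ b - Z 0 $ 1 $ a $ 1 $ b)) \<and>
    (\<forall>x a b. Z x $ 1 $ a $ 1 $ b = Z x $ 1 $ b $ 1 $ a) \<and>
    (\<forall>x. Z x $ 1 $ 2 $ 1 $ 2 + Z x $ 1 $ 3 $ 1 $ 3 + Z x $ 1 $ 4 $ 1 $ 4 = 0) \<and>
    (\<forall>x. w x = w 0)" (is "_ \<longleftrightarrow> ?D \<and> ?A \<and> ?S \<and> ?T \<and> ?C")
proof
  assume "(Z, w) \<in> kernelFadj v 0"
  then have fZ: "\<And>i j k l. indicial_form v 0 (\<lambda>x. Z x $ i $ j $ k $ l)" and fw: "\<And>i. indicial_form v 0 (\<lambda>x. w x $ i)"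
    and r: "re4 Z \<in> sections_S20_asd v" "Fadj v (re4 Z, re1 w) = 0"
    and i: "im4 Z \<in> sections_S20_asd v" "Fadj v (im4 Z, im1 w) = 0"
    by (auto simp: kernelFadj_def)
  note sZ = indicial_form_0_smooth[OF fZ] and sw = indicial_form_0_smooth[OF fw]
  have srw: "smooth (re1 w)" and siw: "smooth (im1 w)"
    unfolding re1_def[abs_def] im1_def[abs_def] by (intro smooth_vec_lambda smooth_Re smooth_Im sw)+
  have er: "dstar (re4 Z) x = Kop gcyl (re1 w) x" and ei: "dstar (im4 Z) x = Kop gcyl (im1 w) x" for x
    using r i by (simp_all add: Fadj_def Dadj_eq_dstar[OF v] fun_eq_iff)
  have cZ: "(\<lambda>z. re4 Z z $ i $ j $ k $ l) = (\<lambda>z. Re (Z z $ i $ j $ k $ l))" "(\<lambda>z. im4 Z z $ i $ j $ k $ l) = (\<lambda>z. Im (Z z $ i $ j $ k $ l))" for i j k l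
    by (simp_all add: re4_def im4_def)
  have cw: "(\<lambda>z. re1 w z $ j) = (\<lambda>z. Re (w z $ j))" "(\<lambda>z. im1 w z $ j) = (\<lambda>z. Im (w z $ j))" for j
    by (simp_all add: re1_def im1_def)
  note br = adjoint_biharmonic[OF r(1) srw er, unfolded cZ cw] and bi = adjoint_biharmonic[OF i(1) siw ei, unfolded cZ cw]
  have yZ: "partial i (\<lambda>x. Z x $ 1 $ a $ 1 $ b) x = 0" if "i \<noteq> 1" for i a b x
    by (rule indicial_biharmonic_y_independent[OF v fZ complex_biharmonic[OF smooth_Re[OF sZ] smooth_Im[OF sZ] br(2) bi(2)] that])
  have yw: "partial i (\<lambda>x. w x $ j) x = 0" if "i \<noteq> 1" for i j x
    by (rule indicial_biharmonic_y_independent[OF v fw complex_biharmonic[OF smooth_Re[OF sw] smooth_Im[OF sw] br(1) bi(1)] that])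
  have "partial i (\<lambda>x. re4 Z x $ 1 $ a $ 1 $ b) x = 0" "partial i (\<lambda>x. im4 Z x $ 1 $ a $ 1 $ b) x = 0"
    "partial i (\<lambda>x. re1 w x $ j) x = 0" "partial i (\<lambda>x. im1 w x $ j) x = 0" if "i \<noteq> 1" for i a b j x
    unfolding cZ cw partial_Re_Im[OF sZ] partial_Re_Im[OF sw] yZ[OF that] yw[OF that] by simp_all
  note R = adjoint_affine_real[OF r(1) srw er this(1,3)] and I = adjoint_affine_real[OF i(1) siw ei this(2,4)]
  have az: "asd_sym_traceless (gcyl x) (re4 Z x)" "asd_sym_traceless (gcyl x) (im4 Z x)" for x
    using r i by (auto simp: sections_S20_asd_def)
  have "?A"
  proof (intro allI complex_eqI)
    fix x a b
    show "Re (Z x $ 1 $ a $ 1 $ b) = Re (Z 0 $ 1 $ a $ 1 $ b + of_real (tcoord x) * (Z (axis 1 1) $ 1 $ a $ 1 $ b - Z 0 $ 1 $ a $ 1 $ b))"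
      using R(1)[of x a b] by (simp add: re4_def)
    show "Im (Z x $ 1 $ a $ 1 $ b) = Im (Z 0 $ 1 $ a $ 1 $ b + of_real (tcoord x) * (Z (axis 1 1) $ 1 $ a $ 1 $ b - Z 0 $ 1 $ a $ 1 $ b))"
      using I(1)[of x a b] by (simp add: im4_def)
  qed
  moreover have "?C"
  proof (intro allI, subst vec_eq_iff, intro allI complex_eqI)
    fix x j
    show "Re (w x $ j) = Re (w 0 $ j)" using R(2)[of x j] by (simp add: re1_def)
    show "Im (w x $ j) = Im (w 0 $ j)" using I(2)[of x j] by (simp add: im1_def)
  qed
  moreover have "?S"
  proof (intro allI)
    fix x a b
    show "Z x $ 1 $ a $ 1 $ b = Z x $ 1 $ b $ 1 $ a"
      using asd_sym_traceless_gcyl(1)[OF az(1)[of x], of 1 a 1 b] asd_sym_traceless_gcyl(1)[OF az(2)[of x], of 1 a 1 b]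
      by (simp add: complex_eq_iff re4_def im4_def)
  qed
  moreover have "?T"
    using asd_sym_traceless_gcyl(5)[OF az(1)] asd_sym_traceless_gcyl(5)[OF az(2)]
      asd_sym_traceless_gcyl(2)[OF az(1)] asd_sym_traceless_gcyl(2)[OF az(2)]
    by (simp add: complex_eq_iff re4_def im4_def sum_4)
  moreover have "?D"
  proof (intro allI)
    fix x i j k l
    show "Z x $ i $ j $ k $ l = (\<Sum>a\<in>{2,3,4}. \<Sum>b\<in>{2,3,4}. of_real (asdq a $ i $ j) * Z x $ 1 $ a $ 1 $ b * of_real (asdq b $ k $ l))"
      using asd_sym_traceless_gcyl(4)[OF az(1), of x i j k l] asd_sym_traceless_gcyl(4)[OF az(2), of x i j k l]
      unfolding sum_234 by (simp add: complex_eq_iff re4_def im4_def)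
  qed
  ultimately show "?D \<and> ?A \<and> ?S \<and> ?T \<and> ?C" by blast
next
  assume "?D \<and> ?A \<and> ?S \<and> ?T \<and> ?C"
  then have D: "?D" and A: "?A" and S: "?S" and T: "?T" and C: "?C" by blast+
  have D2: "Z x $ i $ j $ k $ l = (\<Sum>a\<in>{2,3,4}. \<Sum>b\<in>{2,3,4}. of_real (asdq a $ i $ j) * (Z 0 $ 1 $ a $ 1 $ b + of_real (tcoord x) * (Z (axis 1 1) $ 1 $ a $ 1 $ b - Z 0 $ 1 $ a $ 1 $ b)) * of_real (asdq b $ k $ l))" for x i j k l
    unfolding D[rule_format, of x i j k l] A[rule_format, of x] ..
  have part: "(\<lambda>x. \<chi> i j k l. L (Z x $ i $ j $ k $ l)) \<in> sections_S20_asd v \<and>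
      Fadj v (\<lambda>x. \<chi> i j k l. L (Z x $ i $ j $ k $ l), \<lambda>x. \<chi> i. L (w x $ i)) = 0"
    if L: "linear L" for L :: "complex \<Rightarrow> real"
  proof (rule affine_in_adjoint_kernel_real[OF v, where C = "\<chi> a b. L (Z 0 $ 1 $ a $ 1 $ b)"
        and D = "\<chi> a b. L (Z (axis 1 1) $ 1 $ a $ 1 $ b - Z 0 $ 1 $ a $ 1 $ b)"], unfold vec_lambda_beta)
    have Ls: "L (of_real r * z) = r * L z" "L (z * of_real r) = L z * r" for r z
      using linear_scale[OF L, of r z] by (simp_all add: scaleR_conv_of_real mult.commute)
    show "L (Z x $ i $ j $ k $ l) = (\<Sum>a\<in>{2,3,4}. \<Sum>b\<in>{2,3,4}. asdq a $ i $ j * (L (Z 0 $ 1 $ a $ 1 $ b) + tcoord x * L (Z (axis 1 1) $ 1 $ a $ 1 $ b - Z 0 $ 1 $ a $ 1 $ b)) * asdq b $ k $ l)" for x i j k l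
      by (subst D2) (simp only: linear_sum[OF L] Ls linear_add[OF L])
    show "L (Z 0 $ 1 $ a $ 1 $ b) = L (Z 0 $ 1 $ b $ 1 $ a)"
      "L (Z (axis 1 1) $ 1 $ a $ 1 $ b - Z 0 $ 1 $ a $ 1 $ b) = L (Z (axis 1 1) $ 1 $ b $ 1 $ a - Z 0 $ 1 $ b $ 1 $ a)" for a b
      using S[rule_format, of _ a b] by simp_all
    have t: "L (Z x $ 1 $ 2 $ 1 $ 2) + L (Z x $ 1 $ 3 $ 1 $ 3) + L (Z x $ 1 $ 4 $ 1 $ 4) = 0" for x
      using T[rule_format, of x] by (simp only: linear_add[OF L, symmetric] linear_0[OF L])
    show "L (Z 0 $ 1 $ 2 $ 1 $ 2) + L (Z 0 $ 1 $ 3 $ 1 $ 3) + L (Z 0 $ 1 $ 4 $ 1 $ 4) = 0"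
      "L (Z (axis 1 1) $ 1 $ 2 $ 1 $ 2 - Z 0 $ 1 $ 2 $ 1 $ 2) + L (Z (axis 1 1) $ 1 $ 3 $ 1 $ 3 - Z 0 $ 1 $ 3 $ 1 $ 3)
        + L (Z (axis 1 1) $ 1 $ 4 $ 1 $ 4 - Z 0 $ 1 $ 4 $ 1 $ 4) = 0"
      using t[of 0] t[of "axis 1 1"] unfolding linear_diff[OF L] by linarith+
    show "(\<chi> i. L (w x $ i)) = (\<chi> i. L (w 0 $ i))" for x by (simp only: C[rule_format, of x])
  qed
  note part[OF bounded_linear.linear[OF bounded_linear_Re], folded re4_def re1_def]
    part[OF bounded_linear.linear[OF bounded_linear_Im], folded im4_def im1_def]
  moreover have "indicial_form v 0 (\<lambda>x. Z x $ i $ j $ k $ l)" for i j k l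
  proof (rule indicial_form_affine)
    show "Z x $ i $ j $ k $ l = Z 0 $ i $ j $ k $ l + of_real (tcoord x) * (Z (axis 1 1) $ i $ j $ k $ l - Z 0 $ i $ j $ k $ l)" for x
      unfolding D2[of x i j k l] D[rule_format, of 0 i j k l] D[rule_format, of "axis 1 1" i j k l] sum_234
      by (simp add: algebra_simps)
  qed
  moreover have "indicial_form v 0 (\<lambda>x. w x $ i)" for i
    using C by (intro indicial_form_affine[where c = "w 0 $ i" and d = 0]) (metis add.right_neutral mult_zero_right)
  ultimately show "(Z, w) \<in> kernelFadj v 0" by (simp add: kernelFadj_def)
qed

text \<open>The coordinate maps \<phi> read off the coefficients of a combination, which makes e
  injective on I and its image independent.\<close>

lemma dual_basis_dim:
  fixes scale :: "'a::field \<Rightarrow> 'b::ab_group_add \<Rightarrow> 'b"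
  assumes "vector_space scale" and I: "finite I"
    and \<phi>: "\<And>c i. i \<in> I \<Longrightarrow> \<phi> i (\<Sum>j\<in>I. scale (c j) (e j)) = c i"
    and V: "V = range (\<lambda>c. \<Sum>j\<in>I. scale (c j) (e j))"
  shows "vector_space.dim scale V = card I" "V = module.span scale (e ` I)"
proof -
  interpret vector_space scale by fact
  have e: "(\<Sum>j\<in>I. scale (if j = i then 1 else 0) (e j)) = e i" if "i \<in> I" for i
    using I that by (simp add: if_distrib[of "\<lambda>c. scale c _"] sum.delta' cong: if_cong)
  have inj: "inj_on e I"
  proof (rule inj_onI)
    fix i j assume ij: "i \<in> I" "j \<in> I" "e i = e j"
    have "\<phi> i (e i) = 1" using \<phi>[OF ij(1), of "\<lambda>k. if k = i then 1 else 0"] e[OF ij(1)] by simp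
    moreover have "\<phi> i (e j) = (if i = j then 1 else 0)"
      using \<phi>[OF ij(1), of "\<lambda>k. if k = j then 1 else 0"] e[OF ij(2)] by simp
    ultimately show "i = j" using ij(3) by (auto split: if_splits)
  qed
  show s: "V = span (e ` I)"
  proof -
    have "span (e ` I) = range (\<lambda>u. \<Sum>i\<in>I. scale (u (e i)) (e i))"
      using I by (simp add: span_finite sum.reindex[OF inj])
    also have "\<dots> = V"
    proof -
      have "(\<Sum>j\<in>I. scale (c j) (e j)) = (\<Sum>j\<in>I. scale ((c \<circ> inv_into I e) (e j)) (e j))" for c
        using inj by (intro sum.cong) auto
      then have "V \<subseteq> range (\<lambda>u. \<Sum>i\<in>I. scale (u (e i)) (e i))" unfolding V by blast
      moreover have "range (\<lambda>u. \<Sum>i\<in>I. scale (u (e i)) (e i)) \<subseteq> V"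
        unfolding V
      proof (rule image_subsetI)
        fix u
        show "(\<Sum>i\<in>I. scale (u (e i)) (e i)) \<in> range (\<lambda>c. \<Sum>j\<in>I. scale (c j) (e j))"
          by (rule range_eqI[of _ _ "\<lambda>i. u (e i)"]) simp
      qed
      ultimately show ?thesis by blast
    qed
    finally show ?thesis ..
  qed
  have "independent (e ` I)"
  proof (rule independent_if_scalars_zero)
    fix f x assume z: "(\<Sum>x\<in>e ` I. scale (f x) x) = 0" and "x \<in> e ` I"
    then obtain i where i: "i \<in> I" "x = e i" by blast
    have z': "(\<Sum>j\<in>I. scale (f (e j)) (e j)) = 0" using z by (simp add: sum.reindex[OF inj])
    have "f (e i) = \<phi> i 0" using \<phi>[OF i(1), of "\<lambda>j. f (e j)"] z' by simp
    also have "\<phi> i 0 = 0" using \<phi>[OF i(1), of "\<lambda>j. 0"] by simp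
    finally show "f x = 0" using i by simp
  qed (use I in simp)
  then show "dim V = card I"
    unfolding s by (simp add: dim_eq_card_independent card_image[OF inj])
qed


section \<open>Explicit bases of both kernels\<close>

lemma sum_fun_eval: "(\<Sum>i\<in>I. f i) x = (\<Sum>i\<in>I. f i x)"
  by (induction I rule: infinite_finite_induct) auto

text \<open>The index sets enumerate the free entries: a traceless symmetric matrix is determined by its
  upper triangle without the last diagonal entry. The first component of an index is the power of
  \<open>t\<close>, and \<open>2\<close> stands for the 1-form part.\<close>

definition free_entries :: "(4 \<times> 4) list" where
  "free_entries = [(2,2),(3,3),(2,3),(2,4),(3,4)]"

definition tsym :: "4 \<Rightarrow> 4 \<Rightarrow> real^4^4" where
  "tsym j k = (\<chi> p q. if p = 4 \<and> q = 4 then (if j = k then - 1 else 0)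
     else if (p = j \<and> q = k) \<or> (p = k \<and> q = j) then 1 else 0)"

definition index_F :: "(nat \<times> 4 \<times> 4) set" where
  "index_F = {(0,1,1),(0,1,2),(0,1,3),(0,1,4),(0,2,2),(0,3,3),(0,2,3),(0,2,4),(0,3,4),
     (1,2,2),(1,3,3),(1,2,3),(1,2,4),(1,3,4)}"

definition basis_F :: "nat \<times> 4 \<times> 4 \<Rightarrow> real^4 \<Rightarrow> complex^4^4" where
  "basis_F = (\<lambda>(s,j,k). cplx2 (\<lambda>x. (if s = 0 then 1 else tcoord x) *\<^sub>R tsym j k))"

definition coord_F :: "nat \<times> 4 \<times> 4 \<Rightarrow> (real^4 \<Rightarrow> complex^4^4) \<Rightarrow> complex" where
  "coord_F = (\<lambda>(s,j,k) h. if s = 0 then h 0 $ j $ k else h (axis 1 1) $ j $ k - h 0 $ j $ k)"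

lemma card_index_F: "card index_F = 14" "finite index_F"
  by (simp_all add: index_F_def)

lemma tcoord_simps: "tcoord 0 = 0" "tcoord (axis 1 1) = 1"
  by (simp_all add: tcoord_def)

lemma combination_F:
  "(\<Sum>i\<in>index_F. scale2 (c i) (basis_F i)) x $ p $ q =
     c (0,1,1) * of_real (tsym 1 1 $ p $ q) + c (0,1,2) * of_real (tsym 1 2 $ p $ q)
     + c (0,1,3) * of_real (tsym 1 3 $ p $ q) + c (0,1,4) * of_real (tsym 1 4 $ p $ q)
     + (c (0,2,2) + of_real (tcoord x) * c (1,2,2)) * of_real (tsym 2 2 $ p $ q)
     + (c (0,3,3) + of_real (tcoord x) * c (1,3,3)) * of_real (tsym 3 3 $ p $ q)
     + (c (0,2,3) + of_real (tcoord x) * c (1,2,3)) * of_real (tsym 2 3 $ p $ q)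
     + (c (0,2,4) + of_real (tcoord x) * c (1,2,4)) * of_real (tsym 2 4 $ p $ q)
     + (c (0,3,4) + of_real (tcoord x) * c (1,3,4)) * of_real (tsym 3 4 $ p $ q)"
  unfolding sum_fun_eval sum_component index_F_def
  by (simp add: basis_F_def scale2_def cplx2_def algebra_simps)

lemma kernelF_0_basis:
  assumes v: "det v \<noteq> 0"
  shows "vector_space.dim scale2 (kernelF v 0) = 14" "kernelF v 0 = module.span scale2 (basis_F ` index_F)"
proof -
  have coord: "coord_F i (\<Sum>j\<in>index_F. scale2 (c j) (basis_F j)) = c i" if "i \<in> index_F" for c i
    using that unfolding index_F_def[THEN eqset_imp_iff]
    by (auto simp: coord_F_def combination_F tsym_def tcoord_simps)
  have range: "kernelF v 0 = range (\<lambda>c. \<Sum>j\<in>index_F. scale2 (c j) (basis_F j))"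
  proof (intro equalityI subsetI)
    fix h assume "h \<in> kernelF v 0"
    then have A: "h x $ j $ k = h 0 $ j $ k + of_real (tcoord x) * (h (axis 1 1) $ j $ k - h 0 $ j $ k)"
      and S: "h x $ j $ k = h x $ k $ j" and T: "(\<Sum>j\<in>UNIV. h x $ j $ j) = 0" and C: "h x $ 1 $ k = h 0 $ 1 $ k" for x j k
      unfolding kernelF_0_iff[OF v] by blast+
    have T4: "h x $ 4 $ 4 = - h x $ 1 $ 1 - h x $ 2 $ 2 - h x $ 3 $ 3" for x
      using T[of x] by (simp add: sum_4 eq_neg_iff_add_eq_0 algebra_simps)
    have "h x $ p $ q = (\<Sum>j\<in>index_F. scale2 (coord_F j h) (basis_F j)) x $ p $ q" for x p q
    proof -
      have "\<forall>p q. h x $ p $ q = (\<Sum>j\<in>index_F. scale2 (coord_F j h) (basis_F j)) x $ p $ q"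
        unfolding combination_F forall_4 coord_F_def
        by (simp add: tsym_def S[of x 2 1] S[of x 3 1] S[of x 4 1] S[of x 3 2] S[of x 4 2] S[of x 4 3] T4 C[of x]
          A[of x 2 2] A[of x 2 3] A[of x 2 4] A[of x 3 3] A[of x 3 4])
      then show ?thesis by blast
    qed
    then have eq: "h = (\<Sum>j\<in>index_F. scale2 (coord_F j h) (basis_F j))"
      by (simp add: fun_eq_iff vec_eq_iff)
    show "h \<in> range (\<lambda>c. \<Sum>j\<in>index_F. scale2 (c j) (basis_F j))"
      by (rule range_eqI, rule eq)
  next
    fix h assume "h \<in> range (\<lambda>c. \<Sum>j\<in>index_F. scale2 (c j) (basis_F j))"
    then obtain c where h: "h = (\<Sum>j\<in>index_F. scale2 (c j) (basis_F j))" by blast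
    show "h \<in> kernelF v 0"
      unfolding kernelF_0_iff[OF v] h combination_F tcoord_simps
      by (simp add: forall_4 sum_4 tsym_def algebra_simps)
  qed
  show "vector_space.dim scale2 (kernelF v 0) = 14" "kernelF v 0 = module.span scale2 (basis_F ` index_F)"
    using dual_basis_dim[OF vector_space_scale2 card_index_F(2) coord range] by (simp_all add: card_index_F)
qed

definition index_A :: "(nat \<times> 4 \<times> 4) set" where
  "index_A = {(0,2,2),(0,3,3),(0,2,3),(0,2,4),(0,3,4),(1,2,2),(1,3,3),(1,2,3),(1,2,4),(1,3,4),
     (2,1,1),(2,2,2),(2,3,3),(2,4,4)}"

definition asd_tensor :: "real^4^4 \<Rightarrow> real^4^4^4^4" where
  "asd_tensor S = (\<chi> i j k l. \<Sum>p\<in>{2,3,4}. \<Sum>q\<in>{2,3,4}. asdq p $ i $ j * S $ p $ q * asdq q $ k $ l)"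

definition basis_A :: "nat \<times> 4 \<times> 4 \<Rightarrow> (real^4 \<Rightarrow> complex^4^4^4^4) \<times> (real^4 \<Rightarrow> complex^4)" where
  "basis_A = (\<lambda>(s,a,b). if s = 2 then (0, cplx1 (\<lambda>x. axis a 1))
     else (cplx4 (\<lambda>x. (if s = 0 then 1 else tcoord x) *\<^sub>R asd_tensor (tsym a b)), 0))"

definition coord_A :: "nat \<times> 4 \<times> 4 \<Rightarrow> (real^4 \<Rightarrow> complex^4^4^4^4) \<times> (real^4 \<Rightarrow> complex^4) \<Rightarrow> complex" where
  "coord_A = (\<lambda>(s,a,b) P. if s = 2 then snd P 0 $ a else if s = 0 then fst P 0 $ 1 $ a $ 1 $ b
     else fst P (axis 1 1) $ 1 $ a $ 1 $ b - fst P 0 $ 1 $ a $ 1 $ b)"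

lemma card_index_A: "card index_A = 14" "finite index_A"
  by (simp_all add: index_A_def)

text \<open>The coordinate block at x of the combination with coefficients c.\<close>

definition coeff_A :: "(nat \<times> 4 \<times> 4 \<Rightarrow> complex) \<Rightarrow> real^4 \<Rightarrow> 4 \<Rightarrow> 4 \<Rightarrow> complex" where
  "coeff_A c x p q = (c (0,2,2) + of_real (tcoord x) * c (1,2,2)) * of_real (tsym 2 2 $ p $ q)
     + (c (0,3,3) + of_real (tcoord x) * c (1,3,3)) * of_real (tsym 3 3 $ p $ q)
     + (c (0,2,3) + of_real (tcoord x) * c (1,2,3)) * of_real (tsym 2 3 $ p $ q)
     + (c (0,2,4) + of_real (tcoord x) * c (1,2,4)) * of_real (tsym 2 4 $ p $ q)
     + (c (0,3,4) + of_real (tcoord x) * c (1,3,4)) * of_real (tsym 3 4 $ p $ q)"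

lemma combination_A:
  "fst (\<Sum>i\<in>index_A. scaleP (c i) (basis_A i)) x $ i $ j $ k $ l =
     (\<Sum>p\<in>{2,3,4}. \<Sum>q\<in>{2,3,4}. of_real (asdq p $ i $ j) * coeff_A c x p q * of_real (asdq q $ k $ l))"
  "snd (\<Sum>i\<in>index_A. scaleP (c i) (basis_A i)) x $ m =
     c (2,1,1) * of_real (axis 1 1 $ m) + c (2,2,2) * of_real (axis 2 1 $ m)
     + c (2,3,3) * of_real (axis 3 1 $ m) + c (2,4,4) * of_real (axis 4 1 $ m)"
proof -
  have fs: "fst (\<Sum>i\<in>I. f i) = (\<Sum>i\<in>I. fst (f i))" "snd (\<Sum>i\<in>I. f i) = (\<Sum>i\<in>I. snd (f i))"
    for I :: "(nat \<times> 4 \<times> 4) set" and f :: "_ \<Rightarrow> (real^4 \<Rightarrow> complex^4^4^4^4) \<times> (real^4 \<Rightarrow> complex^4)"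
    by (rule fst_sum snd_sum)+
  have t: "asd_tensor S $ i $ j $ k $ l = (\<Sum>p\<in>{2,3,4}. \<Sum>q\<in>{2,3,4}. asdq p $ i $ j * S $ p $ q * asdq q $ k $ l)" for S
    by (simp add: asd_tensor_def)
  have "fst (\<Sum>i\<in>index_A. scaleP (c i) (basis_A i)) x $ i $ j $ k $ l =
      (c (0,2,2) + of_real (tcoord x) * c (1,2,2)) * of_real (asd_tensor (tsym 2 2) $ i $ j $ k $ l)
     + (c (0,3,3) + of_real (tcoord x) * c (1,3,3)) * of_real (asd_tensor (tsym 3 3) $ i $ j $ k $ l)
     + (c (0,2,3) + of_real (tcoord x) * c (1,2,3)) * of_real (asd_tensor (tsym 2 3) $ i $ j $ k $ l)
     + (c (0,2,4) + of_real (tcoord x) * c (1,2,4)) * of_real (asd_tensor (tsym 2 4) $ i $ j $ k $ l)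
     + (c (0,3,4) + of_real (tcoord x) * c (1,3,4)) * of_real (asd_tensor (tsym 3 4) $ i $ j $ k $ l)"
    unfolding fs sum_fun_eval sum_component index_A_def
    by (simp add: basis_A_def scaleP_def cplx4_def algebra_simps)
  also have "\<dots> = (\<Sum>p\<in>{2,3,4}. \<Sum>q\<in>{2,3,4}. of_real (asdq p $ i $ j) * coeff_A c x p q * of_real (asdq q $ k $ l))"
    unfolding t coeff_A_def of_real_sum of_real_mult sum_distrib_left sum.distrib[symmetric]
    by (intro sum.cong refl) (simp add: algebra_simps)
  finally show "fst (\<Sum>i\<in>index_A. scaleP (c i) (basis_A i)) x $ i $ j $ k $ l =
     (\<Sum>p\<in>{2,3,4}. \<Sum>q\<in>{2,3,4}. of_real (asdq p $ i $ j) * coeff_A c x p q * of_real (asdq q $ k $ l))" .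
  show "snd (\<Sum>i\<in>index_A. scaleP (c i) (basis_A i)) x $ m =
     c (2,1,1) * of_real (axis 1 1 $ m) + c (2,2,2) * of_real (axis 2 1 $ m)
     + c (2,3,3) * of_real (axis 3 1 $ m) + c (2,4,4) * of_real (axis 4 1 $ m)"
    unfolding fs sum_fun_eval sum_component index_A_def
    by (simp add: basis_A_def scaleP_def cplx1_def algebra_simps)
qed

lemma combination_A_coeff:
  assumes "a \<in> {2,3,4}" "b \<in> {2,3,4}"
  shows "fst (\<Sum>i\<in>index_A. scaleP (c i) (basis_A i)) x $ 1 $ a $ 1 $ b = coeff_A c x a b"
  unfolding combination_A sum_234 using assms by (auto simp: asdq_row1 delta_def)

lemma combination_A_zero:
  "fst (\<Sum>i\<in>index_A. scaleP (c i) (basis_A i)) x $ 1 $ 1 $ 1 $ b = 0"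
  "fst (\<Sum>i\<in>index_A. scaleP (c i) (basis_A i)) x $ 1 $ a $ 1 $ 1 = 0"
  unfolding combination_A sum_234 by (simp_all add: asdq_row1 delta_def)

lemma kernelFadj_0_basis:
  assumes v: "det v \<noteq> 0"
  shows "vector_space.dim scaleP (kernelFadj v 0) = 14" "kernelFadj v 0 = module.span scaleP (basis_A ` index_A)"
proof -
  have coord: "coord_A i (\<Sum>j\<in>index_A. scaleP (c j) (basis_A j)) = c i" if "i \<in> index_A" for c i
    using that unfolding index_A_def[THEN eqset_imp_iff]
    by (auto simp: coord_A_def combination_A(2) combination_A_coeff coeff_A_def tsym_def tcoord_simps axis_nth_delta delta_def)
  have range: "kernelFadj v 0 = range (\<lambda>c. \<Sum>j\<in>index_A. scaleP (c j) (basis_A j))"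
  proof (intro equalityI subsetI)
    fix P assume "P \<in> kernelFadj v 0"
    moreover obtain Z w where P: "P = (Z, w)" by (cases P)
    ultimately have D: "Z x $ i $ j $ k $ l = (\<Sum>a\<in>{2,3,4}. \<Sum>b\<in>{2,3,4}. of_real (asdq a $ i $ j) * Z x $ 1 $ a $ 1 $ b * of_real (asdq b $ k $ l))"
      and A: "Z x $ 1 $ i $ 1 $ j = Z 0 $ 1 $ i $ 1 $ j + of_real (tcoord x) * (Z (axis 1 1) $ 1 $ i $ 1 $ j - Z 0 $ 1 $ i $ 1 $ j)"
      and S: "Z x $ 1 $ i $ 1 $ j = Z x $ 1 $ j $ 1 $ i"
      and T: "Z x $ 1 $ 2 $ 1 $ 2 + Z x $ 1 $ 3 $ 1 $ 3 + Z x $ 1 $ 4 $ 1 $ 4 = 0" and C: "w x = w 0" for x i j k l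
      using kernelFadj_0_iff[OF v] by blast+
    have T4: "Z x $ 1 $ 4 $ 1 $ 4 = - Z x $ 1 $ 2 $ 1 $ 2 - Z x $ 1 $ 3 $ 1 $ 3" for x
      using T[of x] by (simp add: eq_neg_iff_add_eq_0 algebra_simps)
    let ?c = "\<lambda>j. coord_A j P"
    have cf: "Z x $ 1 $ a $ 1 $ b = coeff_A ?c x a b" if "a \<in> {2,3,4}" "b \<in> {2,3,4}" for x a b
    proof -
      have "\<forall>a\<in>{2,3,4}. \<forall>b\<in>{2,3,4}. Z x $ 1 $ a $ 1 $ b = coeff_A ?c x a b"
        unfolding coeff_A_def coord_A_def P
        by (simp add: tsym_def S[of x 3 2] S[of x 4 2] S[of x 4 3] T4
            A[of x 2 2] A[of x 2 3] A[of x 2 4] A[of x 3 3] A[of x 3 4])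
      with that show ?thesis by blast
    qed
    have "Z x $ i $ j $ k $ l = fst (\<Sum>j\<in>index_A. scaleP (?c j) (basis_A j)) x $ i $ j $ k $ l" for x i j k l
      unfolding combination_A by (subst D) (intro sum.cong refl, simp only: cf)
    then have eqZ: "Z = fst (\<Sum>j\<in>index_A. scaleP (?c j) (basis_A j))" by (simp add: fun_eq_iff vec_eq_iff)
    have "w x $ m = snd (\<Sum>j\<in>index_A. scaleP (?c j) (basis_A j)) x $ m" for x m
    proof -
      have "\<forall>m. w x $ m = snd (\<Sum>j\<in>index_A. scaleP (?c j) (basis_A j)) x $ m"
        unfolding combination_A forall_4 C[of x] by (simp add: coord_A_def P axis_def)
      then show ?thesis by blast
    qed
    then have eqw: "w = snd (\<Sum>j\<in>index_A. scaleP (?c j) (basis_A j))" by (simp add: fun_eq_iff vec_eq_iff)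
    have "fst P = Z" "snd P = w" by (simp_all add: P)
    then have eq: "P = (\<Sum>j\<in>index_A. scaleP (?c j) (basis_A j))"
      by (intro prod_eqI) (rule trans[OF _ eqZ] trans[OF _ eqw]; assumption)+
    show "P \<in> range (\<lambda>c. \<Sum>j\<in>index_A. scaleP (c j) (basis_A j))"
      by (rule range_eqI, rule eq)
  next
    fix P assume "P \<in> range (\<lambda>c. \<Sum>j\<in>index_A. scaleP (c j) (basis_A j))"
    then obtain c where P: "P = (\<Sum>j\<in>index_A. scaleP (c j) (basis_A j))" by blast
    let ?Z = "fst (\<Sum>j\<in>index_A. scaleP (c j) (basis_A j))" and ?w = "snd (\<Sum>j\<in>index_A. scaleP (c j) (basis_A j))"
    have Z: "?Z x $ 1 $ a $ 1 $ b = (if a = 1 \<or> b = 1 then 0 else coeff_A c x a b)" for x a b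
      using combination_A_zero[of c x] combination_A_coeff[of a b c x] exhaust_4[of a] exhaust_4[of b] by auto
    have "(?Z, ?w) \<in> kernelFadj v 0"
      unfolding kernelFadj_0_iff[OF v] Z
    proof (intro conjI allI)
      fix x i j k l
      show "?Z x $ i $ j $ k $ l = (\<Sum>a\<in>{2,3,4}. \<Sum>b\<in>{2,3,4}. of_real (asdq a $ i $ j) * (if a = 1 \<or> b = 1 then 0 else coeff_A c x a b) * of_real (asdq b $ k $ l))"
        unfolding combination_A sum_234 by simp
    next
      fix x a b
      show "(if a = 1 \<or> b = 1 then 0 else coeff_A c x a b) = (if a = 1 \<or> b = 1 then 0 else coeff_A c 0 a b) + of_real (tcoord x) *
        ((if a = 1 \<or> b = 1 then 0 else coeff_A c (axis 1 1) a b) - (if a = 1 \<or> b = 1 then 0 else coeff_A c 0 a b))"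
        by (simp add: coeff_A_def tcoord_simps algebra_simps)
      have "tsym j k $ a $ b = tsym j k $ b $ a" for j k by (auto simp: tsym_def)
      then show "(if a = 1 \<or> b = 1 then 0 else coeff_A c x a b) = (if b = 1 \<or> a = 1 then 0 else coeff_A c x b a)"
        by (simp add: coeff_A_def disj_commute)
    next
      fix x
      show "(if (2::4) = 1 \<or> (2::4) = 1 then 0 else coeff_A c x 2 2) + (if (3::4) = 1 \<or> (3::4) = 1 then 0 else coeff_A c x 3 3)
        + (if (4::4) = 1 \<or> (4::4) = 1 then 0 else coeff_A c x 4 4) = 0"
        by (simp add: coeff_A_def tsym_def)
      show "?w x = ?w 0" by (simp add: vec_eq_iff combination_A)
    qed
    then show "P \<in> kernelFadj v 0" by (simp add: P)
  qed
  show "vector_space.dim scaleP (kernelFadj v 0) = 14" "kernelFadj v 0 = module.span scaleP (basis_A ` index_A)"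
    using dual_basis_dim[OF vector_space_scaleP card_index_A(2) coord range] by (simp_all add: card_index_A)
qed


definition y_index :: "4 \<Rightarrow> 3" where
  "y_index p = (if p = 2 then 1 else if p = 3 then 2 else 3)"

definition y_lift_index :: "3 \<Rightarrow> 4" where
  "y_lift_index a = (if a = 1 then 2 else if a = 2 then 3 else 4)"

text \<open>\<open>y_index\<close> translates the indices 2, 3, 4 of the cylinder to 1, 2, 3 on Y;
  its value at 1 is a dummy, guarded by the test \<open>p = 1\<close>.\<close>

lemma pull1_const: "pull1 (\<lambda>y. c) x $ p = (if p = 1 then 0 else c $ y_index p)"
proof -
  have "\<forall>p. pull1 (\<lambda>y. c) x $ p = (if p = 1 then 0 else c $ y_index p)"
    by (simp add: forall_4 pull1_def sum_3 ypart_axis y_index_def)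
  then show ?thesis by blast
qed

lemma pull2_const: "pull2 (\<lambda>y. M) x $ p $ q = (if p = 1 \<or> q = 1 then 0 else M $ y_index p $ y_index q)"
proof -
  have "\<forall>p q. pull2 (\<lambda>y. M) x $ p $ q = (if p = 1 \<or> q = 1 then 0 else M $ y_index p $ y_index q)"
    by (simp add: forall_4 pull2_def sum_3 ypart_axis y_index_def)
  then show ?thesis by blast
qed

lemma christoffel_gY [simp]: "christoffel gY x k i j = 0"
  unfolding christoffel_def gY_def by simp

lemma parallel1_gY_const:
  assumes "parallel1 gY w"
  obtains c where "w = (\<lambda>y. c)"
proof -
  have s: "smooth w" and "\<And>x k i. partial k (\<lambda>z. w z $ i) x = 0"
    using assms by (auto simp: parallel1_def nabla1_def)
  then have "w x $ i = w 0 $ i" for x i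
    by (intro constant_if_partials_vanish[of "\<lambda>z. w z $ i"] smooth_vec_nth s)
  then have "w = (\<lambda>y. w 0)" by (simp add: fun_eq_iff vec_eq_iff)
  then show thesis by (rule that)
qed

lemma parallel2_gY_const:
  assumes "parallel2 gY B"
  obtains M where "B = (\<lambda>y. M)"
proof -
  have s: "smooth B" and "\<And>x k i j. partial k (\<lambda>z. B z $ i $ j) x = 0"
    using assms by (auto simp: parallel2_def nabla2_def)
  then have "B x $ i $ j = B 0 $ i $ j" for x i j
    by (intro constant_if_partials_vanish[of "\<lambda>z. B z $ i $ j"] smooth_vec_nth s)
  then have "B = (\<lambda>y. B 0)" by (simp add: fun_eq_iff vec_eq_iff)
  then show thesis by (rule that)
qed

lemma parallel4_gcyl_const:
  assumes "parallel4 gcyl Z"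
  obtains T where "Z = (\<lambda>x. T)"
proof -
  have s: "smooth Z" and "\<And>x q i j k l. partial q (\<lambda>z. Z z $ i $ j $ k $ l) x = 0"
    using assms by (auto simp: parallel4_def nabla4_def)
  then have "Z x $ i $ j $ k $ l = Z 0 $ i $ j $ k $ l" for x i j k l
    by (intro constant_if_partials_vanish[of "\<lambda>z. Z z $ i $ j $ k $ l"] smooth_vec_nth s)
  then have "Z = (\<lambda>y. Z 0)" by (simp add: fun_eq_iff vec_eq_iff)
  then show thesis by (rule that)
qed

lemma const_in_parallel_forms_Y: "(\<lambda>y. c) \<in> parallel_forms_Y v"
  by (simp add: parallel_forms_Y_def torus_periodic_def parallel1_def nabla1_def)

lemma const_in_parallel_S20_Y:
  "(\<lambda>y. M) \<in> parallel_S20_Y v \<longleftrightarrow> (\<forall>a b. M $ a $ b = M $ b $ a) \<and> M $ 1 $ 1 + M $ 2 $ 2 + M $ 3 $ 3 = 0"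
  by (simp add: parallel_S20_Y_def torus_periodic_def parallel2_def nabla2_def sym_traceless_def gY_def sum_3 mat1_nth)

definition y_block :: "real^4^4 \<Rightarrow> real^3^3" where
  "y_block T = (\<chi> a b. T $ y_lift_index a $ y_lift_index b)"

lemma pull2_y_block:
  assumes "\<And>k. T $ 1 $ k = 0" "\<And>k. T $ k $ 1 = 0"
  shows "pull2 (\<lambda>y. y_block T) x = T"
proof -
  have "\<forall>p q. pull2 (\<lambda>y. y_block T) x $ p $ q = T $ p $ q"
    unfolding pull2_const forall_4 by (simp add: y_block_def y_index_def y_lift_index_def assms)
  then show ?thesis by (simp add: vec_eq_iff)
qed

lemma y_block_parallel:
  assumes "\<And>j k. T $ j $ k = T $ k $ j" "T $ 2 $ 2 + T $ 3 $ 3 + T $ 4 $ 4 = 0"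
  shows "(\<lambda>y. y_block T) \<in> parallel_S20_Y v"
  unfolding const_in_parallel_S20_Y using assms(1) by (simp add: y_block_def y_lift_index_def assms(2))

lemma tsym_sym: "tsym j k $ p $ q = tsym j k $ q $ p"
  by (auto simp: tsym_def)

context
  fixes v :: "real^3^3"
  assumes v: "det v \<noteq> 0"
begin

definition "gens_F = {cplx2 (\<lambda>x. 3 *\<^sub>R tens dt dt x - pull2 gY x)}
       \<union> {cplx2 (odot dt (pull1 w)) |w. w \<in> parallel_forms_Y v}
       \<union> {cplx2 (pull2 B) |B. B \<in> parallel_S20_Y v}
       \<union> {cplx2 (\<lambda>x. tcoord x *\<^sub>R pull2 B x) |B. B \<in> parallel_S20_Y v}"

lemma gens_F_kernel: "gens_F \<subseteq> kernelF v 0"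
proof
  have 1: "cplx2 (\<lambda>x. 3 *\<^sub>R tens dt dt x - pull2 gY x) \<in> kernelF v 0"
    unfolding kernelF_0_iff[OF v] cplx2_def gY_def[abs_def]
    by (simp add: forall_4 sum_4 pull2_const tens_def dt_def axis_nth_delta delta_def y_index_def mat1_nth)
  have 2: "cplx2 (odot dt (pull1 w)) \<in> kernelF v 0" if w: "w \<in> parallel_forms_Y v" for w
  proof -
    obtain c where w: "w = (\<lambda>y. c)" using w parallel1_gY_const by (auto simp: parallel_forms_Y_def)
    show ?thesis
      unfolding kernelF_0_iff[OF v] cplx2_def w
      by (simp add: forall_4 sum_4 pull1_const odot_def tens_def dt_def axis_nth_delta delta_def y_index_def)
  qed
  have 3: "cplx2 (pull2 B) \<in> kernelF v 0" "cplx2 (\<lambda>x. tcoord x *\<^sub>R pull2 B x) \<in> kernelF v 0" if B: "B \<in> parallel_S20_Y v" for B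
  proof -
    obtain M where M: "B = (\<lambda>y. M)" using B parallel2_gY_const by (auto simp: parallel_S20_Y_def)
    have m: "M $ a $ b = M $ b $ a" "M $ 1 $ 1 + M $ 2 $ 2 + M $ 3 $ 3 = 0" for a b
      using B unfolding M const_in_parallel_S20_Y by blast+
    have tr: "complex_of_real (M $ 1 $ 1) + complex_of_real (M $ 2 $ 2) + complex_of_real (M $ 3 $ 3) = 0"
      unfolding of_real_add[symmetric] m(2) by simp
    have tr': "t * complex_of_real (M $ 1 $ 1) + t * complex_of_real (M $ 2 $ 2) + t * complex_of_real (M $ 3 $ 3) = 0" for t
      unfolding distrib_left[symmetric] tr by simp
    show "cplx2 (pull2 B) \<in> kernelF v 0" "cplx2 (\<lambda>x. tcoord x *\<^sub>R pull2 B x) \<in> kernelF v 0"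
      unfolding kernelF_0_iff[OF v] cplx2_def M
      using tr tr' by (auto simp: sum_4 pull2_const y_index_def tcoord_simps m(1)[of 2 1] m(1)[of 3 1] m(1)[of 3 2])
  qed
  show "g \<in> kernelF v 0" if "g \<in> gens_F" for g
    using that 1 2 3 unfolding gens_F_def by blast
qed

text \<open>Every basis element but one is itself one of the geometric generators. The exception
  \<open>(0,1,1)\<close> is diag (1,0,0,-1), which mixes two families.\<close>

lemma basis_F_gens: "basis_F ` index_F \<subseteq> module.span scale2 gens_F"
proof -
  interpret vector_space scale2 by (rule vector_space_scale2)
  have B: "cplx2 (\<lambda>x. T) \<in> gens_F" "cplx2 (\<lambda>x. tcoord x *\<^sub>R T) \<in> gens_F"
    if T: "\<And>j k. T $ j $ k = T $ k $ j" "T $ 2 $ 2 + T $ 3 $ 3 + T $ 4 $ 4 = 0" "\<And>k. T $ 1 $ k = 0" "\<And>k. T $ k $ 1 = 0" for T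
  proof -
    have p: "pull2 (\<lambda>y. y_block T) = (\<lambda>x. T)" using pull2_y_block[OF T(3,4)] by auto
    note b = y_block_parallel[OF T(1,2), of v]
    show "cplx2 (\<lambda>x. T) \<in> gens_F" unfolding gens_F_def p[symmetric] using b by blast
    have "cplx2 (\<lambda>x. tcoord x *\<^sub>R pull2 (\<lambda>y. y_block T) x) \<in> gens_F" unfolding gens_F_def using b by blast
    then show "cplx2 (\<lambda>x. tcoord x *\<^sub>R T) \<in> gens_F" by (simp add: p)
  qed
  have free: "basis_F (0,j,k) \<in> gens_F" "basis_F (Suc 0,j,k) \<in> gens_F" if "(j,k) \<in> {(2,2),(3,3),(2,3),(2,4),(3,4)}" for j k
  proof -
    have "tsym j k $ 2 $ 2 + tsym j k $ 3 $ 3 + tsym j k $ 4 $ 4 = 0" "tsym j k $ 1 $ p = 0" "tsym j k $ p $ 1 = 0" for p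
      using that by (auto simp: tsym_def)
    from B[OF tsym_sym this] show "basis_F (0,j,k) \<in> gens_F" "basis_F (Suc 0,j,k) \<in> gens_F"
      by (simp_all add: basis_F_def)
  qed
  have mixed: "basis_F (0,1,k) \<in> gens_F" if "k \<in> {2,3,4}" for k
  proof -
    have "tsym 1 k = odot dt (pull1 (\<lambda>y. axis (y_index k) 1)) x" for x
      using that unfolding vec_eq_iff forall_4
      by (auto simp: tsym_def odot_def tens_def dt_def pull1_const axis_def y_index_def)
    then have "basis_F (0,1,k) = cplx2 (odot dt (pull1 (\<lambda>y. axis (y_index k) 1)))"
      by (simp add: basis_F_def fun_eq_iff cplx2_def)
    then show ?thesis unfolding gens_F_def using const_in_parallel_forms_Y by blast
  qed
  have "basis_F (0,1,1) \<in> span gens_F"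
  proof -
    \<comment> \<open>The difference between diag (1,0,0,-1) and one third of 3 dt^2 - g_Y: diag (0,
      1/3, 1/3, -2/3), a traceless tensor on Y.\<close>
    define T :: "real^4^4" where "T = (\<chi> p q. if p = q then (if p = 1 then 0 else if p = 4 then - 2/3 else 1/3) else 0)"
    let ?g = "cplx2 (\<lambda>x. 3 *\<^sub>R tens dt dt x - pull2 gY x)"
    have "cplx2 (\<lambda>x. T) \<in> gens_F"
      by (rule B) (auto simp: T_def)
    moreover have "?g \<in> gens_F" unfolding gens_F_def by blast
    ultimately have "scale2 (1/3) ?g + cplx2 (\<lambda>x. T) \<in> span gens_F"
      by (intro span_add span_scale span_base)
    also have "scale2 (1/3) ?g + cplx2 (\<lambda>x. T) = basis_F (0,1,1)"
      unfolding fun_eq_iff vec_eq_iff forall_4 gY_def[abs_def]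
      by (simp add: basis_F_def scale2_def cplx2_def T_def tsym_def tens_def dt_def pull2_const axis_nth_delta delta_def mat1_nth y_index_def)
    finally show ?thesis .
  qed
  moreover have "basis_F i \<in> gens_F" if "i \<in> index_F" "i \<noteq> (0,1,1)" for i
    using that unfolding index_F_def by (auto intro: free mixed)
  ultimately show ?thesis using span_base by blast
qed

definition "gens_A = {(0, cplx1 dt)}
       \<union> {(0, cplx1 (pull1 w)) |w. w \<in> parallel_forms_Y v}
       \<union> {(cplx4 Z, 0) |Z. Z \<in> parallel_S20_asd v}
       \<union> {(cplx4 (\<lambda>x. tcoord x *\<^sub>R Z x), 0) |Z. Z \<in> parallel_S20_asd v}"

lemma gens_A_kernel: "gens_A \<subseteq> kernelFadj v 0"
proof
  have 1: "(0, cplx1 dt) \<in> kernelFadj v 0"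
    unfolding kernelFadj_0_iff[OF v] by (simp add: cplx1_def dt_def)
  have 2: "(0, cplx1 (pull1 w)) \<in> kernelFadj v 0" if w: "w \<in> parallel_forms_Y v" for w
  proof -
    obtain c where w: "w = (\<lambda>y. c)" using w parallel1_gY_const by (auto simp: parallel_forms_Y_def)
    show ?thesis unfolding kernelFadj_0_iff[OF v] w by (simp add: cplx1_def pull1_const)
  qed
  have 3: "(cplx4 Z, 0) \<in> kernelFadj v 0" "(cplx4 (\<lambda>x. tcoord x *\<^sub>R Z x), 0) \<in> kernelFadj v 0" if Z: "Z \<in> parallel_S20_asd v" for Z
  proof -
    obtain T where T: "Z = (\<lambda>x. T)" using Z parallel4_gcyl_const by (auto simp: parallel_S20_asd_def)
    have "asd_sym_traceless (gcyl 0) T" using Z unfolding T by (auto simp: parallel_S20_asd_def sections_S20_asd_def)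
    note a = asd_sym_traceless_gcyl[OF this]
    have d: "complex_of_real (T $ i $ j $ k $ l) = (\<Sum>a\<in>{2,3,4}. \<Sum>b\<in>{2,3,4}. of_real (asdq a $ i $ j) * of_real (T $ 1 $ a $ 1 $ b) * of_real (asdq b $ k $ l))" for i j k l
      using arg_cong[OF a(4)[of i j k l], of complex_of_real] by (simp only: of_real_sum of_real_mult)
    have d': "t * complex_of_real (T $ i $ j $ k $ l) = (\<Sum>a\<in>{2,3,4}. \<Sum>b\<in>{2,3,4}. of_real (asdq a $ i $ j) * (t * of_real (T $ 1 $ a $ 1 $ b)) * of_real (asdq b $ k $ l))" for i j k l t
      by (subst d) (simp only: sum_distrib_left mult_ac)
    have s: "T $ 1 $ p $ 1 $ q = T $ 1 $ q $ 1 $ p" for p q by (rule a(1))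
    have "T $ 1 $ 2 $ 1 $ 2 + T $ 1 $ 3 $ 1 $ 3 + T $ 1 $ 4 $ 1 $ 4 = 0" using a(5) by (simp add: sum_4 a(2))
    then have tr: "complex_of_real (T $ 1 $ 2 $ 1 $ 2) + complex_of_real (T $ 1 $ 3 $ 1 $ 3) + complex_of_real (T $ 1 $ 4 $ 1 $ 4) = 0"
      unfolding of_real_add[symmetric] by simp
    show "(cplx4 Z, 0) \<in> kernelFadj v 0"
      unfolding kernelFadj_0_iff[OF v] cplx4_def T vec_lambda_beta
    proof (intro conjI allI)
      show "complex_of_real (T $ i $ j $ k $ l) = (\<Sum>a\<in>{2,3,4}. \<Sum>b\<in>{2,3,4}. of_real (asdq a $ i $ j) * of_real (T $ 1 $ a $ 1 $ b) * of_real (asdq b $ k $ l))" for i j k l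
        by (rule d)
      show "complex_of_real (T $ 1 $ p $ 1 $ q) = of_real (T $ 1 $ q $ 1 $ p)" for p q by (subst s) (rule refl)
    qed (use tr in simp_all)
    show "(cplx4 (\<lambda>x. tcoord x *\<^sub>R Z x), 0) \<in> kernelFadj v 0"
      unfolding kernelFadj_0_iff[OF v] cplx4_def T vec_lambda_beta vector_scaleR_component real_scaleR_def of_real_mult tcoord_simps
    proof (intro conjI allI)
      show "complex_of_real (tcoord x) * of_real (T $ i $ j $ k $ l) = (\<Sum>a\<in>{2,3,4}. \<Sum>b\<in>{2,3,4}. of_real (asdq a $ i $ j) * (of_real (tcoord x) * of_real (T $ 1 $ a $ 1 $ b)) * of_real (asdq b $ k $ l))" for x i j k l
        by (rule d')
      show "complex_of_real (tcoord x) * of_real (T $ 1 $ p $ 1 $ q) = of_real (tcoord x) * of_real (T $ 1 $ q $ 1 $ p)" for x p q by (subst s) (rule refl)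
      show "complex_of_real (tcoord x) * complex_of_real (T $ 1 $ 2 $ 1 $ 2) + complex_of_real (tcoord x) * complex_of_real (T $ 1 $ 3 $ 1 $ 3)
         + complex_of_real (tcoord x) * complex_of_real (T $ 1 $ 4 $ 1 $ 4) = 0" for x
        unfolding distrib_left[symmetric] tr by simp
    qed simp_all
  qed
  show "g \<in> kernelFadj v 0" if "g \<in> gens_A" for g
    using that 1 2 3 unfolding gens_A_def by blast
qed

lemma basis_A_gens: "basis_A ` index_A \<subseteq> gens_A"
proof -
  have parallel: "(cplx4 Z, 0) \<in> gens_A" "(cplx4 (\<lambda>x. tcoord x *\<^sub>R Z x), 0) \<in> gens_A" if "Z \<in> parallel_S20_asd v" for Z
    using that unfolding gens_A_def by blast+
  have free: "basis_A (0,j,k) \<in> gens_A" "basis_A (Suc 0,j,k) \<in> gens_A" if "(j,k) \<in> {(2,2),(3,3),(2,3),(2,4),(3,4)}" for j k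
  proof -
    have tr: "tsym j k $ 2 $ 2 + tsym j k $ 3 $ 3 + tsym j k $ 4 $ 4 = 0"
      using that by (auto simp: tsym_def)
    have "asd_sym_traceless (gcyl x) (asd_tensor (tsym j k))" for x
      by (rule asd_sym_traceless_gcyl_intro[where c = "\<lambda>a b. tsym j k $ a $ b"]) (simp_all only: asd_tensor_def vec_lambda_beta tsym_sym[of j k] tr)
    then have "(\<lambda>x. asd_tensor (tsym j k)) \<in> parallel_S20_asd v"
      by (simp add: parallel_S20_asd_def sections_S20_asd_def cyl_periodic_def parallel4_def nabla4_def)
    from parallel[OF this]
    have "(cplx4 (\<lambda>x. asd_tensor (tsym j k)), 0) \<in> gens_A" "(cplx4 (\<lambda>x. tcoord x *\<^sub>R asd_tensor (tsym j k)), 0) \<in> gens_A" .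
    then show "basis_A (0,j,k) \<in> gens_A" "basis_A (Suc 0,j,k) \<in> gens_A"
      by (simp_all add: basis_A_def)
  qed
  have t: "basis_A (2,1,1) \<in> gens_A"
  proof -
    have "cplx1 (\<lambda>x. axis 1 1) = cplx1 dt" by (simp add: fun_eq_iff cplx1_def dt_def)
    then show ?thesis by (simp add: basis_A_def gens_A_def)
  qed
  have y: "basis_A (2,k,k) \<in> gens_A" if "k \<in> {2,3,4}" for k
  proof -
    have "axis k 1 = pull1 (\<lambda>y. axis (y_index k) 1) x" for x
      using that unfolding vec_eq_iff forall_4 by (auto simp: pull1_const axis_def y_index_def)
    then have "cplx1 (\<lambda>x. axis k 1) = cplx1 (pull1 (\<lambda>y. axis (y_index k) 1))"
      by (simp add: fun_eq_iff cplx1_def)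
    then show ?thesis using const_in_parallel_forms_Y by (auto simp: basis_A_def gens_A_def)
  qed
  show ?thesis unfolding index_A_def by (auto intro: free t y)
qed

end

theorem theorem1p16:
  fixes v :: "real^3^3"
  assumes "det v \<noteq> 0"
  shows "(\<exists>\<epsilon>>0. \<forall>\<beta>\<in>indicial_roots v. \<bar>Re \<beta>\<bar> < \<epsilon> \<longrightarrow> \<beta> = 0) \<and>
    vector_space.dim scale2 (kernelF v 0) = 14 \<and>
    kernelF v 0 = module.span scale2
      ({cplx2 (\<lambda>x. 3 *\<^sub>R tens dt dt x - pull2 gY x)}
       \<union> {cplx2 (odot dt (pull1 w)) |w. w \<in> parallel_forms_Y v}
       \<union> {cplx2 (pull2 B) |B. B \<in> parallel_S20_Y v}
       \<union> {cplx2 (\<lambda>x. tcoord x *\<^sub>R pull2 B x) |B. B \<in> parallel_S20_Y v}) \<and>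
    vector_space.dim scaleP (kernelFadj v 0) = 14 \<and>
    kernelFadj v 0 = module.span scaleP
      ({(0, cplx1 dt)}
       \<union> {(0, cplx1 (pull1 w)) |w. w \<in> parallel_forms_Y v}
       \<union> {(cplx4 Z, 0) |Z. Z \<in> parallel_S20_asd v}
       \<union> {(cplx4 (\<lambda>x. tcoord x *\<^sub>R Z x), 0) |Z. Z \<in> parallel_S20_asd v})"
proof -
  note F = kernelF_0_basis[OF assms] and A = kernelFadj_0_basis[OF assms]
  interpret F: vector_space scale2 by (rule vector_space_scale2)
  interpret A: vector_space scaleP by (rule vector_space_scaleP)
  have "kernelF v 0 = F.span (gens_F v)"
  proof (rule subset_antisym)
    show "kernelF v 0 \<subseteq> F.span (gens_F v)"
      unfolding F(2) by (rule F.span_minimal[OF basis_F_gens[OF assms] F.subspace_span])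
    show "F.span (gens_F v) \<subseteq> kernelF v 0"
      unfolding F(2) by (rule F.span_minimal[OF gens_F_kernel[OF assms, unfolded F(2)] F.subspace_span])
  qed
  moreover have "kernelFadj v 0 = A.span (gens_A v)"
  proof (rule subset_antisym)
    show "kernelFadj v 0 \<subseteq> A.span (gens_A v)"
      unfolding A(2) by (rule A.span_mono[OF basis_A_gens[OF assms]])
    show "A.span (gens_A v) \<subseteq> kernelFadj v 0"
      unfolding A(2) by (rule A.span_minimal[OF gens_A_kernel[OF assms, unfolded A(2)] A.subspace_span])
  qed
  ultimately show ?thesis
    using indicial_roots_gap[OF assms] F(1) A(1) unfolding gens_F_def[OF assms] gens_A_def[OF assms] by blast
qed

end
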